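(* Let $n\ge 2$. The following four statements are equivalent: (i) $W_0^{1,1}(\mathbb{R}^n)\subset L^{n/(n-1),\infty}(\mathbb{R}^n)$ continuously, i.e. there is $c>0$ with $\sup_{t>0} t\,|\{x\in\mathbb{R}^n: |f(x)|>t\}|^{(n-1)/n}\le c\int_{\mathbb{R}^n}|\nabla f(x)|\,dx$ for all $f\in W_0^{1,1}(\mathbb{R}^n)$. (ii) There is a constant $c>0$ such that for all $f\in C_0^\infty(\mathbb{R}^n)$ and all $t>0$, $$\int_0^t s^{-1/n}\,[f^{**}(s)-f^{*}(s)]\,ds\le c\,n\int_0^t |\nabla f|^{*}(s)\,ds .$$ (iii) For every rearrangement invariant space $X$ with lower Boyd index $\alpha_X>0$ there is a constant $C=C(n,X)>0$ such that for all $f\in C_0^\infty(\mathbb{R}^n)$, $$\big\| s^{-1/n}(f^{**}(s)-f^{*}(s))\big\|_X\le C\,\big\| |\nabla f|\big\|_X .$$ (iv) $W_0^{1,1}(\mathbb{R}^n)\subset L^{n/(n-1),1}(\mathbb{R}^n)$ continuously, i.e. there is $c>0$ with $\|f\|_{L^{n/(n-1),1}}\le c\int_{\mathbb{R}^n}|\nabla f|\,dx$ for all $f\in W_0^{1,1}(\mathbb{R}^n)$.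
   Context: For a measurable $f$ on $\mathbb{R}^n$, $f^*$ denotes the non-increasing rearrangement of $|f|$ on $(0,\infty)$ and $f^{**}(t)=\frac1t\int_0^t f^*(s)\,ds$. $|E|$ is Lebesgue measure. $\|f\|_{L^{n/(n-1),1}}=\int_0^\infty f^{**}(s)s^{1-1/n}\frac{ds}{s}$. A rearrangement invariant (r.i.) space $X$ is a Banach function space (with the Fatou property) such that $f^*=g^*$ and $g\in X$ imply $f\in X$ and $\|f\|_X=\|g\|_X$; it is identified with a space of functions on $(0,\infty)$ via $\|f\|_X=\|f^*\|_X$. With $h_X(s)=\sup_{f\in X}\|f^*(\cdot/s)\|_X/\|f^*\|_X$ the norm of the dilation operator, the lower Boyd index is $\alpha_X=\sup_{s<1}\ln h_X(s)/\ln s$. *)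

theory Defs
  imports "HOL-Analysis.Analysis"
begin

definition rearr :: "'a measure \<Rightarrow> ('a \<Rightarrow> ennreal) \<Rightarrow> real \<Rightarrow> ennreal" where
  "rearr M f s = Inf {l::ennreal. emeasure M {x \<in> space M. l < f x} \<le> ennreal s}"

definition rearr2 :: "'a measure \<Rightarrow> ('a \<Rightarrow> ennreal) \<Rightarrow> real \<Rightarrow> ennreal" where
  "rearr2 M f t = (\<integral>\<^sup>+ s \<in> {0<..<t}. rearr M f s \<partial>lborel) / ennreal t"

definition fstar :: "(real^'n \<Rightarrow> real) \<Rightarrow> real \<Rightarrow> ennreal" where
  "fstar f = rearr lebesgue (\<lambda>x. ennreal \<bar>f x\<bar>)"

definition fstarstar :: "(real^'n \<Rightarrow> real) \<Rightarrow> real \<Rightarrow> ennreal" where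
  "fstarstar f = rearr2 lebesgue (\<lambda>x. ennreal \<bar>f x\<bar>)"

text \<open>Power on ennreal (infinity stays infinity), used for p > 0.\<close>
definition enn_powr :: "ennreal \<Rightarrow> real \<Rightarrow> ennreal" where
  "enn_powr x p = (if x = \<infinity> then \<infinity> else ennreal (enn2real x powr p))"

definition lorentz_norm :: "(real^'n \<Rightarrow> real) \<Rightarrow> ennreal" where
  "lorentz_norm f = (\<integral>\<^sup>+ s \<in> {0<..}. fstarstar f s *
      ennreal (s powr (1 - 1 / real CARD('n)) / s) \<partial>lborel)"

definition pderiv_i :: "'n \<Rightarrow> (real^'n \<Rightarrow> real) \<Rightarrow> real^'n \<Rightarrow> real" where
  "pderiv_i i g x = frechet_derivative g (at x) (axis i 1)"

fun iter_pderiv :: "'n list \<Rightarrow> (real^'n \<Rightarrow> real) \<Rightarrow> real^'n \<Rightarrow> real" where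
  "iter_pderiv [] g = g"
| "iter_pderiv (i # is) g = pderiv_i i (iter_pderiv is g)"

definition smooth_fun :: "(real^'n \<Rightarrow> real) \<Rightarrow> bool" where
  "smooth_fun g \<longleftrightarrow> (\<forall>is x. iter_pderiv is g differentiable (at x))"

definition test_fun :: "(real^'n \<Rightarrow> real) \<Rightarrow> bool" where
  "test_fun g \<longleftrightarrow> smooth_fun g \<and> compact (closure {x. g x \<noteq> 0})"

definition grad :: "(real^'n \<Rightarrow> real) \<Rightarrow> real^'n \<Rightarrow> real^'n" where
  "grad g x = (\<chi> i. pderiv_i i g x)"

text \<open>W_0^{1,1}(R^n): closure of C_0^infinity in the W^{1,1} norm. W01 f G means f lies in
  W_0^{1,1} with (weak) gradient G, i.e. some test functions phi_k converge to f in L^1 and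
  their gradients converge to G in L^1.\<close>
definition W01 :: "(real^'n \<Rightarrow> real) \<Rightarrow> (real^'n \<Rightarrow> real^'n) \<Rightarrow> bool" where
  "W01 f G \<longleftrightarrow> integrable lebesgue f \<and> integrable lebesgue G \<and>
     (\<exists>\<phi>::nat \<Rightarrow> real^'n \<Rightarrow> real. (\<forall>k. test_fun (\<phi> k)) \<and>
        (\<lambda>k. \<integral>\<^sup>+ x. ennreal \<bar>\<phi> k x - f x\<bar> \<partial>lebesgue) \<longlonglongrightarrow> 0 \<and>
        (\<lambda>k. \<integral>\<^sup>+ x. ennreal (norm (grad (\<phi> k) x - G x)) \<partial>lebesgue) \<longlonglongrightarrow> 0)"

abbreviation M0 :: "real measure" where
  "M0 \<equiv> lebesgue_on {0<..}"

text \<open>A rearrangement invariant Banach function norm rho on (0,oo) (Bennett-Sharpley axioms,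
  including the Fatou property), acting on non-negative measurable functions. The r.i. space
  X is {f. rho |f| < oo}, and ||f||_X = rho(|f|); for functions on R^n, ||f||_X = rho(f*).\<close>
definition ri_norm :: "((real \<Rightarrow> ennreal) \<Rightarrow> ennreal) \<Rightarrow> bool" where
  "ri_norm \<rho> \<longleftrightarrow>
    (\<forall>f \<in> borel_measurable M0. \<rho> f = 0 \<longleftrightarrow> (AE x in M0. f x = 0)) \<and>
    (\<forall>f \<in> borel_measurable M0. \<forall>a::real. a \<ge> 0 \<longrightarrow> \<rho> (\<lambda>x. ennreal a * f x) = ennreal a * \<rho> f) \<and>
    (\<forall>f \<in> borel_measurable M0. \<forall>g \<in> borel_measurable M0. \<rho> (\<lambda>x. f x + g x) \<le> \<rho> f + \<rho> g) \<and>
    (\<forall>f \<in> borel_measurable M0. \<forall>g \<in> borel_measurable M0.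
        (AE x in M0. g x \<le> f x) \<longrightarrow> \<rho> g \<le> \<rho> f) \<and>
    (\<forall>F::nat \<Rightarrow> real \<Rightarrow> ennreal. (\<forall>k. F k \<in> borel_measurable M0) \<longrightarrow>
        (AE x in M0. incseq (\<lambda>k. F k x)) \<longrightarrow>
        \<rho> (\<lambda>x. SUP k. F k x) = (SUP k. \<rho> (F k))) \<and>
    (\<forall>E \<in> sets M0. emeasure M0 E < \<infinity> \<longrightarrow> \<rho> (indicator E) < \<infinity>) \<and>
    (\<forall>E \<in> sets M0. emeasure M0 E < \<infinity> \<longrightarrow>
        (\<exists>C::real. \<forall>f \<in> borel_measurable M0. (\<integral>\<^sup>+ x \<in> E. f x \<partial>M0) \<le> ennreal C * \<rho> f)) \<and>
    (\<forall>f \<in> borel_measurable M0. \<forall>g \<in> borel_measurable M0.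
        (\<forall>s>0. rearr M0 f s = rearr M0 g s) \<longrightarrow> \<rho> f = \<rho> g)"

definition dilation_norm :: "((real \<Rightarrow> ennreal) \<Rightarrow> ennreal) \<Rightarrow> real \<Rightarrow> ennreal" where
  "dilation_norm \<rho> s = (SUP f \<in> {f \<in> borel_measurable M0. 0 < \<rho> f \<and> \<rho> f < \<infinity>}.
      \<rho> (\<lambda>t. rearr M0 f (t / s)) / \<rho> (rearr M0 f))"

definition lower_boyd :: "((real \<Rightarrow> ennreal) \<Rightarrow> ennreal) \<Rightarrow> ereal" where
  "lower_boyd \<rho> = (SUP s \<in> {0<..<1}. ereal (ln (enn2real (dilation_norm \<rho> s)) / ln s))"

end

(* All four statements hold. If |f| >= b on E and f has compact support, every coordinate line through a point of E
   carries at least b - a of the integral of |grad f| over A = {a < |f| <= b}. A slicing argument in the spirit of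
   Gagliardo and Loomis-Whitney turns this into (b - a) |E|^(1 - 1/n) <= n * (integral of |grad f| over A).
   With a and b the values of f* at consecutive dyadic points t/2^j the sets A are disjoint, and geometric summation
   gives (ii). As t tends to infinity the same sums give (iv) for test functions; Fatou's lemma extends (iv) to
   W_0^{1,1}, and (iv) implies (i). For (iii) put D = f** - f*. Since s D(s) is increasing, s^(-1/n) D(s) has a
   decreasing majorant dominated by a sum of dilates of itself. By (ii) the integrals of this sum over (0,t) are at most
   a constant times those of the same sum of dilates of the rearranged gradient, whose norm is bounded by a geometric
   series because the Boyd index is positive; a Hardy-Littlewood-Polya argument compares the norms. *)
theory Submission
  imports Defs
begin

section \<open>Measure bounds from line integrals\<close>

text \<open>Slabs between levels are used because their gradient integrals add up without overlap:
  all slabs above the level \<open>fstar f t\<close> lie in a set of measure at most t, and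
  Hardy-Littlewood bounds the gradient integral over that set by the rearranged gradient on (0,t).
  This localization is what (ii) demands beyond a bound by the full gradient integral. Two dyadic
  recursions are summed. For s^(1 - 1/n) D(s) the value at one scale is at most 2^(-1/n) times the
  value at half the scale plus a slab term; for s^(1 - 1/n) \<open>fstar f s\<close> it is the
  smaller scale that is controlled by the larger one, with factor 2^(-(1 - 1/n)). Their boundary
  terms sit at opposite ends: boundedness of f removes the one at 0, compact support the one at
  large t. In (iii) the obstacle is that comparing integrals over (0,t) yields a comparison of norms
  only for decreasing functions, and s^(-1/n) D(s) need not decrease. The decreasing majorant costs
  a series of dilates, and its convergence is where the Boyd index enters, through a single \<sigma>
  < 1 of dilation norm below 1.\<close>

lemma ennreal_power_le_imp_le:
  fixes a b :: ennreal
  assumes "a ^ m \<le> b ^ m" "0 < m"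
  shows "a \<le> b"
proof (cases "a = top \<or> b = top")
  case True
  then show ?thesis using assms by (auto simp: ennreal_top_eq_mult_iff power_eq_top_ennreal top_unique)
next
  case False
  then obtain r s where "a = ennreal r" "b = ennreal s" "0 \<le> r" "0 \<le> s"
    by (metis ennreal_cases)
  then show ?thesis using assms by (auto simp: ennreal_power dest: power_le_imp_le_base[of r "m - 1"])
qed

text \<open>Induction on the coordinates. A slice in the new direction i has measure at most W,
  because its points lie on lines in direction i of weight at least 1, and it also obeys the
  inductive bound. Multiplying the two and taking m-th roots gives a bound linear in
  \<open>S t\<close>, which can be integrated over t without Hoelder's inequality. For one
  coordinate the left side is a 0-th power, that is 1, so E must be nonempty.\<close>

lemma (in product_sigma_finite) lines_imp_measure_bound:
  assumes "finite I" "I \<noteq> {}"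
    and "E \<in> sets (Pi\<^sub>M I M)" "emeasure (Pi\<^sub>M I M) E > 0"
    and "\<And>i. i \<in> I \<Longrightarrow> w i \<in> borel_measurable (Pi\<^sub>M I M)"
    and "\<And>x i. x \<in> E \<Longrightarrow> i \<in> I \<Longrightarrow> 1 \<le> (\<integral>\<^sup>+ y. w i (x(i := y)) \<partial>M i)"
  shows "emeasure (Pi\<^sub>M I M) E ^ (card I - 1) \<le> (\<Sum>i\<in>I. \<integral>\<^sup>+ x. w i x \<partial>Pi\<^sub>M I M) ^ card I"
  using assms
proof (induction I arbitrary: E w rule: finite_ne_induct)
  case (singleton i)
  then have "E \<noteq> {}" by auto
  then obtain x where x: "x \<in> E" by blast
  with singleton(1) have "x \<in> space (Pi\<^sub>M {i} M)" using sets.sets_into_space by blast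
  then have "x(i := y) = (\<lambda>_. undefined)(i := y)" for y
    by (auto simp: space_PiM PiE_def extensional_def)
  then have "(\<integral>\<^sup>+ y. w i (x(i := y)) \<partial>M i) = (\<integral>\<^sup>+ x. w i x \<partial>Pi\<^sub>M {i} M)"
    using singleton(3) by (subst product_nn_integral_insert) (auto simp: nn_integral_count_space_finite PiM_empty simp del: fun_upd_apply)
  with singleton(4)[OF x, of i] show ?case by (simp del: fun_upd_apply)
next
  case (insert i I)
  note [measurable] = insert.prems(1)
  have w[measurable]: "\<And>j. j \<in> insert i I \<Longrightarrow> w j \<in> borel_measurable (Pi\<^sub>M (insert i I) M)"
    using insert.prems(3) by blast
  let ?P = "Pi\<^sub>M I M" and ?Q = "Pi\<^sub>M (insert i I) M"
  define W where "W = (\<integral>\<^sup>+ x. w i x \<partial>?Q)"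
  define S where "S t = (\<Sum>j\<in>I. \<integral>\<^sup>+ x. w j (x(i := t)) \<partial>?P)" for t
  define E' where "E' t = {x \<in> space ?P. x(i := t) \<in> E}" for t
  define m where "m = card I"
  have m: "m \<ge> 1" using insert by (simp add: m_def Suc_le_eq card_gt_0_iff)
  have upd: "(\<lambda>x. x(i := t)) \<in> measurable ?P ?Q" if "t \<in> space (M i)" for t
    using that by measurable
  have E'm: "E' t \<in> sets ?P" if "t \<in> space (M i)" for t
  proof -
    have "E' t = (\<lambda>x. x(i := t)) -` E \<inter> space ?P" by (auto simp: E'_def)
    then show ?thesis using measurable_sets[OF upd[OF that] insert.prems(1)] by simp
  qed
  have spE: "x(i := t) \<in> E \<Longrightarrow> x \<in> space ?P \<Longrightarrow> t \<in> space (M i)" for x t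
    using sets.sets_into_space[OF insert.prems(1)] by (force simp: space_PiM PiE_def)
  have E'W: "emeasure ?P (E' t) \<le> W" if t: "t \<in> space (M i)" for t
  proof -
    have "emeasure ?P (E' t) = (\<integral>\<^sup>+ x. indicator (E' t) x \<partial>?P)"
      using E'm[OF t] by simp
    also have "\<dots> \<le> (\<integral>\<^sup>+ x. (\<integral>\<^sup>+ y. w i (x(i := y)) \<partial>M i) \<partial>?P)"
    proof (intro nn_integral_mono)
      fix x assume "x \<in> space ?P"
      show "indicator (E' t) x \<le> (\<integral>\<^sup>+ y. w i (x(i := y)) \<partial>M i)"
        using insert.prems(4)[of "x(i := t)" i] by (auto simp: E'_def indicator_def simp del: fun_upd_apply)
    qed
    also have "\<dots> = W"
      unfolding W_def using insert by (subst product_nn_integral_insert) auto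
    finally show ?thesis .
  qed
  have slice: "emeasure ?P (E' t) ^ m \<le> W * S t ^ m" if t: "t \<in> space (M i)" for t
  proof (cases "emeasure ?P (E' t) = 0")
    case True
    then show ?thesis using m by (simp add: power_0_left)
  next
    case False
    have "emeasure ?P (E' t) ^ (m - 1) \<le> S t ^ m"
      unfolding m_def S_def
    proof (rule insert.IH)
      show "E' t \<in> sets ?P" using E'm[OF t] .
      show "0 < emeasure ?P (E' t)" using False by (simp add: zero_less_iff_neq_zero)
      show "(\<lambda>x. w j (x(i := t))) \<in> borel_measurable ?P" if "j \<in> I" for j
        using measurable_compose[OF upd[OF t] w[of j]] that by simp
      fix x j assume x: "x \<in> E' t" and j: "j \<in> I"
      then have "j \<noteq> i" using insert by auto
      then show "1 \<le> (\<integral>\<^sup>+ y. w j (x(j := y, i := t)) \<partial>M j)"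
        using insert.prems(4)[of "x(i := t)" j] x j by (simp add: E'_def fun_upd_twist del: fun_upd_apply)
    qed
    then have "emeasure ?P (E' t) * emeasure ?P (E' t) ^ (m - 1) \<le> W * S t ^ m"
      by (intro mult_mono E'W t) auto
    then show ?thesis using m by (simp add: power_eq_if)
  qed
  interpret P: sigma_finite_measure ?P using insert by (intro sigma_finite)
  have meas: "(\<lambda>t. \<integral>\<^sup>+ x. w j (x(i := t)) \<partial>?P) \<in> borel_measurable (M i)" if "j \<in> I" for j
  proof -
    have [measurable]: "w j \<in> borel_measurable ?Q" using that by (intro w) simp
    show ?thesis by measurable
  qed
  have Sint: "(\<integral>\<^sup>+ t. S t \<partial>M i) = (\<Sum>j\<in>I. \<integral>\<^sup>+ x. w j x \<partial>?Q)"
    unfolding S_def using insert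
    by (subst nn_integral_sum) (auto simp: product_nn_integral_insert_rev intro!: meas)
  have Eint: "emeasure ?Q E = (\<integral>\<^sup>+ t. emeasure ?P (E' t) \<partial>M i)"
  proof -
    have "emeasure ?Q E = (\<integral>\<^sup>+ x. indicator E x \<partial>?Q)" by simp
    also have "\<dots> = (\<integral>\<^sup>+ t. (\<integral>\<^sup>+ x. indicator E (x(i := t)) \<partial>?P) \<partial>M i)"
      using insert by (subst product_nn_integral_insert_rev) auto
    also have "\<dots> = (\<integral>\<^sup>+ t. emeasure ?P (E' t) \<partial>M i)"
    proof (rule nn_integral_cong)
      fix t assume t: "t \<in> space (M i)"
      have "(\<integral>\<^sup>+ x. indicator E (x(i := t)) \<partial>?P) = (\<integral>\<^sup>+ x. indicator (E' t) x \<partial>?P)"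
        by (intro nn_integral_cong) (auto simp: E'_def indicator_def)
      then show "(\<integral>\<^sup>+ x. indicator E (x(i := t)) \<partial>?P) = emeasure ?P (E' t)"
        using E'm[OF t] by simp
    qed
    finally show ?thesis .
  qed
  have W0: "W \<noteq> 0"
  proof
    assume "W = 0"
    then have "(\<integral>\<^sup>+ t. emeasure ?P (E' t) \<partial>M i) = (\<integral>\<^sup>+ t. 0 \<partial>M i)"
      using E'W by (intro nn_integral_cong) auto
    then show False using Eint insert.prems(2) by simp
  qed
  define T where "T = (\<Sum>j\<in>I. \<integral>\<^sup>+ x. w j x \<partial>?Q)"
  have sum: "(\<Sum>j\<in>insert i I. \<integral>\<^sup>+ x. w j x \<partial>?Q) = W + T"
    using insert by (simp add: W_def T_def)
  have "emeasure ?Q E ^ m \<le> (W + T) ^ Suc m"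
  proof (cases "W = \<infinity>")
    case True
    then show ?thesis by (simp add: ennreal_top_mult)
  next
    case False
    define r where "r = ennreal (root m (enn2real W))"
    have r: "r ^ m = W"
      using m False by (simp add: r_def ennreal_power less_top)
    have "emeasure ?P (E' t) \<le> r * S t" if "t \<in> space (M i)" for t
    proof -
      have "emeasure ?P (E' t) ^ m \<le> (r * S t) ^ m"
        using slice[OF that] by (simp add: power_mult_distrib r)
      then show ?thesis by (rule ennreal_power_le_imp_le) (use m in simp)
    qed
    then have "emeasure ?Q E \<le> (\<integral>\<^sup>+ t. r * S t \<partial>M i)"
      unfolding Eint by (intro nn_integral_mono) auto
    also have "\<dots> = r * T"
      unfolding T_def Sint[symmetric] S_def
      using insert by (intro nn_integral_cmult) (auto intro!: borel_measurable_sum meas)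
    finally have "emeasure ?Q E ^ m \<le> (r * T) ^ m"
      by (intro power_mono) auto
    also have "\<dots> = W * T ^ m"
      by (simp add: power_mult_distrib r)
    also have "\<dots> \<le> (W + T) * (W + T) ^ m"
      by (intro mult_mono power_mono) auto
    finally show ?thesis by simp
  qed
  then show ?case
    unfolding sum using insert by (simp add: m_def)
qed

text \<open>Take for u the last point of [p,q] with A at most a, and for v the first point after u
  with A at least b; extremality of both gives the strict inequalities in between.\<close>

lemma continuous_crossing:
  fixes A :: "real \<Rightarrow> real"
  assumes pq: "p \<le> q" and cont: "continuous_on {p..q} A" and a: "A p \<le> a" and b: "b \<le> A q" and ab: "a < b"
  obtains u v where "u < v" "A u \<le> a" "b \<le> A v" "\<And>y. u < y \<Longrightarrow> y < v \<Longrightarrow> a < A y \<and> A y < b"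
proof -
  define P where "P = {y \<in> {p..q}. A y \<le> a}"
  have "compact P"
    unfolding P_def compact_eq_bounded_closed using cont
    by (intro conjI continuous_on_closed_Collect_le) (auto intro: bounded_subset[of "{p..q}"])
  moreover have "P \<noteq> {}" using pq a by (auto simp: P_def)
  ultimately obtain u where u: "u \<in> P" "\<And>y. y \<in> P \<Longrightarrow> y \<le> u"
    using compact_attains_sup[of P] by blast
  define Q where "Q = {y \<in> {u..q}. b \<le> A y}"
  have "continuous_on {u..q} A"
    using cont u by (auto simp: P_def intro: continuous_on_subset)
  then have "compact Q"
    unfolding Q_def compact_eq_bounded_closed
    by (intro conjI continuous_on_closed_Collect_le) (auto intro: bounded_subset[of "{u..q}"])
  moreover have "Q \<noteq> {}" using u b by (auto simp: P_def Q_def)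
  ultimately obtain v where v: "v \<in> Q" "\<And>y. y \<in> Q \<Longrightarrow> v \<le> y"
    using compact_attains_inf[of Q] by blast
  show ?thesis
  proof (rule that[of u v])
    show "u < v" "A u \<le> a" "b \<le> A v"
      using u(1) v(1) ab by (auto simp: P_def Q_def order_less_le)
    fix y assume "u < y" "y < v"
    then show "a < A y \<and> A y < b"
      using u(1) u(2)[of y] v(1) v(2)[of y] by (force simp: P_def Q_def)
  qed
qed

text \<open>Between x and the zero z there is an interval inside which |F| stays strictly between a
  and b and across which F changes by at least b - a; the fundamental theorem of calculus applies
  there. The endpoints may leave the slab, which costs only a null set.\<close>

lemma line_crossing_integral:
  fixes F F' :: "real \<Rightarrow> real"
  assumes F: "\<And>y. (F has_real_derivative F' y) (at y)" and cont: "continuous_on UNIV F'"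
    and ab: "0 \<le> a" "a < b" and x: "b \<le> \<bar>F x\<bar>" and z: "F z = 0"
  shows "ennreal (b - a) \<le> (\<integral>\<^sup>+ y. ennreal \<bar>F' y\<bar> * indicator {y. a < \<bar>F y\<bar> \<and> \<bar>F y\<bar> \<le> b} y \<partial>lborel)"
proof -
  have contA: "continuous_on S (\<lambda>y. \<bar>F y\<bar>)" for S
    using F by (intro continuous_intros) (meson DERIV_continuous_on DERIV_subset subset_UNIV)
  obtain u v where uv: "u < v" "b - a \<le> \<bar>F v - F u\<bar>"
    and between: "\<And>y. u < y \<Longrightarrow> y < v \<Longrightarrow> a < \<bar>F y\<bar> \<and> \<bar>F y\<bar> < b"
  proof (cases "z \<le> x")
    case True
    obtain u v where "u < v" "\<bar>F u\<bar> \<le> a" "b \<le> \<bar>F v\<bar>" "\<And>y. u < y \<Longrightarrow> y < v \<Longrightarrow> a < \<bar>F y\<bar> \<and> \<bar>F y\<bar> < b"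
      by (rule continuous_crossing[OF True contA, of a b]) (use ab x z in auto)
    then show ?thesis by (intro that[of u v]) auto
  next
    case False
    \<comment> \<open>With z to the right of x the values fall instead of rising, so the crossing is
      taken for -|F| from -b to -a.\<close>
    obtain u v where "u < v" "- \<bar>F u\<bar> \<le> - b" "- a \<le> - \<bar>F v\<bar>"
        "\<And>y. u < y \<Longrightarrow> y < v \<Longrightarrow> - b < - \<bar>F y\<bar> \<and> - \<bar>F y\<bar> < - a"
      by (rule continuous_crossing[of x z "\<lambda>y. - \<bar>F y\<bar>" "- b" "- a"])
        (use ab x z False contA in \<open>auto intro!: continuous_on_minus\<close>)
    then show ?thesis by (intro that[of u v]) auto
  qed
  have FTC: "has_bochner_integral lborel (\<lambda>x. indicator {u..v} x *\<^sub>R F' x) (F v - F u)"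
    using uv F cont
    by (intro has_bochner_integral_FTC_Icc)
      (auto simp: has_real_derivative_iff_has_vector_derivative intro: has_vector_derivative_at_within continuous_on_subset)
  have "ennreal (b - a) \<le> ennreal (norm (\<integral>x. indicator {u..v} x *\<^sub>R F' x \<partial>lborel))"
    using uv FTC by (simp add: has_bochner_integral_integral_eq ennreal_leI)
  also have "\<dots> \<le> (\<integral>\<^sup>+ x. norm (indicator {u..v} x *\<^sub>R F' x) \<partial>lborel)"
    using FTC by (intro integral_norm_bound_ennreal) (auto simp: has_bochner_integral_iff)
  also have "\<dots> \<le> (\<integral>\<^sup>+ y. ennreal \<bar>F' y\<bar> * indicator {y. a < \<bar>F y\<bar> \<and> \<bar>F y\<bar> \<le> b} y \<partial>lborel)"
  proof (rule nn_integral_mono_AE)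
    have "AE y in lborel. y \<noteq> u \<and> y \<noteq> v"
      by (intro AE_conjI AE_lborel_singleton)
    then show "AE y in lborel. ennreal (norm (indicator {u..v} y *\<^sub>R F' y))
        \<le> ennreal \<bar>F' y\<bar> * indicator {y. a < \<bar>F y\<bar> \<and> \<bar>F y\<bar> \<le> b} y"
    proof eventually_elim
      case (elim y)
      then show ?case using between[of y] by (auto simp: indicator_def)
    qed
  qed
  finally show ?thesis .
qed

section \<open>Decreasing rearrangements\<close>

lemma rearr_antimono: "s \<le> t \<Longrightarrow> rearr M f t \<le> rearr M f s"
  unfolding rearr_def by (intro Inf_superset_mono) (auto intro: order_trans ennreal_leI)

text \<open>The infimum defining \<open>rearr\<close> is attained: countably many levels decreasing
  to l exhaust {f > l} by an increasing union, so a bound s on their measures survives. Every later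
  fact on rearrangements is reduced to distribution functions by this equivalence.\<close>

lemma less_rearr_iff:
  assumes "f \<in> borel_measurable M"
  shows "l < rearr M f s \<longleftrightarrow> ennreal s < emeasure M {x \<in> space M. l < f x}"
proof
  assume "l < rearr M f s"
  then show "ennreal s < emeasure M {x \<in> space M. l < f x}"
    unfolding rearr_def by (metis (mono_tags, lifting) Inf_lower linorder_not_less mem_Collect_eq)
next
  assume less: "ennreal s < emeasure M {x \<in> space M. l < f x}"
  note [measurable] = assms
  show "l < rearr M f s"
  proof (rule ccontr)
    assume "\<not> l < rearr M f s"
    have "emeasure M {x \<in> space M. l' < f x} \<le> ennreal s" if "l < l'" for l'
    proof -
      from that \<open>\<not> l < rearr M f s\<close> obtain k where "emeasure M {x \<in> space M. k < f x} \<le> ennreal s" "k < l'"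
        unfolding rearr_def not_less by (metis (mono_tags, lifting) Inf_less_iff mem_Collect_eq order_le_less_trans)
      moreover have "emeasure M {x \<in> space M. l' < f x} \<le> emeasure M {x \<in> space M. k < f x}"
        using \<open>k < l'\<close> by (intro emeasure_mono) auto
      ultimately show ?thesis by simp
    qed
    note le = this
    have "l \<noteq> top"
    proof
      assume "l = top"
      then have "{x \<in> space M. l < f x} = {}" by auto
      with less show False by (metis emeasure_empty not_less_zero)
    qed
    then obtain r where r: "l = ennreal r" "0 \<le> r" by (cases l) auto
    define X where "X n = ennreal (r + 1 / real (Suc n))" for n
    have X: "decseq X" "\<And>n. l < X n"
      using r by (auto simp: X_def decseq_def ennreal_less_iff frac_le intro!: ennreal_leI)
    have "(\<lambda>n. r + 1 / real (Suc n)) \<longlonglongrightarrow> r + 0"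
      by (intro tendsto_intros LIMSEQ_Suc lim_1_over_n)
    then have lim: "X \<longlonglongrightarrow> l"
      unfolding X_def r by (intro tendsto_ennrealI) simp
    have "\<exists>n. X n < f x" if "l < f x" for x
      using order_tendstoD(2)[OF lim that] by (auto simp: eventually_sequentially)
    then have "{x \<in> space M. l < f x} = (\<Union>n. {x \<in> space M. X n < f x})"
      using X(2) by (auto intro: less_trans)
    moreover have "emeasure M \<dots> = (SUP n. emeasure M {x \<in> space M. X n < f x})"
      using X(1) by (intro SUP_emeasure_incseq[symmetric])
        (auto simp: incseq_def decseq_def intro: order_le_less_trans)
    ultimately have "emeasure M {x \<in> space M. l < f x} \<le> ennreal s"
      using le[OF X(2)] by (auto intro: SUP_least)
    with less show False by simp
  qed
qed

text \<open>Right continuity is what later allows the rearranged gradient to be recognized as its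
  own rearrangement on (0,oo), so that the dilation norm can act on it.\<close>

lemma rearr_right_cont:
  assumes "f \<in> borel_measurable M" "0 \<le> s"
  shows "rearr M f s \<le> (SUP t\<in>{s<..}. rearr M f t)"
proof (rule dense_le)
  fix l assume "l < rearr M f s"
  then have "ennreal s < emeasure M {x \<in> space M. l < f x}" using assms less_rearr_iff by blast
  then obtain r where "ennreal s < r" "r < emeasure M {x \<in> space M. l < f x}" using dense by blast
  then obtain t where "s < t" "ennreal t < emeasure M {x \<in> space M. l < f x}"
    using assms by (cases r) (auto simp: ennreal_less_iff)
  then have "l < rearr M f t" using assms less_rearr_iff by blast
  then have "l \<le> rearr M f t" by simp
  also have "\<dots> \<le> (SUP t\<in>{s<..}. rearr M f t)" using \<open>s < t\<close> by (intro SUP_upper) auto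
  finally show "l \<le> \<dots>" .
qed

lemma borel_measurable_antimono_ennreal:
  fixes f :: "real \<Rightarrow> ennreal"
  assumes "\<And>s t. s \<le> t \<Longrightarrow> f t \<le> f s"
  shows "f \<in> borel_measurable borel"
proof (rule borel_measurableI_greater)
  fix y
  have "is_interval {x. y < f x}"
    unfolding is_interval_1 using assms by (auto intro: order_less_le_trans)
  then show "{x \<in> space borel. y < f x} \<in> sets borel"
    by (simp add: real_interval_borel_measurable)
qed

lemma borel_measurable_mono_ennreal:
  fixes f :: "real \<Rightarrow> ennreal"
  assumes "\<And>s t. s \<le> t \<Longrightarrow> f s \<le> f t"
  shows "f \<in> borel_measurable borel"
proof (rule borel_measurableI_greater)
  fix y
  have "is_interval {x. y < f x}"
    unfolding is_interval_1 using assms by (auto intro: order_less_le_trans)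
  then show "{x \<in> space borel. y < f x} \<in> sets borel"
    by (simp add: real_interval_borel_measurable)
qed

lemma nn_integral_layer_cake:
  assumes "sigma_finite_measure M" and [measurable]: "u \<in> borel_measurable M"
  shows "(\<integral>\<^sup>+ x. ennreal (u x) \<partial>M) = (\<integral>\<^sup>+ l. emeasure M {x \<in> space M. l < u x} * indicator {0<..} l \<partial>lborel)"
proof -
  interpret sigma_finite_measure M by fact
  interpret pair_sigma_finite lborel M ..
  have "(\<integral>\<^sup>+ x. ennreal (u x) \<partial>M) = (\<integral>\<^sup>+ x. (\<integral>\<^sup>+ l. indicator {(l, x). 0 < l \<and> l < u x} (l, x) \<partial>lborel) \<partial>M)"
  proof (rule nn_integral_cong)
    fix x
    have "(\<integral>\<^sup>+ l. indicator {(l, x). 0 < l \<and> l < u x} (l, x) \<partial>lborel) = (\<integral>\<^sup>+ l. indicator {0<..<u x} l \<partial>lborel)"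
      by (intro nn_integral_cong) (auto simp: indicator_def)
    also have "\<dots> = ennreal (u x)" by (cases "0 \<le> u x") (auto simp: ennreal_neg)
    finally show "ennreal (u x) = (\<integral>\<^sup>+ l. indicator {(l, x). 0 < l \<and> l < u x} (l, x) \<partial>lborel)" by simp
  qed
  also have "\<dots> = (\<integral>\<^sup>+ l. (\<integral>\<^sup>+ x. indicator {(l, x). 0 < l \<and> l < u x} (l, x) \<partial>M) \<partial>lborel)"
    by (subst Fubini') auto
  also have "\<dots> = (\<integral>\<^sup>+ l. emeasure M {x \<in> space M. l < u x} * indicator {0<..} l \<partial>lborel)"
  proof (rule nn_integral_cong)
    fix l :: real
    have "(\<integral>\<^sup>+ x. indicator {(l, x). 0 < l \<and> l < u x} (l, x) \<partial>M)
        = (\<integral>\<^sup>+ x. indicator {0<..} l * indicator {x \<in> space M. l < u x} x \<partial>M)"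
      by (intro nn_integral_cong) (auto simp: indicator_def)
    then show "(\<integral>\<^sup>+ x. indicator {(l, x). 0 < l \<and> l < u x} (l, x) \<partial>M) = emeasure M {x \<in> space M. l < u x} * indicator {0<..} l"
      by (simp add: nn_integral_cmult mult.commute)
  qed
  finally show ?thesis .
qed

text \<open>Layer by layer: E meets {u > l} in measure at most min(t, m), where m is the measure of
  {u > l}, and by \<open>less_rearr_iff\<close> every positive s below this minimum lies in the
  corresponding layer of the rearrangement. Fubini's theorem reassembles the layers.\<close>

lemma hardy_littlewood_rearr:
  assumes "sigma_finite_measure M" and u[measurable]: "u \<in> borel_measurable M" and [measurable]: "E \<in> sets M"
    and E: "emeasure M E \<le> ennreal t"
  shows "(\<integral>\<^sup>+ x\<in>E. ennreal (u x) \<partial>M) \<le> (\<integral>\<^sup>+ s\<in>{0<..<t}. rearr M (\<lambda>x. ennreal (u x)) s \<partial>lborel)"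
proof (cases "t > 0")
  case False
  then have "emeasure M E = 0" using E by (simp add: ennreal_neg)
  then have "AE x in M. x \<notin> E" by (intro AE_not_in null_setsI) auto
  then have "(\<integral>\<^sup>+ x\<in>E. ennreal (u x) \<partial>M) = (\<integral>\<^sup>+ x. 0 \<partial>M)"
    by (intro nn_integral_cong_AE) auto
  then show ?thesis by simp
next
  case True
  let ?r = "rearr M (\<lambda>x. ennreal (u x))"
  have [measurable]: "?r \<in> borel_measurable borel"
    by (intro borel_measurable_antimono_ennreal rearr_antimono)
  have L: "l < u x \<longleftrightarrow> ennreal l < ennreal (u x)" if "0 \<le> l" for l x
    using that by (cases "u x < 0") (auto simp: ennreal_less_iff ennreal_neg)
  have "(\<integral>\<^sup>+ x\<in>E. ennreal (u x) \<partial>M) = (\<integral>\<^sup>+ x. ennreal (u x * indicator E x) \<partial>M)"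
    by (intro nn_integral_cong) (auto simp: indicator_def)
  also have "\<dots> = (\<integral>\<^sup>+ l. emeasure M {x \<in> space M. l < u x * indicator E x} * indicator {0<..} l \<partial>lborel)"
    by (intro nn_integral_layer_cake assms) measurable
  also have "\<dots> \<le> (\<integral>\<^sup>+ l. (\<integral>\<^sup>+ s. indicator {(l,s). 0 < l \<and> 0 < s \<and> s < t \<and> ennreal l < ?r s} (l,s) \<partial>lborel) \<partial>lborel)"
  proof (rule nn_integral_mono)
    fix l :: real
    show "emeasure M {x \<in> space M. l < u x * indicator E x} * indicator {0<..} l
      \<le> (\<integral>\<^sup>+ s. indicator {(l,s). 0 < l \<and> 0 < s \<and> s < t \<and> ennreal l < ?r s} (l,s) \<partial>lborel)"
    proof (cases "l > 0")
      case l: True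
      define m where "m = emeasure M {x \<in> space M. ennreal l < ennreal (u x)}"
      have "emeasure M {x \<in> space M. l < u x * indicator E x} \<le> min (emeasure M E) m"
        unfolding m_def using l by (intro min.boundedI emeasure_mono) (auto simp: indicator_def L split: if_splits)
      also have "\<dots> \<le> min (ennreal t) m" using E by (auto simp: min_le_iff_disj)
      finally have le: "emeasure M {x \<in> space M. l < u x * indicator E x} \<le> min (ennreal t) m" .
      then obtain c where c: "min (ennreal t) m = ennreal c" "0 \<le> c"
        by (cases "min (ennreal t) m") (auto simp: min_def split: if_splits)
      have "{0<..<c} \<subseteq> {s. 0 < s \<and> s < t \<and> ennreal l < ?r s}"
      proof
        fix s assume "s \<in> {0<..<c}"
        then have "ennreal s < min (ennreal t) m" "0 < s" by (auto simp: c ennreal_less_iff)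
        then show "s \<in> {s. 0 < s \<and> s < t \<and> ennreal l < ?r s}"
          by (auto simp: less_rearr_iff m_def ennreal_less_iff)
      qed
      then have "ennreal c \<le> (\<integral>\<^sup>+ s. indicator {s. 0 < s \<and> s < t \<and> ennreal l < ?r s} s \<partial>lborel)"
        using c emeasure_mono[of "{0<..<c}" _ lborel] by simp
      also have "\<dots> = (\<integral>\<^sup>+ s. indicator {(l,s). 0 < l \<and> 0 < s \<and> s < t \<and> ennreal l < ?r s} (l,s) \<partial>lborel)"
        using l by (intro nn_integral_cong) (auto simp: indicator_def)
      finally show ?thesis using le c l by simp
    qed simp
  qed
  also have "\<dots> = (\<integral>\<^sup>+ s. (\<integral>\<^sup>+ l. indicator {(l,s). 0 < l \<and> 0 < s \<and> s < t \<and> ennreal l < ?r s} (l,s) \<partial>lborel) \<partial>lborel)"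
    by (subst lborel_pair.Fubini') auto
  also have "\<dots> \<le> (\<integral>\<^sup>+ s\<in>{0<..<t}. ?r s \<partial>lborel)"
  proof (rule nn_integral_mono)
    fix s :: real
    show "(\<integral>\<^sup>+ l. indicator {(l,s). 0 < l \<and> 0 < s \<and> s < t \<and> ennreal l < ?r s} (l,s) \<partial>lborel) \<le> ?r s * indicator {0<..<t} s"
    proof (cases "0 < s \<and> s < t \<and> ?r s < \<infinity>")
      case True
      then obtain c where c: "?r s = ennreal c" "0 \<le> c" by (cases "?r s") auto
      have "(\<integral>\<^sup>+ l. indicator {(l,s). 0 < l \<and> 0 < s \<and> s < t \<and> ennreal l < ?r s} (l,s) \<partial>lborel)
          = (\<integral>\<^sup>+ l. indicator {0<..<c} l \<partial>lborel)"
        using True c by (intro nn_integral_cong) (auto simp: indicator_def ennreal_less_iff)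
      then show ?thesis using c True by simp
    next
      case False
      then consider "\<not> (0 < s \<and> s < t)" | "0 < s" "s < t" "?r s = \<infinity>"
        by (auto simp: less_top[symmetric])
      then show ?thesis by cases (auto simp: indicator_def)
    qed
  qed
  finally show ?thesis .
qed

section \<open>Level sets of test functions\<close>

lemma test_fun_differentiable: "test_fun f \<Longrightarrow> f differentiable (at x)"
  unfolding test_fun_def smooth_fun_def by (metis iter_pderiv.simps(1))

lemma test_fun_continuous_on: "test_fun f \<Longrightarrow> continuous_on S f"
  by (simp add: test_fun_differentiable differentiable_imp_continuous_within continuous_at_imp_continuous_on)

lemma test_fun_borel_measurable: "test_fun f \<Longrightarrow> f \<in> borel_measurable borel"
  by (simp add: test_fun_continuous_on borel_measurable_continuous_onI)

lemma test_fun_continuous_on_pderiv_i: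
  assumes "test_fun f"
  shows "continuous_on S (pderiv_i i f)"
proof -
  have "iter_pderiv [i] f differentiable (at x)" for x
    using assms unfolding test_fun_def smooth_fun_def by blast
  then show ?thesis
    by (simp add: differentiable_imp_continuous_within continuous_at_imp_continuous_on)
qed

lemma test_fun_continuous_on_grad: "test_fun f \<Longrightarrow> continuous_on S (grad f)"
  unfolding grad_def by (intro continuous_on_vec_lambda test_fun_continuous_on_pderiv_i)

lemma test_fun_borel_measurable_grad: "test_fun f \<Longrightarrow> grad f \<in> borel_measurable borel"
  by (simp add: test_fun_continuous_on_grad borel_measurable_continuous_onI)

lemma test_fun_vanishes_outside_cball:
  assumes "test_fun f"
  shows "\<exists>R. \<forall>x. R < norm x \<longrightarrow> f x = 0"
proof -
  have "bounded {x. f x \<noteq> 0}"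
    using assms bounded_subset[OF compact_imp_bounded closure_subset] by (auto simp: test_fun_def)
  then obtain R where "\<forall>x\<in>{x. f x \<noteq> 0}. norm x \<le> R"
    unfolding bounded_iff by blast
  then show ?thesis by (intro exI[of _ R]) force
qed

lemma test_fun_bounded:
  assumes "test_fun f"
  shows "\<exists>B\<ge>0. \<forall>x. \<bar>f x\<bar> \<le> B"
proof -
  obtain R where R: "\<forall>x. R < norm x \<longrightarrow> f x = 0" using test_fun_vanishes_outside_cball[OF assms] by blast
  have "bounded (f ` cball 0 R)"
    by (intro compact_imp_bounded compact_continuous_image test_fun_continuous_on assms compact_cball)
  then obtain B where B: "\<forall>y\<in>f ` cball 0 R. norm y \<le> B"
    unfolding bounded_iff by blast
  have "\<bar>f x\<bar> \<le> max 0 B" for x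
  proof (cases "norm x \<le> R")
    case True
    then have "f x \<in> f ` cball 0 R" by simp
    with B have "norm (f x) \<le> B" by blast
    then show ?thesis by simp
  next
    case False
    with R show ?thesis by simp
  qed
  then show ?thesis by (intro exI[of _ "max 0 B"]) simp
qed

lemma test_fun_has_line_derivative:
  fixes f :: "real^'n \<Rightarrow> real"
  assumes "test_fun f"
  shows "((\<lambda>y. f (p + y *\<^sub>R axis i 1)) has_real_derivative pderiv_i i f (p + y *\<^sub>R axis i 1)) (at y)"
proof -
  let ?e = "axis i 1 :: real^'n" and ?D = "frechet_derivative f (at (p + y *\<^sub>R axis i 1))"
  have D: "(f has_derivative ?D) (at (p + y *\<^sub>R ?e))"
    using test_fun_differentiable[OF assms] frechet_derivative_works by blast
  have "((\<lambda>y. p + y *\<^sub>R ?e) has_derivative (\<lambda>h. h *\<^sub>R ?e)) (at y)"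
    by (auto intro!: derivative_eq_intros)
  from has_derivative_compose[OF this D]
  have "((\<lambda>y. f (p + y *\<^sub>R ?e)) has_derivative (\<lambda>h. ?D (h *\<^sub>R ?e))) (at y)" .
  moreover have "?D (h *\<^sub>R ?e) = h * ?D ?e" for h
    using linear_cmul[OF has_derivative_linear[OF D], of h ?e] by simp
  ultimately show ?thesis
    by (simp add: has_field_derivative_def pderiv_i_def mult_commute_abs)
qed

text \<open>All n weights in \<open>lines_imp_measure_bound\<close> are the same function, |grad f|
  / (b - a) on the slab, since every partial derivative is at most |grad f|; this is the origin of
  the factor n. Dividing by b - a normalizes the line integrals to 1.\<close>

lemma test_fun_level_set_power_bound:
  fixes f :: "real^'n \<Rightarrow> real"
  assumes f: "test_fun f" and ab: "0 \<le> a" "a < b"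
    and pos: "emeasure lborel {x. b \<le> \<bar>f x\<bar>} > 0"
  shows "emeasure lborel {x. b \<le> \<bar>f x\<bar>} ^ (CARD('n) - 1) \<le>
    (of_nat CARD('n) * (\<integral>\<^sup>+ x. ennreal (norm (grad f x) / (b - a)) * indicator {x. a < \<bar>f x\<bar> \<and> \<bar>f x\<bar> \<le> b} x \<partial>lborel)) ^ CARD('n)"
proof -
  note [measurable] = test_fun_borel_measurable[OF f] test_fun_borel_measurable_grad[OF f]
  define u where "u x = ennreal (norm (grad f x) / (b - a)) * indicator {x. a < \<bar>f x\<bar> \<and> \<bar>f x\<bar> \<le> b} x" for x
  have [measurable]: "u \<in> borel_measurable borel" unfolding u_def by measurable
  define V where "V X = (\<Sum>b\<in>Basis. X b *\<^sub>R b)" for X :: "real^'n \<Rightarrow> real"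
  let ?P = "\<Pi>\<^sub>M b\<in>(Basis :: (real^'n) set). (lborel :: real measure)"
  have V[measurable]: "V \<in> measurable ?P borel" unfolding V_def by measurable
  have lb: "lborel = distr ?P borel V" using lborel_eq unfolding V_def .
  define E where "E = {X \<in> space ?P. b \<le> \<bar>f (V X)\<bar>}"
  have E[measurable]: "E \<in> sets ?P" unfolding E_def by measurable
  have Em: "emeasure lborel {x. b \<le> \<bar>f x\<bar>} = emeasure ?P E"
    by (subst lb, subst emeasure_distr) (auto simp: E_def intro!: arg_cong[where f = "emeasure ?P"])
  have um: "(\<integral>\<^sup>+ x. u x \<partial>lborel) = (\<integral>\<^sup>+ X. u (V X) \<partial>?P)"
    by (subst lb, subst nn_integral_distr) auto
  have line: "1 \<le> (\<integral>\<^sup>+ y. u (V (X(e := y))) \<partial>lborel)" if X: "X \<in> E" and e: "e \<in> Basis" for X e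
  proof -
    from e obtain i where i: "e = axis i 1" by (auto simp: Basis_vec_def)
    \<comment> \<open>The line through \<open>V X\<close> in direction e, based so that the
      parameter value \<open>X e\<close> gives back \<open>V X\<close>.\<close>
    define p where "p = V (X(e := 0))"
    have Ve: "V (X(e := y)) = p + y *\<^sub>R axis i 1" for y
      using e unfolding p_def V_def i[symmetric]
      by (simp add: sum.remove[OF finite_Basis e])
    define F where "F y = f (p + y *\<^sub>R axis i 1)" for y
    define F' where "F' y = pderiv_i i f (p + y *\<^sub>R axis i 1)" for y
    have F: "(F has_real_derivative F' y) (at y)" for y
      unfolding F_def F'_def by (rule test_fun_has_line_derivative[OF f])
    have cont: "continuous_on UNIV F'"
      unfolding F'_def
      by (intro continuous_on_compose2[OF test_fun_continuous_on_pderiv_i[OF f, of UNIV]] continuous_intros) auto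
    have "F (X e) = f (V X)" using Ve[of "X e"] by (simp add: F_def)
    then have Fx: "b \<le> \<bar>F (X e)\<bar>" using X by (simp add: E_def)
    obtain R where R: "\<And>x. R < norm x \<Longrightarrow> f x = 0" using test_fun_vanishes_outside_cball[OF f] by blast
    \<comment> \<open>A point of the line outside the support supplies the zero that
      \<open>line_crossing_integral\<close> asks for.\<close>
    have "R < norm (p + (\<bar>R\<bar> + norm p + 1) *\<^sub>R axis i 1 :: real^'n)"
      using norm_triangle_ineq2[of "(\<bar>R\<bar> + norm p + 1) *\<^sub>R axis i 1 :: real^'n" "- p"] by (simp add: add.commute)
    then have Fz: "F (\<bar>R\<bar> + norm p + 1) = 0" unfolding F_def by (rule R)
    have "ennreal 1 = ennreal (1 / (b - a)) * ennreal (b - a)"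
      using ab by (simp add: ennreal_mult[symmetric])
    also have "\<dots> \<le> ennreal (1 / (b - a)) * (\<integral>\<^sup>+ y. ennreal \<bar>F' y\<bar> * indicator {y. a < \<bar>F y\<bar> \<and> \<bar>F y\<bar> \<le> b} y \<partial>lborel)"
      by (intro mult_left_mono line_crossing_integral[OF F cont ab Fx Fz]) auto
    also have "\<dots> = (\<integral>\<^sup>+ y. ennreal (1 / (b - a)) * (ennreal \<bar>F' y\<bar> * indicator {y. a < \<bar>F y\<bar> \<and> \<bar>F y\<bar> \<le> b} y) \<partial>lborel)"
    proof -
      have [measurable]: "F' \<in> borel_measurable borel" using cont by (rule borel_measurable_continuous_onI)
      have [measurable]: "F \<in> borel_measurable borel" unfolding F_def by measurable
      show ?thesis by (rule nn_integral_cmult[symmetric]) measurable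
    qed
    also have "\<dots> \<le> (\<integral>\<^sup>+ y. u (V (X(e := y))) \<partial>lborel)"
    proof (rule nn_integral_mono)
      fix y
      have "\<bar>F' y\<bar> \<le> norm (grad f (p + y *\<^sub>R axis i 1))"
        unfolding F'_def using component_le_norm_cart[of "grad f (p + y *\<^sub>R axis i 1)" i] by (simp add: grad_def)
      then show "ennreal (1 / (b - a)) * (ennreal \<bar>F' y\<bar> * indicator {y. a < \<bar>F y\<bar> \<and> \<bar>F y\<bar> \<le> b} y) \<le> u (V (X(e := y)))"
        using ab unfolding u_def Ve F_def
        by (auto simp: indicator_def ennreal_mult[symmetric] divide_right_mono intro!: ennreal_leI)
    qed
    finally show ?thesis by simp
  qed
  interpret product_sigma_finite "\<lambda>_. lborel :: real measure" ..
  have "emeasure ?P E ^ (card (Basis :: (real^'n) set) - 1)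
      \<le> (\<Sum>e\<in>(Basis :: (real^'n) set). \<integral>\<^sup>+ X. u (V X) \<partial>?P) ^ card (Basis :: (real^'n) set)"
    using pos line by (intro lines_imp_measure_bound) (auto simp: Em)
  then show ?thesis
    unfolding Em um[symmetric] u_def[symmetric] by (simp add: DIM_cart)
qed

text \<open>The power bound after taking n-th roots. A real m below the measure keeps the root among
  the reals and allows m = s as soon as the measure exceeds s.\<close>

lemma test_fun_level_set_bound:
  fixes f :: "real^'n \<Rightarrow> real"
  assumes f: "test_fun f" and ab: "0 \<le> a" "a \<le> b"
    and m: "0 \<le> m" "ennreal m \<le> emeasure lborel {x. b \<le> \<bar>f x\<bar>}"
  shows "ennreal ((b - a) * m powr (1 - 1 / real CARD('n))) \<le>
    of_nat CARD('n) * (\<integral>\<^sup>+ x. ennreal (norm (grad f x)) * indicator {x. a < \<bar>f x\<bar> \<and> \<bar>f x\<bar> \<le> b} x \<partial>lborel)"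
    (is "_ \<le> of_nat ?N * ?J")
proof (cases "a = b \<or> m = 0 \<or> ?J = \<infinity>")
  case True
  then show ?thesis by (auto simp: ennreal_mult_top)
next
  case False
  note [measurable] = test_fun_borel_measurable[OF f] test_fun_borel_measurable_grad[OF f]
  from False obtain J where J: "?J = ennreal J" "0 \<le> J" by (cases ?J) auto
  define y where "y = ?N * (J / (b - a))"
  have ab': "a < b" and m': "0 < m" using False ab m by auto
  have y0: "0 \<le> y" using J ab' by (simp add: y_def)
  have "(\<integral>\<^sup>+ x. ennreal (norm (grad f x) / (b - a)) * indicator {x. a < \<bar>f x\<bar> \<and> \<bar>f x\<bar> \<le> b} x \<partial>lborel)
      = (\<integral>\<^sup>+ x. ennreal (1 / (b - a)) * (ennreal (norm (grad f x)) * indicator {x. a < \<bar>f x\<bar> \<and> \<bar>f x\<bar> \<le> b} x) \<partial>lborel)"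
    using ab' by (intro nn_integral_cong) (auto simp: indicator_def ennreal_mult[symmetric])
  also have "\<dots> = ennreal (J / (b - a))"
    using J ab' by (subst nn_integral_cmult) (auto simp: ennreal_mult[symmetric])
  finally have eq: "of_nat ?N * (\<integral>\<^sup>+ x. ennreal (norm (grad f x) / (b - a)) * indicator {x. a < \<bar>f x\<bar> \<and> \<bar>f x\<bar> \<le> b} x \<partial>lborel) = ennreal y"
    using J ab' by (simp add: y_def ennreal_of_nat_eq_real_of_nat ennreal_mult[symmetric])
  have "emeasure lborel {x. b \<le> \<bar>f x\<bar>} > 0"
    using m m' by (metis ennreal_less_zero_iff order_less_le_trans)
  from test_fun_level_set_power_bound[OF f ab(1) ab' this]
  have "ennreal m ^ (?N - 1) \<le> ennreal y ^ ?N"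
    unfolding eq using m by (meson order_trans power_mono zero_le)
  then have "m ^ (?N - 1) \<le> y ^ ?N"
    using y0 m by (simp add: ennreal_power)
  then have "(m ^ (?N - 1)) powr (1 / ?N) \<le> (y ^ ?N) powr (1 / ?N)"
    using m by (intro powr_mono2) auto
  moreover have "(m ^ (?N - 1)) powr (1 / ?N) = m powr (1 - 1 / ?N)"
    using m' by (simp add: powr_realpow[symmetric] powr_powr of_nat_diff Suc_le_eq field_simps)
  moreover have "(y ^ ?N) powr (1 / ?N) = y"
    using y0 by (cases "y = 0") (simp_all add: powr_realpow[symmetric] powr_powr)
  ultimately have "m powr (1 - 1 / ?N) \<le> y" by simp
  then have "(b - a) * m powr (1 - 1 / ?N) \<le> (b - a) * y"
    using ab' by (intro mult_left_mono) auto
  also have "\<dots> = ?N * J" using ab' by (simp add: y_def)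
  finally show ?thesis
    unfolding J using J by (simp add: ennreal_of_nat_eq_real_of_nat ennreal_mult[symmetric] ennreal_leI)
qed

section \<open>Dyadic sums and integrals\<close>

text \<open>Summing shifts the index on the right by one, so q times the sum is absorbed on the left
  and one boundary term survives, here at the far index N. For the opposite recursion in
  \<open>geometric_recursion_down\<close> it sits at index 0.\<close>

lemma geometric_recursion_up:
  fixes x y :: "nat \<Rightarrow> real"
  assumes "q < 1" "\<And>k. x k \<le> q * x (Suc k) + y k" "0 \<le> q" "\<And>k. 0 \<le> x k"
  shows "(\<Sum>k<N. x k) \<le> (x N + (\<Sum>k<N. y k)) / (1 - q)"
proof -
  have "(1 - q) * (\<Sum>k<N. x k) \<le> q * x N + (\<Sum>k<N. y k)"
  proof (induction N)
    case (Suc N)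
    have "(1 - q) * (\<Sum>k<Suc N. x k) \<le> q * x N + (\<Sum>k<N. y k) + (1 - q) * x N"
      using Suc by (simp add: algebra_simps)
    also have "\<dots> = x N + (\<Sum>k<N. y k)" by (simp add: algebra_simps)
    also have "\<dots> \<le> q * x (Suc N) + (\<Sum>k<Suc N. y k)" using assms(2)[of N] by simp
    finally show ?case .
  qed (use assms in simp)
  moreover have "q * x N \<le> 1 * x N" using assms by (intro mult_right_mono) auto
  ultimately show ?thesis using assms(1) by (simp add: field_simps)
qed

lemma geometric_recursion_down:
  fixes x y :: "nat \<Rightarrow> real"
  assumes "q < 1" "\<And>k. x (Suc k) \<le> q * x k + y k" "0 \<le> q" "\<And>k. 0 \<le> x k"
  shows "(\<Sum>k<N. x (Suc k)) \<le> (x 0 + (\<Sum>k<N. y k)) / (1 - q)"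
proof -
  have "(1 - q) * (\<Sum>k<N. x (Suc k)) + q * x N \<le> q * x 0 + (\<Sum>k<N. y k)"
  proof (induction N)
    case (Suc N)
    then show ?case using assms(2)[of N] by (simp add: algebra_simps)
  qed simp
  moreover have "q * x 0 \<le> 1 * x 0" "0 \<le> q * x N" using assms mult_right_mono[of q 1 "x 0"] by auto
  ultimately show ?thesis using assms(1) by (simp add: field_simps)
qed

text \<open>The cell (t/2^(k+1), t/2^k] has length t/2^(k+1), so the partial sums bound the integral
  over the first N cells. The error \<open>e N\<close> makes room for the boundary term of
  \<open>geometric_recursion_up\<close>, which vanishes only in the limit.\<close>

lemma nn_integral_dyadic_le:
  fixes g :: "real \<Rightarrow> ennreal"
  assumes [measurable]: "g \<in> borel_measurable borel" and t: "0 < t"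
    and g: "\<And>k s. t / 2 ^ Suc k < s \<Longrightarrow> s \<le> t / 2 ^ k \<Longrightarrow> g s \<le> ennreal (c k)"
    and c: "\<And>k. 0 \<le> c k" "\<And>N. (\<Sum>k<N. c k * (t / 2 ^ Suc k)) \<le> e N + R"
    and e: "e \<longlonglongrightarrow> 0"
  shows "(\<integral>\<^sup>+ s\<in>{0<..<t}. g s \<partial>lborel) \<le> ennreal R"
proof -
  have dec: "t / 2 ^ Suc k \<le> t / 2 ^ k" for k using t by (simp add: field_simps)
  have pieces: "(\<integral>\<^sup>+ s\<in>{t / 2 ^ N<..t}. g s \<partial>lborel) \<le> ennreal (\<Sum>k<N. c k * (t / 2 ^ Suc k))" for N
  proof (induction N)
    case (Suc N)
    have "t / 2 ^ N \<le> t" using t by (simp add: field_simps)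
    then have "(\<integral>\<^sup>+ s\<in>{t / 2 ^ Suc N<..t}. g s \<partial>lborel)
        = (\<integral>\<^sup>+ s. g s * indicator {t / 2 ^ N<..t} s + g s * indicator {t / 2 ^ Suc N<..t / 2 ^ N} s \<partial>lborel)"
      using dec[of N] by (intro nn_integral_cong) (auto simp: indicator_def)
    also have "\<dots> = (\<integral>\<^sup>+ s\<in>{t / 2 ^ N<..t}. g s \<partial>lborel) + (\<integral>\<^sup>+ s\<in>{t / 2 ^ Suc N<..t / 2 ^ N}. g s \<partial>lborel)"
      by (intro nn_integral_add) auto
    also have "(\<integral>\<^sup>+ s\<in>{t / 2 ^ Suc N<..t / 2 ^ N}. g s \<partial>lborel)
        \<le> (\<integral>\<^sup>+ s. ennreal (c N) * indicator {t / 2 ^ Suc N<..t / 2 ^ N} s \<partial>lborel)"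
      using g[of N] by (intro nn_integral_mono) (auto simp: indicator_def)
    also have "\<dots> = ennreal (c N * (t / 2 ^ Suc N))"
    proof -
      have "t / 2 ^ N - t / 2 ^ Suc N = t / 2 ^ Suc N" by (simp add: field_simps)
      then show ?thesis
        using dec[of N] c(1)[of N] t by (simp add: nn_integral_cmult_indicator ennreal_mult[symmetric] del: power_Suc)
    qed
    also have "(\<integral>\<^sup>+ s\<in>{t / 2 ^ N<..t}. g s \<partial>lborel) + ennreal (c N * (t / 2 ^ Suc N))
        \<le> ennreal (\<Sum>k<N. c k * (t / 2 ^ Suc k)) + ennreal (c N * (t / 2 ^ Suc N))"
      using Suc by (intro add_right_mono)
    also have "\<dots> = ennreal (\<Sum>k<Suc N. c k * (t / 2 ^ Suc k))"
      using c(1) t by (subst ennreal_plus[symmetric]) (auto intro!: sum_nonneg)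
    finally show ?case by (simp add: add_left_mono)
  qed simp
  \<comment> \<open>The domain is fixed by N while the error is taken at a larger M, so the error
    can tend to 0 before the domain grows.\<close>
  have R: "(\<integral>\<^sup>+ s\<in>{t / 2 ^ N<..t}. g s \<partial>lborel) \<le> ennreal R" for N
  proof (rule LIMSEQ_le_const)
    have "(\<lambda>M. e M + R) \<longlonglongrightarrow> 0 + R" by (intro tendsto_intros e)
    then show "(\<lambda>M. ennreal (e M + R)) \<longlonglongrightarrow> ennreal R" by (intro tendsto_ennrealI) simp
    show "\<exists>n. \<forall>M\<ge>n. (\<integral>\<^sup>+ s\<in>{t / 2 ^ N<..t}. g s \<partial>lborel) \<le> ennreal (e M + R)"
    proof (intro exI allI impI)
      fix M assume "N \<le> M"
      then have "t / 2 ^ M \<le> t / 2 ^ N" using t by (intro divide_left_mono) auto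
      then have "(\<integral>\<^sup>+ s\<in>{t / 2 ^ N<..t}. g s \<partial>lborel) \<le> (\<integral>\<^sup>+ s\<in>{t / 2 ^ M<..t}. g s \<partial>lborel)"
        by (intro nn_integral_mono) (auto simp: indicator_def)
      also have "\<dots> \<le> ennreal (e M + R)" using pieces[of M] c(2)[of M] by (meson ennreal_leI order_trans)
      finally show "(\<integral>\<^sup>+ s\<in>{t / 2 ^ N<..t}. g s \<partial>lborel) \<le> ennreal (e M + R)" .
    qed
  qed
  have inc: "incseq (\<lambda>N s. g s * indicator {t / 2 ^ N<..t} s)"
  proof (rule incseq_SucI, rule le_funI)
    fix N s show "g s * indicator {t / 2 ^ N<..t} s \<le> g s * indicator {t / 2 ^ Suc N<..t} s"
      using dec[of N] by (auto simp: indicator_def)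
  qed
  have "(\<integral>\<^sup>+ s\<in>{0<..<t}. g s \<partial>lborel) \<le> (\<integral>\<^sup>+ s. (SUP N. g s * indicator {t / 2 ^ N<..t} s) \<partial>lborel)"
  proof (rule nn_integral_mono)
    fix s :: real
    show "g s * indicator {0<..<t} s \<le> (SUP N. g s * indicator {t / 2 ^ N<..t} s)"
    proof (cases "0 < s \<and> s < t")
      case True
      then obtain N where "t / s < 2 ^ N" using real_arch_pow[of 2 "t / s"] by auto
      then have "t / 2 ^ N < s" using True by (simp add: field_simps)
      then have "g s * indicator {0<..<t} s \<le> g s * indicator {t / 2 ^ N<..t} s"
        using True by (simp add: indicator_def)
      then show ?thesis by (meson SUP_upper UNIV_I order_trans)
    qed (auto simp: indicator_def)
  qed
  also have "\<dots> = (SUP N. \<integral>\<^sup>+ s\<in>{t / 2 ^ N<..t}. g s \<partial>lborel)"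
    by (intro nn_integral_monotone_convergence_SUP inc) measurable
  also have "\<dots> \<le> ennreal R" by (intro SUP_least R)
  finally show ?thesis .
qed

text \<open>Truncated subtraction on \<open>ennreal\<close> is harmless here, because
  \<open>\<phi> s\<close> is finite and a lower bound of \<phi> on (0,s). The difference becomes an
  average of nonnegative differences.\<close>

lemma average_minus_eq:
  fixes \<phi> :: "real \<Rightarrow> ennreal"
  assumes anti: "\<And>r s. r \<le> s \<Longrightarrow> \<phi> s \<le> \<phi> r" and s: "0 < s" and fin: "\<phi> s \<noteq> \<infinity>"
  shows "(\<integral>\<^sup>+ r\<in>{0<..<s}. \<phi> r \<partial>lborel) / ennreal s - \<phi> s
    = (\<integral>\<^sup>+ r\<in>{0<..<s}. (\<phi> r - \<phi> s) \<partial>lborel) / ennreal s"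
proof -
  have [measurable]: "\<phi> \<in> borel_measurable borel"
    using anti by (rule borel_measurable_antimono_ennreal)
  have "(\<integral>\<^sup>+ r\<in>{0<..<s}. \<phi> r \<partial>lborel)
      = (\<integral>\<^sup>+ r. (\<phi> r - \<phi> s) * indicator {0<..<s} r + \<phi> s * indicator {0<..<s} r \<partial>lborel)"
    using anti fin by (intro nn_integral_cong) (auto simp: indicator_def diff_add_cancel_ennreal less_top)
  also have "\<dots> = (\<integral>\<^sup>+ r\<in>{0<..<s}. (\<phi> r - \<phi> s) \<partial>lborel) + \<phi> s * ennreal s"
    using s by (subst nn_integral_add) (auto simp: nn_integral_cmult_indicator)
  finally have "(\<integral>\<^sup>+ r\<in>{0<..<s}. \<phi> r \<partial>lborel) / ennreal s
      = (\<integral>\<^sup>+ r\<in>{0<..<s}. (\<phi> r - \<phi> s) \<partial>lborel) / ennreal s + \<phi> s"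
    using s by (simp add: add_divide_distrib_ennreal ennreal_mult_divide_eq)
  then show ?thesis using fin by simp
qed

section \<open>Rearrangements of test functions\<close>

lemma fstar_eq_rearr_lborel:
  assumes [measurable]: "f \<in> borel_measurable borel"
  shows "fstar f = rearr lborel (\<lambda>x. ennreal \<bar>f x\<bar>)"
proof
  fix s
  have "{x. l < ennreal \<bar>f x\<bar>} \<in> sets borel" for l :: ennreal by measurable
  then show "fstar f s = rearr lborel (\<lambda>x. ennreal \<bar>f x\<bar>) s"
    unfolding fstar_def rearr_def by (simp add: main_part_sets)
qed

lemma fstar_antimono: "s \<le> t \<Longrightarrow> fstar f t \<le> fstar f s"
  unfolding fstar_def by (rule rearr_antimono)

lemma borel_measurable_fstar [measurable]: "fstar f \<in> borel_measurable borel"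
  by (intro borel_measurable_antimono_ennreal fstar_antimono)

lemma less_fstar_iff:
  assumes [measurable]: "f \<in> borel_measurable borel" and l: "0 \<le> l"
  shows "ennreal l < fstar f s \<longleftrightarrow> ennreal s < emeasure lborel {x. l < \<bar>f x\<bar>}"
  using l by (simp add: fstar_eq_rearr_lborel less_rearr_iff ennreal_less_iff)

lemma fstarstar_eq: "fstarstar f s = (\<integral>\<^sup>+ r\<in>{0<..<s}. fstar f r \<partial>lborel) / ennreal s"
  by (simp add: fstarstar_def rearr2_def fstar_def)

lemma borel_measurable_fstarstar [measurable]: "fstarstar f \<in> borel_measurable borel"
proof -
  have [measurable]: "(\<lambda>s. \<integral>\<^sup>+ r\<in>{0<..<s}. fstar f r \<partial>lborel) \<in> borel_measurable borel"
    by (intro borel_measurable_mono_ennreal nn_integral_mono) (auto simp: indicator_def)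
  show ?thesis unfolding fstarstar_eq[abs_def] by measurable
qed

lemma fstar_le_fstarstar:
  assumes "0 < s"
  shows "fstar f s \<le> fstarstar f s"
proof -
  have "fstar f s * ennreal s = (\<integral>\<^sup>+ r. fstar f s * indicator {0<..<s} r \<partial>lborel)"
    using assms by (simp add: nn_integral_cmult_indicator)
  also have "\<dots> \<le> (\<integral>\<^sup>+ r\<in>{0<..<s}. fstar f r \<partial>lborel)"
    by (intro nn_integral_mono) (auto simp: indicator_def intro!: fstar_antimono)
  finally have "fstar f s * ennreal s / ennreal s \<le> fstarstar f s"
    unfolding fstarstar_eq by (rule divide_right_mono_ennreal)
  then show ?thesis using assms by (simp add: ennreal_mult_divide_eq)
qed

text \<open>This is s times the difference of \<open>fstarstar f\<close> and \<open>fstar f\<close>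
  at s whenever \<open>fstar f s\<close> is finite. In this form monotonicity in s is visible: both
  the interval and the integrand grow.\<close>

definition oscillation :: "(real^'n \<Rightarrow> real) \<Rightarrow> real \<Rightarrow> ennreal" where
  "oscillation f s = (\<integral>\<^sup>+ r\<in>{0<..<s}. (fstar f r - fstar f s) \<partial>lborel)"

lemma oscillation_mono: "s \<le> t \<Longrightarrow> oscillation f s \<le> oscillation f t"
  unfolding oscillation_def
  by (intro nn_integral_mono) (auto simp: indicator_def intro!: ennreal_minus_mono fstar_antimono)

lemma borel_measurable_oscillation [measurable]: "oscillation f \<in> borel_measurable borel"
  by (intro borel_measurable_mono_ennreal oscillation_mono)

lemma fstarstar_minus_fstar:
  assumes "0 < s" "fstar f s \<noteq> \<infinity>"
  shows "fstarstar f s - fstar f s = oscillation f s / ennreal s"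
  unfolding fstarstar_eq oscillation_def
  by (intro average_minus_eq fstar_antimono assms)

lemma test_fun_fstar_le:
  assumes f: "test_fun f" and B: "0 \<le> B" "\<And>x. \<bar>f x\<bar> \<le> B"
  shows "fstar f s \<le> ennreal B"
proof (rule ccontr)
  note [measurable] = test_fun_borel_measurable[OF f]
  assume "\<not> fstar f s \<le> ennreal B"
  then have "ennreal s < emeasure lborel {x. B < \<bar>f x\<bar>}"
    using B by (simp add: not_le less_fstar_iff)
  moreover have "{x. B < \<bar>f x\<bar>} = {}" using B by (auto simp: not_less)
  ultimately show False by simp
qed

lemma test_fun_fstar_finite: "test_fun f \<Longrightarrow> fstar f s < \<infinity>"
  using test_fun_bounded[of f] test_fun_fstar_le[of f]
  by (metis ennreal_less_top infinity_ennreal_def order_le_less_trans)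

lemma test_fun_fstar_eventually_zero:
  fixes f :: "real^'n \<Rightarrow> real"
  assumes f: "test_fun f"
  shows "\<exists>T>0. \<forall>s\<ge>T. fstar f s = 0"
proof -
  note [measurable] = test_fun_borel_measurable[OF f]
  obtain R where R: "\<forall>x. R < norm x \<longrightarrow> f x = 0" using test_fun_vanishes_outside_cball[OF f] by blast
  have "emeasure lborel {x. 0 < \<bar>f x\<bar>} \<le> emeasure lborel (cball (0 :: real^'n) R)"
  proof (rule emeasure_mono)
    show "{x. 0 < \<bar>f x\<bar>} \<subseteq> cball 0 R" using R by force
  qed simp
  also have "\<dots> < \<infinity>" using emeasure_bounded_finite[OF bounded_cball] by blast
  finally obtain m where m: "emeasure lborel {x. 0 < \<bar>f x\<bar>} = ennreal m" "0 \<le> m"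
    by (cases "emeasure lborel {x. 0 < \<bar>f x\<bar>}") auto
  have "fstar f s = 0" if "m + 1 \<le> s" for s
    using less_fstar_iff[of f 0 s] m that by (auto simp: ennreal_less_iff not_less zero_less_iff_neq_zero)
  then show ?thesis using m(2) by (intro exI[of _ "m + 1"]) auto
qed

text \<open>Each level l strictly below p is exceeded by |f| on a set of measure more than s, so the
  level-set bound applies with m = s. Since \<open>less_fstar_iff\<close> speaks of strict
  inequalities, p itself is reached by a limit from the left.\<close>

lemma test_fun_fstar_difference_bound:
  fixes f :: "real^'n \<Rightarrow> real"
  assumes f: "test_fun f" and s: "0 \<le> s" and p: "fstar f s = ennreal p" "0 \<le> a" "a \<le> p"
  shows "ennreal (s powr (1 - 1 / real CARD('n)) * (p - a)) \<le>
    of_nat CARD('n) * (\<integral>\<^sup>+ x. ennreal (norm (grad f x)) * indicator {x. a < \<bar>f x\<bar> \<and> \<bar>f x\<bar> \<le> p} x \<partial>lborel)"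
    (is "_ \<le> of_nat ?N * ?J")
proof (cases "a = p")
  case False
  note [measurable] = test_fun_borel_measurable[OF f]
  let ?c = "s powr (1 - 1 / real CARD('n))"
  have "ennreal (?c * (l - a)) \<le> of_nat ?N * ?J" if l: "a < l" "l < p" for l
  proof -
    have "ennreal l < fstar f s" using l p by (simp add: ennreal_less_iff)
    then have "ennreal s < emeasure lborel {x. l < \<bar>f x\<bar>}" using l p by (subst (asm) less_fstar_iff) auto
    also have "\<dots> \<le> emeasure lborel {x. l \<le> \<bar>f x\<bar>}" by (intro emeasure_mono) auto
    finally have "ennreal ((l - a) * ?c) \<le> of_nat ?N *
        (\<integral>\<^sup>+ x. ennreal (norm (grad f x)) * indicator {x. a < \<bar>f x\<bar> \<and> \<bar>f x\<bar> \<le> l} x \<partial>lborel)"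
      using l p s by (intro test_fun_level_set_bound f) auto
    also have "\<dots> \<le> of_nat ?N * ?J"
      using l by (intro mult_left_mono nn_integral_mono) (auto simp: indicator_def)
    finally show ?thesis by (simp add: mult.commute)
  qed
  note bound = this
  show ?thesis
  proof (rule tendsto_upperbound)
    have "((\<lambda>l. ?c * (l - a)) \<longlongrightarrow> ?c * (p - a)) (at_left p)" by (intro tendsto_intros)
    then show "((\<lambda>l. ennreal (?c * (l - a))) \<longlongrightarrow> ennreal (?c * (p - a))) (at_left p)"
      by (rule tendsto_ennrealI)
    have "a < p" using False p by simp
    then show "\<forall>\<^sub>F l in at_left p. ennreal (?c * (l - a)) \<le> of_nat ?N * ?J"
      using bound eventually_at_left_field by blast
  qed simp
qed simp

text \<open>The set where |f| exceeds \<open>fstar f t\<close> has measure at most t, so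
  Hardy-Littlewood applies to it.\<close>

lemma test_fun_gradient_above_level:
  fixes f :: "real^'n \<Rightarrow> real"
  assumes f: "test_fun f" and t: "0 < t"
  shows "(\<integral>\<^sup>+ x. ennreal (norm (grad f x)) * indicator {x. fstar f t < ennreal \<bar>f x\<bar>} x \<partial>lborel)
    \<le> (\<integral>\<^sup>+ s\<in>{0<..<t}. fstar (\<lambda>x. norm (grad f x)) s \<partial>lborel)"
proof -
  note [measurable] = test_fun_borel_measurable[OF f] test_fun_borel_measurable_grad[OF f]
  have "emeasure lborel {x. fstar f t < ennreal \<bar>f x\<bar>} \<le> ennreal t"
    using less_rearr_iff[of "\<lambda>x. ennreal \<bar>f x\<bar>" lborel "fstar f t" t]
    by (simp add: fstar_eq_rearr_lborel)
  then show ?thesis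
    using hardy_littlewood_rearr[of "lborel :: (real^'n) measure" "\<lambda>x. norm (grad f x)" "{x. fstar f t < ennreal \<bar>f x\<bar>}" t]
    by (simp add: fstar_eq_rearr_lborel sigma_finite_lborel)
qed

text \<open>The level bounds add up because the sets \<open>f\<^sup>*(t / 2 ^ j) < |f| \<le> f\<^sup>*(t / 2 ^ (j + 1))\<close> are disjoint.\<close>

lemma test_fun_dyadic_sum_bound:
  fixes f :: "real^'n \<Rightarrow> real"
  assumes f: "test_fun f" and t: "0 < t" and p: "\<And>s. fstar f s = ennreal (p s)" "\<And>s. 0 \<le> p s"
  shows "ennreal (\<Sum>j<N. (t / 2 ^ Suc j) powr (1 - 1 / real CARD('n)) * (p (t / 2 ^ Suc j) - p (t / 2 ^ j)))
    \<le> of_nat CARD('n) * (\<integral>\<^sup>+ x. ennreal (norm (grad f x)) * indicator {x. fstar f t < ennreal \<bar>f x\<bar>} x \<partial>lborel)"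
    (is "ennreal (\<Sum>j<N. ?y j) \<le> _")
proof -
  note [measurable] = test_fun_borel_measurable[OF f] test_fun_borel_measurable_grad[OF f]
  define J where "J a b = (\<integral>\<^sup>+ x. ennreal (norm (grad f x)) * indicator {x. a < \<bar>f x\<bar> \<and> \<bar>f x\<bar> \<le> b} x \<partial>lborel)" for a b
  have anti: "p b \<le> p a" if "a \<le> b" for a b
    using fstar_antimono[OF that, of f] p by simp
  have dec: "t / 2 ^ Suc j \<le> t / 2 ^ j" for j using t by (simp add: field_simps)
  have "ennreal (\<Sum>j<N. ?y j) \<le> of_nat CARD('n) * J (p t) (p (t / 2 ^ N))"
  proof (induction N)
    case (Suc N)
    have y: "0 \<le> ?y j" for j using anti[OF dec[of j]] by simp
    have "ennreal (\<Sum>j<Suc N. ?y j) = ennreal (\<Sum>j<N. ?y j) + ennreal (?y N)"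
      using y by (simp add: ennreal_plus sum_nonneg)
    also have "\<dots> \<le> of_nat CARD('n) * J (p t) (p (t / 2 ^ N)) + of_nat CARD('n) * J (p (t / 2 ^ N)) (p (t / 2 ^ Suc N))"
      unfolding J_def using t p anti[OF dec[of N]]
      by (intro add_mono Suc[unfolded J_def] test_fun_fstar_difference_bound f) auto
    also have "\<dots> = of_nat CARD('n) * (J (p t) (p (t / 2 ^ N)) + J (p (t / 2 ^ N)) (p (t / 2 ^ Suc N)))"
      by (simp add: distrib_left)
    also have "J (p t) (p (t / 2 ^ N)) + J (p (t / 2 ^ N)) (p (t / 2 ^ Suc N)) = J (p t) (p (t / 2 ^ Suc N))"
    proof -
      have "p t \<le> p (t / 2 ^ N)" using t by (intro anti) (simp add: field_simps)
      then show ?thesis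
        unfolding J_def using anti[OF dec[of N]]
        by (subst nn_integral_add[symmetric]) (auto intro!: nn_integral_cong simp: indicator_def)
    qed
    finally show ?case .
  qed simp
  also have "\<dots> \<le> of_nat CARD('n) * (\<integral>\<^sup>+ x. ennreal (norm (grad f x)) * indicator {x. fstar f t < ennreal \<bar>f x\<bar>} x \<partial>lborel)"
    unfolding J_def p(1) using p(2)
    by (intro mult_left_mono nn_integral_mono) (auto simp: indicator_def ennreal_less_iff)
  finally show ?thesis .
qed

lemma powr_halves:
  fixes t r :: real
  assumes "0 < t"
  shows "(t / 2 ^ Suc k) powr r = (1 / 2) powr r * (t / 2 ^ k) powr r"
  using assms by (simp flip: powr_mult)

lemma powr_dyadic_tendsto_0:
  fixes t r :: real
  assumes "0 < t" "0 < r"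
  shows "(\<lambda>k. (t / 2 ^ k) powr r) \<longlonglongrightarrow> 0"
proof -
  have eq: "(t / 2 ^ k) powr r = ((1 / 2) powr r) ^ k * t powr r" for k
  proof (induction k)
    case (Suc k)
    then show ?case using powr_halves[OF assms(1), of k r] by simp
  qed simp
  have "(1 / 2 :: real) powr r < 1 powr r" using assms by (intro powr_less_mono2) auto
  then have "(\<lambda>k. ((1 / 2) powr r) ^ k * t powr r) \<longlonglongrightarrow> 0 * t powr r"
    by (intro tendsto_intros LIMSEQ_realpow_zero) auto
  then show ?thesis by (simp add: eq)
qed

text \<open>The right-hand side stays a gradient integral over {|f| > \<open>fstar f t\<close>}
  because it is used twice: Hardy-Littlewood turns it into (ii), and enlarging it to the whole space
  gives one half of the Lorentz bound.\<close>

lemma test_fun_oscillation_integral_bound: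
  fixes f :: "real^'n \<Rightarrow> real"
  assumes dim: "2 \<le> CARD('n)"
  shows "\<exists>c>0. \<forall>f :: real^'n \<Rightarrow> real. test_fun f \<longrightarrow> (\<forall>t>0.
    (\<integral>\<^sup>+ s\<in>{0<..<t}. ennreal (s powr (- 1 / real CARD('n))) * (fstarstar f s - fstar f s) \<partial>lborel)
      \<le> ennreal c * (\<integral>\<^sup>+ x. ennreal (norm (grad f x)) * indicator {x. fstar f t < ennreal \<bar>f x\<bar>} x \<partial>lborel))"
proof -
  define n where "n = real CARD('n)"
  define \<theta> where "\<theta> = 1 - 1 / n"
  define q where "q = (1 / 2 :: real) powr (1 / n)"
  have n: "2 \<le> n" using dim by (simp add: n_def)
  have \<theta>: "0 < \<theta>" using n by (simp add: \<theta>_def)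
  have q: "0 < q" "q < 1" using n powr_less_mono2[of "1 / n" "1 / 2 :: real" 1] by (auto simp: q_def)
  \<comment> \<open>The factor 1/q comes from taking s^(-1/n) at the left end of a cell, 1/(1 - q)
    from the recursion, 2^\<theta> from passing between the two ends of a cell in y, and n from the
    level-set bound.\<close>
  define C where "C = 1 / q * (1 / (1 - q)) * (2 powr \<theta> * n)"
  have C: "0 < C" using n q by (simp add: C_def)
  have "(\<integral>\<^sup>+ s\<in>{0<..<t}. ennreal (s powr (- 1 / n)) * (fstarstar f s - fstar f s) \<partial>lborel)
      \<le> ennreal C * (\<integral>\<^sup>+ x. ennreal (norm (grad f x)) * indicator {x. fstar f t < ennreal \<bar>f x\<bar>} x \<partial>lborel)"
    (is "?L \<le> _ * ?J")
    if f: "test_fun f" and t: "0 < t" for f :: "real^'n \<Rightarrow> real" and t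
  proof (cases "?J = \<infinity>")
    case True
    then show ?thesis using C by (simp add: ennreal_mult_top)
  next
    case False
    then obtain \<rho> where \<rho>: "?J = ennreal \<rho>" "0 \<le> \<rho>" by (cases ?J) auto
    obtain B where B: "0 \<le> B" "\<forall>x. \<bar>f x\<bar> \<le> B" using test_fun_bounded[OF f] by blast
    define p where "p s = enn2real (fstar f s)" for s
    have p: "fstar f s = ennreal (p s)" "0 \<le> p s" for s
      using test_fun_fstar_finite[OF f, of s] by (auto simp: p_def less_top)
    have anti: "p b \<le> p a" if "a \<le> b" for a b
      using fstar_antimono[OF that, of f] p by simp
    have pB: "p s \<le> B" for s
      using test_fun_fstar_le[OF f B(1), of s] B p(1)[of s] by simp
    have oscB: "oscillation f s \<le> ennreal (B * s)" if "0 < s" for s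
    proof -
      have "oscillation f s \<le> (\<integral>\<^sup>+ r. ennreal B * indicator {0<..<s} r \<partial>lborel)"
        unfolding oscillation_def using p pB
        by (intro nn_integral_mono) (auto simp: indicator_def intro!: order_trans[OF diff_le_self_ennreal] ennreal_leI)
      also have "\<dots> = ennreal (B * s)"
        using that B by (simp add: nn_integral_cmult_indicator ennreal_mult)
      finally show ?thesis .
    qed
    define w where "w s = enn2real (oscillation f s)" for s
    have w: "oscillation f s = ennreal (w s)" "0 \<le> w s" "w s \<le> B * s" if "0 < s" for s
    proof -
      have "oscillation f s < top" using oscB[OF that] ennreal_less_top order_le_less_trans by blast
      then show "oscillation f s = ennreal (w s)" "0 \<le> w s" by (simp_all add: w_def)
      with oscB[OF that] B that show "w s \<le> B * s" by simp
    qed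
    define \<tau> where "\<tau> k = t / 2 ^ k" for k :: nat
    have \<tau>: "0 < \<tau> k" "\<tau> (Suc k) < \<tau> k" "\<tau> k = 2 * \<tau> (Suc k)" for k
      using t by (auto simp: \<tau>_def field_simps)
    define x where "x k = \<tau> k powr (- 1 / n) * w (\<tau> k)" for k
    define y where "y k = 2 powr \<theta> * (\<tau> (Suc k) powr \<theta> * (p (\<tau> (Suc k)) - p (\<tau> k)))" for k
    \<comment> \<open>Subtracting the larger level \<open>p (\<tau> (Suc k))\<close> on the left
      half loses at most \<open>?D\<close>; on the right half the integrand itself is at most
      \<open>?D\<close>.\<close>
    have osc_rec: "w (\<tau> k) \<le> w (\<tau> (Suc k)) + \<tau> k * (p (\<tau> (Suc k)) - p (\<tau> k))" for k
    proof -
      let ?D = "p (\<tau> (Suc k)) - p (\<tau> k)"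
      have D: "0 \<le> ?D" using anti \<tau>[of k] by simp
      have "oscillation f (\<tau> k) \<le> (\<integral>\<^sup>+ r. (fstar f r - fstar f (\<tau> (Suc k))) * indicator {0<..<\<tau> (Suc k)} r
          + ennreal ?D * indicator {0<..<\<tau> k} r \<partial>lborel)"
        unfolding oscillation_def
      proof (rule nn_integral_mono)
        fix r
        show "(fstar f r - fstar f (\<tau> k)) * indicator {0<..<\<tau> k} r
            \<le> (fstar f r - fstar f (\<tau> (Suc k))) * indicator {0<..<\<tau> (Suc k)} r + ennreal ?D * indicator {0<..<\<tau> k} r"
        proof (cases "0 < r \<and> r < \<tau> k")
          case True
          show ?thesis
          proof (cases "r < \<tau> (Suc k)")
            case r: True
            then have "p (\<tau> (Suc k)) \<le> p r" by (intro anti) simp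
            then show ?thesis using True r D p
              by (simp add: indicator_def ennreal_minus ennreal_plus[symmetric] del: ennreal_plus)
          next
            case r: False
            then have "p r \<le> p (\<tau> (Suc k))" by (intro anti) simp
            then show ?thesis using True r D p
              by (simp add: indicator_def ennreal_minus ennreal_leI)
          qed
        qed simp
      qed
      also have "\<dots> = oscillation f (\<tau> (Suc k)) + ennreal ?D * ennreal (\<tau> k)"
        unfolding oscillation_def using \<tau>[of k] by (subst nn_integral_add) (auto simp: nn_integral_cmult_indicator)
      finally have "ennreal (w (\<tau> k)) \<le> ennreal (w (\<tau> (Suc k)) + ?D * \<tau> k)"
        using w[OF \<tau>(1)] \<tau>(1)[of k] D by (simp add: ennreal_mult ennreal_plus)
      then show ?thesis
        using w(2)[OF \<tau>(1), of "Suc k"] \<tau>(1)[of k] D by (subst (asm) ennreal_le_iff) (auto simp: mult.commute)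
    qed
    \<comment> \<open>Halving the argument multiplies s^(-1/n) by 1/q, so expressing the old weight
      by the new one gains the factor q < 1.\<close>
    have x_rec: "x k \<le> q * x (Suc k) + y k" for k
    proof -
      have e1: "\<tau> (Suc k) powr (- 1 / n) = 1 / q * \<tau> k powr (- 1 / n)"
        using powr_halves[OF t, of k "- 1 / n"] by (simp add: \<tau>_def q_def powr_minus_divide)
      have e2: "\<tau> (Suc k) powr \<theta> = (1 / 2) powr \<theta> * \<tau> k powr \<theta>"
        unfolding \<tau>_def by (rule powr_halves[OF t])
      have e3: "\<tau> k powr (- 1 / n) * \<tau> k = \<tau> k powr \<theta>"
        using \<tau>(1)[of k] powr_add[of "\<tau> k" "- 1 / n" 1] by (simp add: \<theta>_def)
      have "x k \<le> \<tau> k powr (- 1 / n) * (w (\<tau> (Suc k)) + \<tau> k * (p (\<tau> (Suc k)) - p (\<tau> k)))"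
        unfolding x_def by (intro mult_left_mono osc_rec) auto
      also have "\<dots> = \<tau> k powr (- 1 / n) * w (\<tau> (Suc k)) + \<tau> k powr \<theta> * (p (\<tau> (Suc k)) - p (\<tau> k))"
        by (simp add: distrib_left e3[symmetric])
      also have "\<tau> k powr (- 1 / n) * w (\<tau> (Suc k)) = q * x (Suc k)"
        unfolding x_def e1 using q by simp
      also have "\<tau> k powr \<theta> * (p (\<tau> (Suc k)) - p (\<tau> k)) = y k"
        unfolding y_def e2 by (simp add: powr_divide)
      finally show ?thesis .
    qed
    have ysum: "(\<Sum>k<N. y k) \<le> 2 powr \<theta> * (n * \<rho>)" for N
    proof -
      have "ennreal (\<Sum>j<N. \<tau> (Suc j) powr \<theta> * (p (\<tau> (Suc j)) - p (\<tau> j))) \<le> ennreal (n * \<rho>)"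
        using test_fun_dyadic_sum_bound[OF f t p, of N] \<rho> n
        by (simp add: \<theta>_def n_def \<tau>_def ennreal_mult ennreal_of_nat_eq_real_of_nat del: power_Suc)
      then have "(\<Sum>j<N. \<tau> (Suc j) powr \<theta> * (p (\<tau> (Suc j)) - p (\<tau> j))) \<le> n * \<rho>"
        using n \<rho> by (subst (asm) ennreal_le_iff) auto
      then show ?thesis unfolding y_def by (simp add: sum_distrib_left[symmetric])
    qed
    have x0: "0 \<le> x k" for k unfolding x_def using w(2)[OF \<tau>(1)] by simp
    \<comment> \<open>Boundedness of f gives \<open>w s\<close> at most B s, and \<theta> is
      positive; this disposes of the boundary term \<open>x N\<close> of the recursion.\<close>
    have xlim: "x \<longlonglongrightarrow> 0"
    proof (rule tendsto_sandwich)
      show "\<forall>\<^sub>F k in sequentially. 0 \<le> x k" using x0 by simp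
      have "x k \<le> B * \<tau> k powr \<theta>" for k
      proof -
        have "x k \<le> \<tau> k powr (- 1 / n) * (B * \<tau> k)"
          unfolding x_def by (intro mult_left_mono w \<tau>) auto
        also have "\<dots> = B * \<tau> k powr \<theta>"
          using \<tau>(1)[of k] powr_add[of "\<tau> k" "- 1 / n" 1] by (simp add: \<theta>_def)
        finally show ?thesis .
      qed
      then show "\<forall>\<^sub>F k in sequentially. x k \<le> B * \<tau> k powr \<theta>" by simp
      show "(\<lambda>k. B * \<tau> k powr \<theta>) \<longlonglongrightarrow> 0"
        unfolding \<tau>_def using tendsto_mult_left[OF powr_dyadic_tendsto_0[OF t \<theta>], of B] by simp
    qed simp
    \<comment> \<open>An upper bound on the whole cell: the decreasing factors s^(-1/n) and 1/s are
      taken at its left end, the increasing \<open>oscillation\<close> at its right end.\<close>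
    define c where "c k = \<tau> (Suc k) powr (- 1 / n) * (w (\<tau> k) / \<tau> (Suc k))" for k
    have "?L \<le> ennreal (C * \<rho>)"
    proof (rule nn_integral_dyadic_le[OF _ t])
      show "(\<lambda>s. ennreal (s powr (- 1 / n)) * (fstarstar f s - fstar f s)) \<in> borel_measurable borel"
        by measurable
      fix k s assume s: "t / 2 ^ Suc k < s" "s \<le> t / 2 ^ k"
      then have s': "\<tau> (Suc k) < s" "s \<le> \<tau> k" "0 < s" using \<tau>(1)[of "Suc k"] by (auto simp: \<tau>_def)
      have "fstarstar f s - fstar f s = oscillation f s / ennreal s"
        using s' p by (intro fstarstar_minus_fstar) auto
      also have "\<dots> \<le> ennreal (w (\<tau> k)) / ennreal s"
        using oscillation_mono[OF s'(2), of f] w(1)[OF \<tau>(1)] by (simp add: divide_right_mono_ennreal)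
      also have "\<dots> = ennreal (w (\<tau> k) / s)"
        using s' w[OF \<tau>(1)] by (simp add: divide_ennreal)
      also have "\<dots> \<le> ennreal (w (\<tau> k) / \<tau> (Suc k))"
        using s' w[OF \<tau>(1)] \<tau>(1)[of "Suc k"] by (intro ennreal_leI divide_left_mono) auto
      finally have "ennreal (s powr (- 1 / n)) * (fstarstar f s - fstar f s)
          \<le> ennreal (s powr (- 1 / n)) * ennreal (w (\<tau> k) / \<tau> (Suc k))"
        by (rule mult_left_mono) simp
      also have "\<dots> \<le> ennreal (\<tau> (Suc k) powr (- 1 / n)) * ennreal (w (\<tau> k) / \<tau> (Suc k))"
        using s' \<tau>(1)[of "Suc k"] n by (intro mult_right_mono ennreal_leI powr_mono2') auto
      also have "\<dots> = ennreal (c k)"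
        unfolding c_def using w[OF \<tau>(1)] \<tau>(1)[of "Suc k"] by (simp add: ennreal_mult[symmetric])
      finally show "ennreal (s powr (- 1 / n)) * (fstarstar f s - fstar f s) \<le> ennreal (c k)" .
    next
      show "0 \<le> c k" for k unfolding c_def using w[OF \<tau>(1)] \<tau>(1)[of "Suc k"] by simp
      show "(\<lambda>N. 1 / q * (1 / (1 - q)) * x N) \<longlonglongrightarrow> 0"
        using tendsto_mult_left[OF xlim, of "1 / q * (1 / (1 - q))"] by simp
      fix N
      have "c k * (t / 2 ^ Suc k) = 1 / q * x k" for k
        using powr_halves[OF t, of k "- 1 / n"] \<tau>(1)[of "Suc k"]
        by (simp add: c_def x_def \<tau>_def q_def powr_minus_divide del: power_Suc)
      then have "(\<Sum>k<N. c k * (t / 2 ^ Suc k)) = 1 / q * (\<Sum>k<N. x k)"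
        by (simp add: sum_distrib_left)
      also have "\<dots> \<le> 1 / q * ((x N + 2 powr \<theta> * (n * \<rho>)) / (1 - q))"
      proof (intro mult_left_mono)
        have "(\<Sum>k<N. x k) \<le> (x N + (\<Sum>k<N. y k)) / (1 - q)"
          using q x0 x_rec by (intro geometric_recursion_up) auto
        also have "\<dots> \<le> (x N + 2 powr \<theta> * (n * \<rho>)) / (1 - q)"
          using q ysum by (intro divide_right_mono add_left_mono) auto
        finally show "(\<Sum>k<N. x k) \<le> (x N + 2 powr \<theta> * (n * \<rho>)) / (1 - q)" .
      qed (use q in simp)
      also have "\<dots> = 1 / q * (1 / (1 - q)) * x N + C * \<rho>"
        unfolding C_def by (simp add: add_divide_distrib distrib_left mult.assoc)
      finally show "(\<Sum>k<N. c k * (t / 2 ^ Suc k)) \<le> 1 / q * (1 / (1 - q)) * x N + C * \<rho>" .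
    qed
    then show ?thesis using \<rho> C by (simp add: ennreal_mult)
  qed
  then show ?thesis using C unfolding n_def by blast
qed

section \<open>The Lorentz norm\<close>

text \<open>Here the weighted value at \<open>\<tau> (Suc k)\<close> is q times the one at
  \<open>\<tau> k\<close> plus a slab term, with q = 2^(-\<theta>), so the recursion starts at t
  instead of ending at 0. The condition \<open>fstar f t = 0\<close> makes its starting term
  vanish.\<close>

lemma test_fun_fstar_integral_bound:
  assumes dim: "2 \<le> CARD('n)"
  shows "\<exists>c>0. \<forall>f :: real^'n \<Rightarrow> real. test_fun f \<longrightarrow> (\<forall>t>0. fstar f t = 0 \<longrightarrow>
    (\<integral>\<^sup>+ s\<in>{0<..<t}. ennreal (s powr (- 1 / real CARD('n))) * fstar f s \<partial>lborel)
      \<le> ennreal c * (\<integral>\<^sup>+ x. ennreal (norm (grad f x)) \<partial>lborel))"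
proof -
  define n where "n = real CARD('n)"
  define \<theta> where "\<theta> = 1 - 1 / n"
  define q where "q = (1 / 2 :: real) powr \<theta>"
  have n: "2 \<le> n" using dim by (simp add: n_def)
  have \<theta>: "0 < \<theta>" using n by (simp add: \<theta>_def)
  have q: "0 < q" "q < 1" using \<theta> powr_less_mono2[of \<theta> "1 / 2 :: real" 1] by (auto simp: q_def)
  define C where "C = n / (1 - q)"
  have C: "0 < C" using n q by (simp add: C_def)
  have "(\<integral>\<^sup>+ s\<in>{0<..<t}. ennreal (s powr (- 1 / n)) * fstar f s \<partial>lborel)
      \<le> ennreal C * (\<integral>\<^sup>+ x. ennreal (norm (grad f x)) \<partial>lborel)"
    (is "?L \<le> _ * ?J")
    if f: "test_fun f" and t: "0 < t" and z: "fstar f t = 0" for f :: "real^'n \<Rightarrow> real" and t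
  proof (cases "?J = \<infinity>")
    case True
    then show ?thesis using C by (simp add: ennreal_mult_top)
  next
    case False
    then obtain \<rho> where \<rho>: "?J = ennreal \<rho>" "0 \<le> \<rho>" by (cases ?J) auto
    define p where "p s = enn2real (fstar f s)" for s
    have p: "fstar f s = ennreal (p s)" "0 \<le> p s" for s
      using test_fun_fstar_finite[OF f, of s] by (auto simp: p_def less_top)
    have anti: "p b \<le> p a" if "a \<le> b" for a b
      using fstar_antimono[OF that, of f] p by simp
    define \<tau> where "\<tau> k = t / 2 ^ k" for k :: nat
    have \<tau>: "0 < \<tau> k" "\<tau> (Suc k) < \<tau> k" "\<tau> k = 2 * \<tau> (Suc k)" for k
      using t by (auto simp: \<tau>_def field_simps)
    define x where "x k = \<tau> k powr \<theta> * p (\<tau> k)" for k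
    define y where "y k = \<tau> (Suc k) powr \<theta> * (p (\<tau> (Suc k)) - p (\<tau> k))" for k
    have x_rec: "x (Suc k) \<le> q * x k + y k" for k
    proof -
      have "\<tau> (Suc k) powr \<theta> = q * \<tau> k powr \<theta>"
        unfolding \<tau>_def q_def by (rule powr_halves[OF t])
      then show ?thesis by (simp add: x_def y_def algebra_simps)
    qed
    have ysum: "(\<Sum>k<N. y k) \<le> n * \<rho>" for N
    proof -
      have "ennreal (\<Sum>k<N. y k)
        \<le> ennreal n * (\<integral>\<^sup>+ x. ennreal (norm (grad f x)) * indicator {x. fstar f t < ennreal \<bar>f x\<bar>} x \<partial>lborel)"
        using test_fun_dyadic_sum_bound[OF f t p, of N]
        by (simp add: y_def \<theta>_def n_def \<tau>_def ennreal_of_nat_eq_real_of_nat del: power_Suc)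
      also have "\<dots> \<le> ennreal n * ?J"
        by (intro mult_left_mono nn_integral_mono) (auto simp: indicator_def)
      also have "\<dots> = ennreal (n * \<rho>)" using \<rho> n by (simp add: ennreal_mult)
      finally show ?thesis using n \<rho> by (subst (asm) ennreal_le_iff) auto
    qed
    have x0: "0 \<le> x k" for k unfolding x_def using p by simp
    have "p t = 0" using z p[of t] by simp
    then have x_0: "x 0 = 0" by (simp add: x_def \<tau>_def)
    define c where "c k = \<tau> (Suc k) powr (- 1 / n) * p (\<tau> (Suc k))" for k
    have "?L \<le> ennreal (C * \<rho>)"
    proof (rule nn_integral_dyadic_le[OF _ t])
      show "(\<lambda>s. ennreal (s powr (- 1 / n)) * fstar f s) \<in> borel_measurable borel"
        by measurable
      fix k s assume s: "t / 2 ^ Suc k < s" "s \<le> t / 2 ^ k"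
      then have s': "\<tau> (Suc k) < s" "s \<le> \<tau> k" "0 < s" using \<tau>(1)[of "Suc k"] by (auto simp: \<tau>_def)
      have "ennreal (s powr (- 1 / n)) * fstar f s \<le> ennreal (\<tau> (Suc k) powr (- 1 / n)) * fstar f (\<tau> (Suc k))"
        using s' \<tau>(1)[of "Suc k"] n by (intro mult_mono ennreal_leI powr_mono2' fstar_antimono) auto
      then show "ennreal (s powr (- 1 / n)) * fstar f s \<le> ennreal (c k)"
        unfolding c_def p(1) using p(2) by (simp add: ennreal_mult)
    next
      show "0 \<le> c k" for k unfolding c_def using p by simp
      show "(\<lambda>N. 0) \<longlonglongrightarrow> (0 :: real)" by simp
      fix N
      have "c k * (t / 2 ^ Suc k) = x (Suc k)" for k
        using t \<tau>(1)[of "Suc k"] powr_add[of "\<tau> (Suc k)" "- 1 / n" 1] by (simp add: c_def x_def \<tau>_def \<theta>_def)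
      then have "(\<Sum>k<N. c k * (t / 2 ^ Suc k)) = (\<Sum>k<N. x (Suc k))" by simp
      also have "\<dots> \<le> (x 0 + (\<Sum>k<N. y k)) / (1 - q)"
        using q x0 x_rec by (intro geometric_recursion_down) auto
      also have "\<dots> \<le> n * \<rho> / (1 - q)"
        using q ysum x_0 by (intro divide_right_mono) auto
      finally show "(\<Sum>k<N. c k * (t / 2 ^ Suc k)) \<le> 0 + C * \<rho>" by (simp add: C_def)
    qed
    then show ?thesis using \<rho> C by (simp add: ennreal_mult)
  qed
  then show ?thesis using C unfolding n_def by blast
qed

text \<open>\<open>fstarstar f\<close> is split into \<open>fstar f\<close> and the difference of
  the two. Both parts are bounded independently of t once \<open>fstar f t\<close> is 0, so t tends
  to infinity by monotone convergence.\<close>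

lemma test_fun_lorentz_norm_bound:
  assumes dim: "2 \<le> CARD('n)"
  shows "\<exists>c>0. \<forall>f :: real^'n \<Rightarrow> real. test_fun f \<longrightarrow>
    lorentz_norm f \<le> ennreal c * (\<integral>\<^sup>+ x. ennreal (norm (grad f x)) \<partial>lborel)"
proof -
  define n where "n = real CARD('n)"
  obtain c1 where c1: "0 < c1" "\<And>f :: real^'n \<Rightarrow> real. \<And>t. test_fun f \<Longrightarrow> 0 < t \<Longrightarrow>
    (\<integral>\<^sup>+ s\<in>{0<..<t}. ennreal (s powr (- 1 / n)) * (fstarstar f s - fstar f s) \<partial>lborel)
      \<le> ennreal c1 * (\<integral>\<^sup>+ x. ennreal (norm (grad f x)) * indicator {x. fstar f t < ennreal \<bar>f x\<bar>} x \<partial>lborel)"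
    using test_fun_oscillation_integral_bound[OF dim] unfolding n_def by blast
  obtain c2 where c2: "0 < c2" "\<And>f :: real^'n \<Rightarrow> real. \<And>t. test_fun f \<Longrightarrow> 0 < t \<Longrightarrow> fstar f t = 0 \<Longrightarrow>
    (\<integral>\<^sup>+ s\<in>{0<..<t}. ennreal (s powr (- 1 / n)) * fstar f s \<partial>lborel)
      \<le> ennreal c2 * (\<integral>\<^sup>+ x. ennreal (norm (grad f x)) \<partial>lborel)"
    using test_fun_fstar_integral_bound[OF dim] unfolding n_def by blast
  have "lorentz_norm f \<le> ennreal (c1 + c2) * (\<integral>\<^sup>+ x. ennreal (norm (grad f x)) \<partial>lborel)" (is "_ \<le> _ * ?J")
    if f: "test_fun f" for f :: "real^'n \<Rightarrow> real"
  proof -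
    obtain T where T: "0 < T" "\<forall>s\<ge>T. fstar f s = 0" using test_fun_fstar_eventually_zero[OF f] by blast
    let ?g = "\<lambda>s. ennreal (s powr (- 1 / n)) * fstarstar f s"
    have bound: "(\<integral>\<^sup>+ s\<in>{0<..<t}. ?g s \<partial>lborel) \<le> ennreal (c1 + c2) * ?J" if "T \<le> t" for t
    proof -
      have t: "0 < t" "fstar f t = 0" using T that by auto
      have "(\<integral>\<^sup>+ s\<in>{0<..<t}. ?g s \<partial>lborel)
        = (\<integral>\<^sup>+ s. ennreal (s powr (- 1 / n)) * (fstarstar f s - fstar f s) * indicator {0<..<t} s
          + ennreal (s powr (- 1 / n)) * fstar f s * indicator {0<..<t} s \<partial>lborel)"
      proof (rule nn_integral_cong)
        fix s
        show "?g s * indicator {0<..<t} s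
          = ennreal (s powr (- 1 / n)) * (fstarstar f s - fstar f s) * indicator {0<..<t} s
          + ennreal (s powr (- 1 / n)) * fstar f s * indicator {0<..<t} s"
          using fstar_le_fstarstar[of s f] test_fun_fstar_finite[OF f, of s]
          by (cases "0 < s") (auto simp: indicator_def distrib_left[symmetric] diff_add_cancel_ennreal)
      qed
      also have "\<dots> = (\<integral>\<^sup>+ s\<in>{0<..<t}. ennreal (s powr (- 1 / n)) * (fstarstar f s - fstar f s) \<partial>lborel)
        + (\<integral>\<^sup>+ s\<in>{0<..<t}. ennreal (s powr (- 1 / n)) * fstar f s \<partial>lborel)"
        by (intro nn_integral_add) measurable
      also have "\<dots> \<le> ennreal c1 * ?J + ennreal c2 * ?J"
      proof (intro add_mono c2(2)[OF f t] order_trans[OF c1(2)[OF f t(1)]] mult_left_mono nn_integral_mono)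
        fix x show "ennreal (norm (grad f x)) * indicator {x. fstar f t < ennreal \<bar>f x\<bar>} x \<le> ennreal (norm (grad f x))"
          by (simp add: indicator_def)
      qed simp
      also have "\<dots> = ennreal (c1 + c2) * ?J" using c1(1) c2(1) by (simp add: distrib_right)
      finally show ?thesis .
    qed
    have "lorentz_norm f \<le> (\<integral>\<^sup>+ s. (SUP N. ?g s * indicator {0<..<T + real N} s) \<partial>lborel)"
      unfolding lorentz_norm_def
    proof (rule nn_integral_mono)
      fix s :: real
      show "fstarstar f s * ennreal (s powr (1 - 1 / real CARD('n)) / s) * indicator {0<..} s
        \<le> (SUP N. ?g s * indicator {0<..<T + real N} s)"
      proof (cases "0 < s")
        case True
        obtain N where "s < real N" using reals_Archimedean2 by blast
        then have "s < T + real N" using T by simp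
        moreover have "s powr (1 - 1 / n) / s = s powr (- 1 / n)"
          using True by (simp add: powr_diff powr_minus_divide)
        ultimately have eq: "fstarstar f s * ennreal (s powr (1 - 1 / real CARD('n)) / s) * indicator {0<..} s
            = ?g s * indicator {0<..<T + real N} s"
          using True by (simp add: n_def mult.commute)
        show ?thesis by (rule SUP_upper2[of N]) (simp, rule eq_refl[OF eq])
      qed simp
    qed
    also have "\<dots> = (SUP N. \<integral>\<^sup>+ s\<in>{0<..<T + real N}. ?g s \<partial>lborel)"
      by (intro nn_integral_monotone_convergence_SUP incseq_SucI le_funI) (auto simp: indicator_def)
    also have "\<dots> \<le> ennreal (c1 + c2) * ?J" by (intro SUP_least bound) simp
    finally show ?thesis .
  qed
  then show ?thesis using c1(1) c2(1) by (intro exI[of _ "c1 + c2"]) auto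
qed

section \<open>Lower semicontinuity and the passage from test functions to the Sobolev space\<close>

lemma emeasure_superlevel_liminf:
  assumes [measurable]: "\<And>k. u k \<in> borel_measurable M" "v \<in> borel_measurable M"
    and lim: "AE x in M. (\<lambda>k. u k x) \<longlonglongrightarrow> (v x :: real)"
  shows "emeasure M {x \<in> space M. l < v x} \<le> liminf (\<lambda>k. emeasure M {x \<in> space M. l < u k x})"
proof -
  have "emeasure M {x \<in> space M. l < v x} = (\<integral>\<^sup>+ x. indicator {x \<in> space M. l < v x} x \<partial>M)" by simp
  also have "\<dots> \<le> (\<integral>\<^sup>+ x. liminf (\<lambda>k. indicator {x \<in> space M. l < u k x} x) \<partial>M)"
  proof (rule nn_integral_mono_AE)
    show "AE x in M. indicator {x \<in> space M. l < v x} x \<le> liminf (\<lambda>k. indicator {x \<in> space M. l < u k x} x :: ennreal)"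
      using lim AE_space
    proof eventually_elim
      case (elim x)
      show ?case
      proof (cases "l < v x")
        case True
        then have "\<forall>\<^sub>F k in sequentially. 1 \<le> (indicator {x \<in> space M. l < u k x} x :: ennreal)"
          using order_tendstoD(1)[OF elim(1) True] elim(2) by (auto elim!: eventually_mono)
        then have "1 \<le> liminf (\<lambda>k. indicator {x \<in> space M. l < u k x} x :: ennreal)"
          by (rule Liminf_bounded)
        then show ?thesis by (rule order_trans[rotated]) (simp add: indicator_def)
      qed simp
    qed
  qed
  also have "\<dots> \<le> liminf (\<lambda>k. \<integral>\<^sup>+ x. indicator {x \<in> space M. l < u k x} x \<partial>M)"
    by (intro nn_integral_liminf) measurable
  finally show ?thesis by simp
qed

text \<open>The condition l < v x is open, so Fatou's lemma for indicators makes the distribution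
  function lower semicontinuous; \<open>less_rearr_iff\<close> translates this to
  rearrangements.\<close>

lemma rearr_liminf:
  assumes [measurable]: "\<And>k. u k \<in> borel_measurable M" "v \<in> borel_measurable M"
    and lim: "AE x in M. (\<lambda>k. u k x) \<longlonglongrightarrow> (v x :: real)"
  shows "rearr M (\<lambda>x. ennreal (v x)) s \<le> liminf (\<lambda>k. rearr M (\<lambda>x. ennreal (u k x)) s)"
proof (rule dense_le)
  fix l assume l: "l < rearr M (\<lambda>x. ennreal (v x)) s"
  then obtain r where r: "l = ennreal r" "0 \<le> r" by (cases l) auto
  have lev: "{x \<in> space M. ennreal r < ennreal (g x)} = {x \<in> space M. r < g x}" for g
    using r by (auto simp: ennreal_less_iff)
  have "ennreal s < emeasure M {x \<in> space M. r < v x}"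
    using l unfolding r by (subst (asm) less_rearr_iff) (auto simp: lev)
  also have "\<dots> \<le> liminf (\<lambda>k. emeasure M {x \<in> space M. r < u k x})"
    by (intro emeasure_superlevel_liminf assms)
  finally have "\<forall>\<^sub>F k in sequentially. ennreal s < emeasure M {x \<in> space M. r < u k x}"
    by (rule less_LiminfD)
  then have "\<forall>\<^sub>F k in sequentially. l \<le> rearr M (\<lambda>x. ennreal (u k x)) s"
  proof eventually_elim
    case (elim k)
    then have "l < rearr M (\<lambda>x. ennreal (u k x)) s"
      unfolding r by (subst less_rearr_iff) (auto simp: lev)
    then show ?case by simp
  qed
  then show "l \<le> liminf (\<lambda>k. rearr M (\<lambda>x. ennreal (u k x)) s)" by (rule Liminf_bounded)
qed

lemma test_fun_integrable:
  fixes f :: "real^'n \<Rightarrow> real"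
  assumes f: "test_fun f"
  shows "integrable lebesgue f"
proof -
  obtain R where R: "\<forall>x. R < norm x \<longrightarrow> f x = 0" using test_fun_vanishes_outside_cball[OF f] by blast
  have "integrable lborel (\<lambda>x. indicator (cball 0 R) x *\<^sub>R f x)"
    by (intro borel_integrable_compact test_fun_continuous_on[OF f] compact_cball)
  moreover have "(\<lambda>x. indicator (cball 0 R) x *\<^sub>R f x) = f"
    using R by (auto simp: indicator_def fun_eq_iff)
  ultimately show ?thesis by (simp add: integrable_completion test_fun_borel_measurable[OF f])
qed

lemma liminf_cmult_ennreal:
  fixes u :: "nat \<Rightarrow> ennreal"
  assumes "c < \<infinity>"
  shows "liminf (\<lambda>k. c * u k) = c * liminf u"
  using assms by (intro Liminf_compose_continuous_mono ennreal_continuous_on_cmult continuous_on_id)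
    (auto simp: mono_def mult_left_mono)

text \<open>Fatou's lemma is applied twice: to the integral inside \<open>fstarstar\<close> and to
  the weighted integral over s.\<close>

lemma lorentz_norm_liminf:
  fixes u :: "nat \<Rightarrow> real^'n \<Rightarrow> real"
  assumes [measurable]: "\<And>k. u k \<in> borel_measurable lebesgue" "v \<in> borel_measurable lebesgue"
    and lim: "AE x in lebesgue. (\<lambda>k. u k x) \<longlonglongrightarrow> v x"
  shows "lorentz_norm v \<le> liminf (\<lambda>k. lorentz_norm (u k))"
proof -
  have star: "fstar v s \<le> liminf (\<lambda>k. fstar (u k) s)" for s
    unfolding fstar_def using lim
    by (intro rearr_liminf) (auto elim!: eventually_mono intro!: tendsto_rabs)
  have starstar: "fstarstar v s \<le> liminf (\<lambda>k. fstarstar (u k) s)" if s: "0 < s" for s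
  proof -
    have "(\<integral>\<^sup>+ r\<in>{0<..<s}. fstar v r \<partial>lborel) \<le> (\<integral>\<^sup>+ r. liminf (\<lambda>k. fstar (u k) r * indicator {0<..<s} r) \<partial>lborel)"
      using star by (intro nn_integral_mono) (auto simp: indicator_def)
    also have "\<dots> \<le> liminf (\<lambda>k. \<integral>\<^sup>+ r\<in>{0<..<s}. fstar (u k) r \<partial>lborel)"
      by (intro nn_integral_liminf) measurable
    finally have "ennreal (1 / s) * (\<integral>\<^sup>+ r\<in>{0<..<s}. fstar v r \<partial>lborel)
        \<le> ennreal (1 / s) * liminf (\<lambda>k. \<integral>\<^sup>+ r\<in>{0<..<s}. fstar (u k) r \<partial>lborel)"
      by (rule mult_left_mono) simp
    also have "\<dots> = liminf (\<lambda>k. ennreal (1 / s) * (\<integral>\<^sup>+ r\<in>{0<..<s}. fstar (u k) r \<partial>lborel))"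
      by (rule liminf_cmult_ennreal[symmetric]) simp
    finally show ?thesis
      using s by (simp add: fstarstar_eq divide_ennreal_def inverse_ennreal mult.commute inverse_eq_divide)
  qed
  let ?c = "\<lambda>s. ennreal (s powr (1 - 1 / real CARD('n)) / s)"
  have "lorentz_norm v \<le> (\<integral>\<^sup>+ s. liminf (\<lambda>k. fstarstar (u k) s * ?c s * indicator {0<..} s) \<partial>lborel)"
    unfolding lorentz_norm_def
  proof (rule nn_integral_mono)
    fix s :: real
    show "fstarstar v s * ?c s * indicator {0<..} s \<le> liminf (\<lambda>k. fstarstar (u k) s * ?c s * indicator {0<..} s)"
    proof (cases "0 < s")
      case True
      have "?c s * fstarstar v s \<le> ?c s * liminf (\<lambda>k. fstarstar (u k) s)"
        by (intro mult_left_mono starstar True) simp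
      also have "\<dots> = liminf (\<lambda>k. ?c s * fstarstar (u k) s)"
        by (rule liminf_cmult_ennreal[symmetric]) simp
      finally show ?thesis using True by (simp add: mult.commute)
    qed simp
  qed
  also have "\<dots> \<le> liminf (\<lambda>k. lorentz_norm (u k))"
    unfolding lorentz_norm_def by (intro nn_integral_liminf) measurable
  finally show ?thesis .
qed

text \<open>Convergence in L^1 gives almost everywhere convergence of the test functions along a
  subsequence, which is enough for lower semicontinuity. The gradients enter only through their L^1
  norms, where the triangle inequality suffices.\<close>

lemma W01_lorentz_norm_bound:
  assumes dim: "2 \<le> CARD('n)"
  shows "\<exists>c>0. \<forall>(f :: real^'n \<Rightarrow> real) G. W01 f G \<longrightarrow>
    lorentz_norm f \<le> ennreal c * (\<integral>\<^sup>+ x. ennreal (norm (G x)) \<partial>lebesgue)"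
proof -
  obtain c where c: "0 < c" "\<And>f :: real^'n \<Rightarrow> real. test_fun f \<Longrightarrow>
    lorentz_norm f \<le> ennreal c * (\<integral>\<^sup>+ x. ennreal (norm (grad f x)) \<partial>lborel)"
    using test_fun_lorentz_norm_bound[OF dim] by blast
  have "lorentz_norm f \<le> ennreal c * (\<integral>\<^sup>+ x. ennreal (norm (G x)) \<partial>lebesgue)" if W: "W01 f G"
    for f :: "real^'n \<Rightarrow> real" and G
  proof -
    have f: "integrable lebesgue f" and G: "integrable lebesgue G" using W by (auto simp: W01_def)
    obtain \<phi> where \<phi>: "\<And>k. test_fun (\<phi> k)"
        and L1: "(\<lambda>k. \<integral>\<^sup>+ x. ennreal \<bar>\<phi> k x - f x\<bar> \<partial>lebesgue) \<longlonglongrightarrow> 0"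
        and grad: "(\<lambda>k. \<integral>\<^sup>+ x. ennreal (norm (grad (\<phi> k) x - G x)) \<partial>lebesgue) \<longlonglongrightarrow> 0"
      using W by (auto simp: W01_def)
    have [measurable]: "f \<in> borel_measurable lebesgue" "G \<in> borel_measurable lebesgue" using f G by auto
    have [measurable]: "\<phi> k \<in> borel_measurable lebesgue" for k
      by (intro measurable_completion) (simp add: test_fun_borel_measurable \<phi>)
    have [measurable]: "grad (\<phi> k) \<in> borel_measurable lebesgue" for k
      by (intro measurable_completion) (simp add: test_fun_borel_measurable_grad \<phi>)
    have int: "integrable lebesgue (\<lambda>x. \<phi> k x - f x)" for k
      by (intro Bochner_Integration.integrable_diff f test_fun_integrable \<phi>)
    have "(\<integral>\<^sup>+ x. ennreal \<bar>\<phi> k x - f x\<bar> \<partial>lebesgue) = ennreal (\<integral>x. norm (\<phi> k x - f x) \<partial>lebesgue)" for k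
      using nn_integral_eq_integral[OF integrable_norm[OF int[of k]]] by simp
    with L1 have "(\<lambda>k. \<integral>x. norm (\<phi> k x - f x) \<partial>lebesgue) \<longlonglongrightarrow> 0"
      by (simp add: ennreal_tendsto_0_iff)
    then obtain r :: "nat \<Rightarrow> nat" where r: "strict_mono r" "AE x in lebesgue. (\<lambda>n. \<phi> (r n) x - f x) \<longlonglongrightarrow> 0"
      using tendsto_L1_AE_subseq[of lebesgue "\<lambda>n x. \<phi> n x - f x", OF int] by blast
    then have "lorentz_norm f \<le> liminf (\<lambda>n. lorentz_norm (\<phi> (r n)))"
      by (intro lorentz_norm_liminf) (auto elim!: eventually_mono simp: LIM_zero_iff)
    also have "\<dots> \<le> liminf (\<lambda>n. ennreal c * ((\<integral>\<^sup>+ x. ennreal (norm (G x)) \<partial>lebesgue)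
        + (\<integral>\<^sup>+ x. ennreal (norm (grad (\<phi> (r n)) x - G x)) \<partial>lebesgue)))"
    proof (intro Liminf_mono always_eventually allI)
      fix n
      have "lorentz_norm (\<phi> (r n)) \<le> ennreal c * (\<integral>\<^sup>+ x. ennreal (norm (grad (\<phi> (r n)) x)) \<partial>lebesgue)"
        using c(2)[OF \<phi>] by (simp add: nn_integral_completion)
      also have "\<dots> \<le> ennreal c * (\<integral>\<^sup>+ x. ennreal (norm (G x)) + ennreal (norm (grad (\<phi> (r n)) x - G x)) \<partial>lebesgue)"
        by (intro mult_left_mono nn_integral_mono)
          (auto simp: ennreal_plus[symmetric] norm_triangle_sub simp del: ennreal_plus intro!: ennreal_leI)
      also have "\<dots> = ennreal c * ((\<integral>\<^sup>+ x. ennreal (norm (G x)) \<partial>lebesgue)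
          + (\<integral>\<^sup>+ x. ennreal (norm (grad (\<phi> (r n)) x - G x)) \<partial>lebesgue))"
        by (subst nn_integral_add) auto
      finally show "lorentz_norm (\<phi> (r n)) \<le> \<dots>" .
    qed
    also have "\<dots> = ennreal c * ((\<integral>\<^sup>+ x. ennreal (norm (G x)) \<partial>lebesgue) + 0)"
      using LIMSEQ_subseq_LIMSEQ[OF grad r(1)]
      by (intro lim_imp_Liminf ennreal_tendsto_cmult tendsto_add tendsto_const) (auto simp: o_def)
    finally show ?thesis by simp
  qed
  then show ?thesis using c(1) by blast
qed

section \<open>The weak-type estimate from the Lorentz norm\<close>

lemma lorentz_norm_ge:
  fixes f :: "real^'n \<Rightarrow> real"
  assumes [measurable]: "f \<in> borel_measurable lebesgue" and t: "0 \<le> t" and a: "0 \<le> a"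
    and meas: "ennreal a \<le> emeasure lebesgue {x. t < \<bar>f x\<bar>}"
  shows "ennreal (t * a powr (1 - 1 / real CARD('n))) \<le> lorentz_norm f"
proof (cases "a = 0")
  case False
  let ?n = "real CARD('n)"
  have a: "0 < a" using False a by simp
  have e: "a powr (1 - 1 / ?n) = a powr (- 1 / ?n) * a"
    using a powr_add[of a "- 1 / ?n" 1] by simp
  \<comment> \<open>On (0,a) \<open>fstarstar f\<close> is at least t and s^(-1/n) is at least
    a^(-1/n); the integral of the product of these constants is the left side.\<close>
  have "ennreal (t * a powr (1 - 1 / ?n)) = (\<integral>\<^sup>+ s. ennreal (t * a powr (- 1 / ?n)) * indicator {0<..<a} s \<partial>lborel)"
    using a t by (simp add: nn_integral_cmult_indicator ennreal_mult[symmetric] e mult.assoc)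
  also have "\<dots> \<le> lorentz_norm f"
    unfolding lorentz_norm_def
  proof (rule nn_integral_mono)
    fix s
    show "ennreal (t * a powr (- 1 / ?n)) * indicator {0<..<a} s
      \<le> fstarstar f s * ennreal (s powr (1 - 1 / ?n) / s) * indicator {0<..} s"
    proof (cases "0 < s \<and> s < a")
      case True
      have "ennreal s < ennreal a" using True by (simp add: ennreal_less_iff)
      also have "\<dots> \<le> emeasure lebesgue {x \<in> space lebesgue. ennreal t < ennreal \<bar>f x\<bar>}"
        using meas t by (simp add: ennreal_less_iff)
      finally have "ennreal t < fstar f s"
        unfolding fstar_def by (subst less_rearr_iff) auto
      then have "ennreal t \<le> fstarstar f s" using fstar_le_fstarstar[of s f] True by simp
      moreover have "a powr (- 1 / ?n) \<le> s powr (- 1 / ?n)" using True by (intro powr_mono2') auto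
      then have "ennreal (a powr (- 1 / ?n)) \<le> ennreal (s powr (1 - 1 / ?n) / s)"
        using True by (intro ennreal_leI) (simp add: powr_diff powr_minus_divide)
      ultimately have "ennreal t * ennreal (a powr (- 1 / ?n)) \<le> fstarstar f s * ennreal (s powr (1 - 1 / ?n) / s)"
        by (rule mult_mono) auto
      then show ?thesis using True t by (simp add: ennreal_mult)
    qed auto
  qed
  finally show ?thesis .
qed simp

text \<open>A level set of infinite measure is handled by \<open>lorentz_norm_ge\<close> with
  arbitrarily large finite a, which forces the Lorentz norm to be infinite.\<close>

lemma lorentz_norm_weak:
  fixes f :: "real^'n \<Rightarrow> real"
  assumes f: "f \<in> borel_measurable lebesgue" and t: "0 < t" and dim: "2 \<le> CARD('n)"
  shows "ennreal t * enn_powr (emeasure lebesgue {x. t < \<bar>f x\<bar>}) (1 - 1 / real CARD('n)) \<le> lorentz_norm f"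
proof -
  let ?r = "1 - 1 / real CARD('n)"
  have r: "0 < ?r" using dim by simp
  show ?thesis
  proof (cases "emeasure lebesgue {x. t < \<bar>f x\<bar>}")
    case (real a)
    then show ?thesis
      using lorentz_norm_ge[OF f, of t a] t by (simp add: enn_powr_def ennreal_mult[symmetric])
  next
    case top
    have "lorentz_norm f = top"
    proof (rule ccontr)
      assume "lorentz_norm f \<noteq> top"
      then obtain L where L: "lorentz_norm f = ennreal L" "0 \<le> L" by (cases "lorentz_norm f") auto
      \<comment> \<open>Chosen so that t a^(1 - 1/n) = L + 1 exceeds the supposedly finite norm
        L.\<close>
      define a where "a = ((L + 1) / t) powr (1 / ?r)"
      have "a powr ?r = (L + 1) / t" using r L t by (simp add: a_def powr_powr)
      then have "t * a powr ?r = L + 1" using t by simp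
      then have "ennreal (L + 1) \<le> ennreal L"
        using lorentz_norm_ge[OF f, of t a] t L top by (simp add: a_def)
      then show False using L by simp
    qed
    then show ?thesis by simp
  qed
qed

section \<open>Rearrangement-invariant norms and majorization\<close>

lemma borel_measurable_M0: "f \<in> borel_measurable borel \<Longrightarrow> f \<in> borel_measurable M0"
  by (intro measurable_restrict_space1 measurable_completion) simp

lemma antimono_borel_measurable_M0:
  fixes f :: "real \<Rightarrow> ennreal"
  assumes "\<And>s t. 0 < s \<Longrightarrow> s \<le> t \<Longrightarrow> f t \<le> f s"
  shows "f \<in> borel_measurable M0"
proof -
  \<comment> \<open>The value \<open>top\<close> on the left of 0 extends the monotonicity to the
    whole line.\<close>
  have "(\<lambda>s. if 0 < s then f s else top) \<in> borel_measurable borel"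
    using assms by (intro borel_measurable_antimono_ennreal) auto
  then have "(\<lambda>s. if 0 < s then f s else top) \<in> borel_measurable M0"
    by (rule borel_measurable_M0)
  then show ?thesis
    by (rule measurable_cong[THEN iffD1, rotated]) simp
qed

lemma emeasure_M0:
  assumes "A \<in> sets borel" "A \<subseteq> {0<..}"
  shows "emeasure M0 A = emeasure lborel A"
  using assms by (simp add: emeasure_restrict_space main_part_sets)

lemma nn_integral_M0:
  shows "(\<integral>\<^sup>+ x. f x \<partial>M0) = (\<integral>\<^sup>+ x\<in>{0<..}. f x \<partial>lborel)"
  by (simp add: nn_integral_restrict_space nn_integral_completion)

lemma AE_M0_I: "(\<And>x. 0 < x \<Longrightarrow> P x) \<Longrightarrow> AE x in M0. P x"
  by (rule AE_I2) simp

context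
  fixes \<rho> :: "(real \<Rightarrow> ennreal) \<Rightarrow> ennreal"
  assumes ri: "ri_norm \<rho>"
begin

lemma ri_eq_0_iff: "f \<in> borel_measurable M0 \<Longrightarrow> \<rho> f = 0 \<longleftrightarrow> (AE x in M0. f x = 0)"
  using ri[unfolded ri_norm_def, THEN conjunct1] by blast

lemma ri_scale: "f \<in> borel_measurable M0 \<Longrightarrow> 0 \<le> a \<Longrightarrow> \<rho> (\<lambda>x. ennreal a * f x) = ennreal a * \<rho> f"
  using ri[unfolded ri_norm_def, THEN conjunct2, THEN conjunct1] by blast

lemma ri_add: "f \<in> borel_measurable M0 \<Longrightarrow> g \<in> borel_measurable M0 \<Longrightarrow> \<rho> (\<lambda>x. f x + g x) \<le> \<rho> f + \<rho> g"
  using ri[unfolded ri_norm_def, THEN conjunct2, THEN conjunct2, THEN conjunct1] by blast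

lemma ri_mono:
  "f \<in> borel_measurable M0 \<Longrightarrow> g \<in> borel_measurable M0 \<Longrightarrow> (\<And>x. 0 < x \<Longrightarrow> g x \<le> f x) \<Longrightarrow> \<rho> g \<le> \<rho> f"
  using ri[unfolded ri_norm_def, THEN conjunct2, THEN conjunct2, THEN conjunct2, THEN conjunct1] AE_M0_I[of "\<lambda>x. g x \<le> f x"] by blast

lemma ri_cong:
  "f \<in> borel_measurable M0 \<Longrightarrow> g \<in> borel_measurable M0 \<Longrightarrow> (\<And>x. 0 < x \<Longrightarrow> g x = f x) \<Longrightarrow> \<rho> g = \<rho> f"
  by (intro antisym ri_mono) auto

lemma ri_SUP:
  assumes "\<And>k. F k \<in> borel_measurable M0" "\<And>x. 0 < x \<Longrightarrow> incseq (\<lambda>k. F k x)"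
  shows "\<rho> (\<lambda>x. SUP k. F k x) = (SUP k. \<rho> (F k))"
proof -
  have "AE x in M0. incseq (\<lambda>k. F k x)" using assms(2) by (rule AE_M0_I)
  then show ?thesis using ri[unfolded ri_norm_def, THEN conjunct2, THEN conjunct2, THEN conjunct2, THEN conjunct2, THEN conjunct1] assms(1) by blast
qed

lemma ri_integral_bound:
  assumes "E \<in> sets M0" "emeasure M0 E < \<infinity>"
  shows "\<exists>C. \<forall>f\<in>borel_measurable M0. (\<integral>\<^sup>+ x\<in>E. f x \<partial>M0) \<le> ennreal C * \<rho> f"
  using ri[unfolded ri_norm_def, THEN conjunct2, THEN conjunct2, THEN conjunct2, THEN conjunct2, THEN conjunct2, THEN conjunct2, THEN conjunct1] assms by blast

lemma ri_rearr:
  "f \<in> borel_measurable M0 \<Longrightarrow> g \<in> borel_measurable M0 \<Longrightarrow>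
    (\<And>s. 0 < s \<Longrightarrow> rearr M0 f s = rearr M0 g s) \<Longrightarrow> \<rho> f = \<rho> g"
  using ri[unfolded ri_norm_def, THEN conjunct2, THEN conjunct2, THEN conjunct2, THEN conjunct2, THEN conjunct2, THEN conjunct2, THEN conjunct2] by blast

end

section \<open>Step functions and transfers of mass between cells\<close>

definition step :: "real \<Rightarrow> nat \<Rightarrow> (nat \<Rightarrow> real) \<Rightarrow> real \<Rightarrow> ennreal" where
  "step \<delta> N a x = (\<Sum>j<N. ennreal (a j) * indicator {real j * \<delta><..real (Suc j) * \<delta>} x)"

lemma step_measurable [measurable]: "step \<delta> N a \<in> borel_measurable M0"
  unfolding step_def by (intro borel_measurable_M0) measurable

lemma cell_index_unique:
  assumes "0 < \<delta>" "real j * \<delta> < x" "x \<le> real (Suc j) * \<delta>" "real i * \<delta> < x" "x \<le> real (Suc i) * \<delta>"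
  shows "i = j"
proof -
  have "real j * \<delta> < real (Suc i) * \<delta>" "real i * \<delta> < real (Suc j) * \<delta>" using assms by linarith+
  then have "real j < real (Suc i)" "real i < real (Suc j)" using assms(1) by (simp_all only: mult_less_cancel_right_pos)
  then show ?thesis by linarith
qed

lemma step_eq:
  assumes "0 < \<delta>" "j < N" "real j * \<delta> < x" "x \<le> real (Suc j) * \<delta>"
  shows "step \<delta> N a x = ennreal (a j)"
proof -
  have "step \<delta> N a x = (\<Sum>i<N. if i = j then ennreal (a j) else 0)"
    unfolding step_def
  proof (intro sum.cong refl)
    fix i
    show "ennreal (a i) * indicator {real i * \<delta><..real (Suc i) * \<delta>} x = (if i = j then ennreal (a j) else 0)"
    proof (cases "i = j")
      case False
      then have "x \<notin> {real i * \<delta><..real (Suc i) * \<delta>}"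
        using cell_index_unique[OF assms(1,3,4), of i] by (auto simp del: of_nat_Suc)
      then show ?thesis using False by simp
    qed (use assms in simp)
  qed
  then show ?thesis using assms(2) by simp
qed

lemma cell_exists:
  assumes "0 < \<delta>" "0 < x" "x \<le> real N * \<delta>"
  shows "\<exists>j<N. real j * \<delta> < x \<and> x \<le> real (Suc j) * \<delta>"
proof -
  define m where "m = (LEAST m. x \<le> real m * \<delta>)"
  have m: "x \<le> real m * \<delta>" unfolding m_def using assms(3) by (rule LeastI)
  have "m \<noteq> 0" using m assms(2) by (intro notI) simp
  then obtain j where j: "m = Suc j" by (cases m) auto
  have "\<not> x \<le> real j * \<delta>" using not_less_Least[of j "\<lambda>m. x \<le> real m * \<delta>"] j by (simp add: m_def)
  moreover have "m \<le> N" unfolding m_def using assms(3) by (rule Least_le)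
  ultimately show ?thesis using m j by (intro exI[of _ j]) auto
qed

lemma step_outside:
  assumes "0 < \<delta>" "\<not> (0 < x \<and> x \<le> real N * \<delta>)"
  shows "step \<delta> N a x = 0"
  unfolding step_def
proof (rule sum.neutral, rule ballI)
  fix j assume "j \<in> {..<N}"
  then have "real (Suc j) * \<delta> \<le> real N * \<delta>" "0 \<le> real j * \<delta>" using assms(1) by (auto intro!: mult_right_mono)
  then have "x \<notin> {real j * \<delta><..real (Suc j) * \<delta>}" using assms(2) by auto
  then show "ennreal (a j) * indicator {real j * \<delta><..real (Suc j) * \<delta>} x = 0" by simp
qed

text \<open>Only the number of cells with coefficient above l counts, not their position; hence
  permuting the coefficients preserves the rearrangement.\<close>

lemma emeasure_step_superlevel:
  assumes \<delta>: "0 < \<delta>"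
  shows "emeasure M0 {x \<in> space M0. l < step \<delta> N a x} = of_nat (card {j. j < N \<and> l < ennreal (a j)}) * ennreal \<delta>"
proof -
  let ?J = "{j. j < N \<and> l < ennreal (a j)}"
  let ?I = "\<lambda>j. {real j * \<delta><..real (Suc j) * \<delta>}"
  have I0: "?I j \<subseteq> {0<..}" for j
  proof
    fix x assume "x \<in> ?I j"
    moreover have "0 \<le> real j * \<delta>" using \<delta> by simp
    ultimately show "x \<in> {0<..}" by auto
  qed
  have "{x \<in> space M0. l < step \<delta> N a x} = (\<Union>j\<in>?J. ?I j)"
  proof (intro set_eqI iffI)
    fix x assume x: "x \<in> {x \<in> space M0. l < step \<delta> N a x}"
    then have "0 < x \<and> x \<le> real N * \<delta>" using step_outside[OF \<delta>, of x N a] by (cases "0 < x \<and> x \<le> real N * \<delta>") auto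
    then obtain j where j: "j < N" "real j * \<delta> < x" "x \<le> real (Suc j) * \<delta>" using cell_exists[OF \<delta>] by blast
    then show "x \<in> (\<Union>j\<in>?J. ?I j)" using x step_eq[OF \<delta> j, of a] by auto
  next
    fix x assume "x \<in> (\<Union>j\<in>?J. ?I j)"
    then obtain j where j: "j \<in> ?J" "x \<in> ?I j" by blast
    then have "0 < x" using I0[of j] by auto
    then show "x \<in> {x \<in> space M0. l < step \<delta> N a x}"
      using j step_eq[OF \<delta>, of j N x a] by simp
  qed
  then have "emeasure M0 {x \<in> space M0. l < step \<delta> N a x} = emeasure M0 (\<Union>j\<in>?J. ?I j)" by simp
  also have "\<dots> = emeasure lborel (\<Union>j\<in>?J. ?I j)" using I0 by (intro emeasure_M0) auto
  also have "\<dots> = (\<Sum>j\<in>?J. emeasure lborel (?I j))"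
  proof (rule sum_emeasure[symmetric])
    show "disjoint_family_on ?I ?J"
      unfolding disjoint_family_on_def
    proof (intro ballI impI)
      fix i j :: nat assume "i \<noteq> j"
      then show "?I i \<inter> ?I j = {}" using cell_index_unique[OF \<delta>, of j _ i] by fastforce
    qed
  qed auto
  also have "\<dots> = (\<Sum>j\<in>?J. ennreal \<delta>)"
    using \<delta> by (intro sum.cong refl) (simp add: algebra_simps)
  finally show ?thesis by simp
qed

context
  fixes \<rho> :: "(real \<Rightarrow> ennreal) \<Rightarrow> ennreal"
  assumes ri: "ri_norm \<rho>"
begin

lemma ri_step_transpose:
  assumes "0 < \<delta>" "i < N" "k < N"
  shows "\<rho> (step \<delta> N (\<lambda>j. a (Transposition.transpose i k j))) = \<rho> (step \<delta> N a)"
proof (rule ri_rearr[OF ri])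
  fix s
  have "card {j. j < N \<and> l < ennreal (a (Transposition.transpose i k j))} = card {j. j < N \<and> l < ennreal (a j)}" for l
  proof (rule bij_betw_same_card[of "Transposition.transpose i k"])
    have lt: "Transposition.transpose i k j < N" if "j < N" for j using that assms by (auto simp: Transposition.transpose_def)
    show "bij_betw (Transposition.transpose i k) {j. j < N \<and> l < ennreal (a (Transposition.transpose i k j))} {j. j < N \<and> l < ennreal (a j)}"
      by (intro bij_betwI[where g = "Transposition.transpose i k"]) (auto simp: lt)
  qed
  then show "rearr M0 (step \<delta> N (\<lambda>j. a (Transposition.transpose i k j))) s = rearr M0 (step \<delta> N a) s"
    unfolding rearr_def emeasure_step_superlevel[OF assms(1)] by simp
qed measurable

lemma step_mono:
  assumes "\<And>j. j < N \<Longrightarrow> a j \<le> b j"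
  shows "step \<delta> N a x \<le> step \<delta> N b x"
  unfolding step_def using assms by (intro sum_mono mult_right_mono ennreal_leI) auto

text \<open>A transfer of mass \<open>d\<close> from cell \<open>i\<close> to cell \<open>k\<close> is a
  convex combination of \<open>b\<close> and its transposition, and makes one more entry agree with \<open>a\<close>.\<close>

lemma ri_step_majorization:
  assumes \<delta>: "0 < \<delta>" and a: "\<And>j. 0 \<le> a j" "\<And>i j. i \<le> j \<Longrightarrow> j < N \<Longrightarrow> a j \<le> a i"
    and b: "\<And>j. 0 \<le> b j" and le: "\<And>l. l \<le> N \<Longrightarrow> (\<Sum>j<l. a j) \<le> (\<Sum>j<l. b j)"
  shows "\<rho> (step \<delta> N a) \<le> \<rho> (step \<delta> N b)"
  using b le
\<comment> \<open>The number of indices where a and b disagree drops with each transfer. The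
  induction admits every b, decreasing or not, because a transfer can destroy monotonicity.\<close>
proof (induction "card {j. j < N \<and> a j \<noteq> b j}" arbitrary: b rule: less_induct)
  case less
  note b = less.prems(1) and le = less.prems(2)
  show ?case
  proof (cases "\<forall>j<N. a j \<le> b j")
    case True
    then show ?thesis by (intro ri_mono[OF ri] step_measurable step_mono) auto
  next
    case False
    define k where "k = (LEAST k. k < N \<and> b k < a k)"
    from False obtain k0 where "k0 < N \<and> b k0 < a k0" by (auto simp: not_le)
    then have k: "k < N \<and> b k < a k" unfolding k_def by (rule LeastI)
    have before: "a j \<le> b j" if "j < k" for j
      using not_less_Least[of j "\<lambda>k. k < N \<and> b k < a k"] that k by (auto simp: k_def not_less)
    \<comment> \<open>The first deficit, at k, must be outweighed by an earlier surplus, since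
      otherwise the partial sum up to and including k would violate the assumption.\<close>
    have "\<exists>i<k. a i < b i"
    proof (rule ccontr)
      assume "\<not> ?thesis"
      then have "b j \<le> a j" if "j < k" for j using that by (meson not_le)
      then have "(\<Sum>j<k. b j) \<le> (\<Sum>j<k. a j)" by (intro sum_mono) simp
      then have "(\<Sum>j<Suc k. b j) < (\<Sum>j<Suc k. a j)" using k by simp
      then show False using le[of "Suc k"] k by simp
    qed
    then obtain i where i: "i < k" "a i < b i" by blast
    \<comment> \<open>The smaller of surplus and deficit, so that after the transfer
      \<open>b'\<close> agrees with a at i or at k.\<close>
    define d where "d = min (b i - a i) (a k - b k)"
    have d: "0 < d" "d \<le> b i - a i" "d \<le> a k - b k" using i k by (auto simp: d_def)
    have aik: "a k \<le> a i" using a(2)[of i k] i k by simp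
    define b' where "b' j = b j - (if j = i then d else 0) + (if j = k then d else 0)" for j
    \<comment> \<open>The weight for which \<open>\<theta> * (b i - b k) = d\<close>: mixing b with
      its transposition in this proportion moves exactly d from i to k.\<close>
    define \<theta> where "\<theta> = d / (b i - b k)"
    have gap: "0 < b i - b k" "d \<le> b i - b k" using d aik by auto
    have \<theta>: "0 \<le> \<theta>" "\<theta> \<le> 1" "\<theta> * (b i - b k) = d" using d gap by (auto simp: \<theta>_def)
    have b'0: "0 \<le> b' j" for j using b[of j] d a(1)[of i] i by (auto simp: b'_def)
    have comb: "b' j = (1 - \<theta>) * b j + \<theta> * b (Transposition.transpose i k j)" for j
    proof -
      have ik: "i \<noteq> k" using i by simp
      consider "j = i" | "j = k" | "j \<noteq> i" "j \<noteq> k" by blast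
      then show ?thesis
        using \<theta>(3) ik by cases (simp_all add: b'_def algebra_simps)
    qed
    have "step \<delta> N b' x = ennreal (1 - \<theta>) * step \<delta> N b x + ennreal \<theta> * step \<delta> N (\<lambda>j. b (Transposition.transpose i k j)) x" for x
    proof -
      have "ennreal (b' j) * c = ennreal (1 - \<theta>) * (ennreal (b j) * c) + ennreal \<theta> * (ennreal (b (Transposition.transpose i k j)) * c)" for j c
        unfolding comb using \<theta> b by (simp add: ennreal_plus ennreal_mult distrib_right mult.assoc)
      then show ?thesis unfolding step_def sum_distrib_left sum.distrib[symmetric] by simp
    qed
    then have "\<rho> (step \<delta> N b') = \<rho> (\<lambda>x. ennreal (1 - \<theta>) * step \<delta> N b x + ennreal \<theta> * step \<delta> N (\<lambda>j. b (Transposition.transpose i k j)) x)"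
      by presburger
    also have "\<dots> \<le> \<rho> (\<lambda>x. ennreal (1 - \<theta>) * step \<delta> N b x) + \<rho> (\<lambda>x. ennreal \<theta> * step \<delta> N (\<lambda>j. b (Transposition.transpose i k j)) x)"
      by (intro ri_add[OF ri]) measurable
    also have "\<dots> = ennreal (1 - \<theta>) * \<rho> (step \<delta> N b) + ennreal \<theta> * \<rho> (step \<delta> N (\<lambda>j. b (Transposition.transpose i k j)))"
      using \<theta> by (simp add: ri_scale[OF ri])
    also have "\<dots> = (ennreal (1 - \<theta>) + ennreal \<theta>) * \<rho> (step \<delta> N b)"
      using ri_step_transpose[OF \<delta>, of i N k b] i k by (simp add: distrib_right)
    also have "ennreal (1 - \<theta>) + ennreal \<theta> = 1" using \<theta> by (simp add: ennreal_plus[symmetric] del: ennreal_plus)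
    finally have b'b: "\<rho> (step \<delta> N b') \<le> \<rho> (step \<delta> N b)" by simp
    have "\<rho> (step \<delta> N a) \<le> \<rho> (step \<delta> N b')"
    proof (rule less.hyps)
      have "{j. j < N \<and> a j \<noteq> b' j} \<subset> {j. j < N \<and> a j \<noteq> b j}"
      proof
        show "{j. j < N \<and> a j \<noteq> b' j} \<subseteq> {j. j < N \<and> a j \<noteq> b j}" using i k by (auto simp: b'_def split: if_splits)
        have "a i = b' i \<or> a k = b' k" using i by (auto simp: b'_def d_def min_def)
        then show "{j. j < N \<and> a j \<noteq> b' j} \<noteq> {j. j < N \<and> a j \<noteq> b j}" using i k by fastforce
      qed
      then show "card {j. j < N \<and> a j \<noteq> b' j} < card {j. j < N \<and> a j \<noteq> b j}" by (intro psubset_card_mono) auto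
      show "0 \<le> b' j" for j by (rule b'0)
      fix l assume l: "l \<le> N"
      have sum': "(\<Sum>j<l. b' j) = (\<Sum>j<l. b j) - (if i < l then d else 0) + (if k < l then d else 0)"
        unfolding b'_def by (simp add: sum.distrib sum_subtractf)
      show "(\<Sum>j<l. a j) \<le> (\<Sum>j<l. b' j)"
      \<comment> \<open>Sums that contain i but not yet k lose d. Since b dominates a at every index
        before k, the surplus at i alone covers the loss.\<close>
      proof (cases "i < l \<and> l \<le> k")
        case True
        have "d \<le> b i - a i" by (rule d)
        also have "\<dots> \<le> (\<Sum>j<l. b j - a j)"
          using True before by (intro member_le_sum) auto
        also have "\<dots> = (\<Sum>j<l. b j) - (\<Sum>j<l. a j)" by (rule sum_subtractf)
        finally show ?thesis using True by (simp add: sum')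
      next
        case False
        then show ?thesis using le[OF l] i by (auto simp: sum')
      qed
    qed
    with b'b show ?thesis by simp
  qed
qed

end

section \<open>Majorization for decreasing functions\<close>

lemma riemann_sum_antimono_le:
  fixes G :: "real \<Rightarrow> ennreal"
  assumes [measurable]: "G \<in> borel_measurable borel" and \<delta>: "0 < \<delta>"
    and anti: "\<And>s t. 0 < s \<Longrightarrow> s \<le> t \<Longrightarrow> G t \<le> G s"
  shows "(\<Sum>j<l. G (real (Suc j) * \<delta>)) * ennreal \<delta> \<le> (\<integral>\<^sup>+ x\<in>{0<..<real l * \<delta>}. G x \<partial>lborel)"
proof (induction l)
  case (Suc l)
  let ?p = "real l * \<delta>" and ?q = "real (Suc l) * \<delta>"
  have p: "0 \<le> ?p" "?p < ?q" "?q - ?p = \<delta>" using \<delta> by (auto simp: algebra_simps)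
  have "(\<Sum>j<Suc l. G (real (Suc j) * \<delta>)) * ennreal \<delta>
      = (\<Sum>j<l. G (real (Suc j) * \<delta>)) * ennreal \<delta> + G ?q * ennreal \<delta>"
    by (simp add: distrib_right)
  also have "\<dots> \<le> (\<integral>\<^sup>+ x\<in>{0<..<?p}. G x \<partial>lborel) + (\<integral>\<^sup>+ x. G ?q * indicator {?p<..<?q} x \<partial>lborel)"
    using p Suc by (intro add_mono) (simp_all add: nn_integral_cmult_indicator)
  also have "\<dots> = (\<integral>\<^sup>+ x. G x * indicator {0<..<?p} x + G ?q * indicator {?p<..<?q} x \<partial>lborel)"
    by (intro nn_integral_add[symmetric]) measurable
  also have "\<dots> \<le> (\<integral>\<^sup>+ x\<in>{0<..<?q}. G x \<partial>lborel)"
  proof (rule nn_integral_mono)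
    fix x
    consider "x \<le> 0" | "0 < x" "x \<le> ?p" | "0 < x" "?p < x" "x < ?q" | "?q \<le> x" by linarith
    then show "G x * indicator {0<..<?p} x + G ?q * indicator {?p<..<?q} x \<le> G x * indicator {0<..<?q} x"
    proof cases
      case 1
      then have "\<not> ?p < x" using p(1) by linarith
      with 1 show ?thesis by simp
    next
      case 3
      then show ?thesis using anti[of x ?q] by (simp del: of_nat_Suc)
    qed (use p in \<open>auto simp del: of_nat_Suc simp: indicator_def\<close>)
  qed
  finally show ?case .
qed simp

text \<open>The value at the right end of a cell bounds G on the next cell, not on its own. Hence
  the integral starts at \<delta>: the first cell, where G may blow up, is not controlled.\<close>

lemma riemann_sum_antimono_ge:
  fixes G :: "real \<Rightarrow> ennreal"
  assumes [measurable]: "G \<in> borel_measurable borel" and \<delta>: "0 < \<delta>"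
    and anti: "\<And>s t. 0 < s \<Longrightarrow> s \<le> t \<Longrightarrow> G t \<le> G s"
  shows "(\<integral>\<^sup>+ x\<in>{\<delta>..<real (Suc l) * \<delta>}. G x \<partial>lborel) \<le> (\<Sum>j<l. G (real (Suc j) * \<delta>)) * ennreal \<delta>"
proof (induction l)
  case (Suc l)
  let ?p = "real (Suc l) * \<delta>" and ?q = "real (Suc (Suc l)) * \<delta>"
  have p: "0 < ?p" "\<delta> \<le> ?p" "?p < ?q" "?q - ?p = \<delta>" using \<delta> by (auto simp: algebra_simps intro: add_pos_nonneg)
  have "(\<integral>\<^sup>+ x\<in>{\<delta>..<?q}. G x \<partial>lborel) \<le> (\<integral>\<^sup>+ x. G x * indicator {\<delta>..<?p} x + G ?p * indicator {?p..<?q} x \<partial>lborel)"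
  proof (rule nn_integral_mono)
    fix x
    consider "x < ?p" | "?p \<le> x" "x < ?q" | "?q \<le> x" by linarith
    then show "G x * indicator {\<delta>..<?q} x \<le> G x * indicator {\<delta>..<?p} x + G ?p * indicator {?p..<?q} x"
      using p anti[of ?p x] by cases (auto simp del: of_nat_Suc simp: indicator_def)
  qed
  also have "\<dots> = (\<integral>\<^sup>+ x\<in>{\<delta>..<?p}. G x \<partial>lborel) + (\<integral>\<^sup>+ x. G ?p * indicator {?p..<?q} x \<partial>lborel)"
    by (intro nn_integral_add) measurable
  also have "\<dots> \<le> (\<Sum>j<l. G (real (Suc j) * \<delta>)) * ennreal \<delta> + G ?p * ennreal \<delta>"
    using p Suc by (intro add_mono) (simp_all add: nn_integral_cmult_indicator)
  also have "\<dots> = (\<Sum>j<Suc l. G (real (Suc j) * \<delta>)) * ennreal \<delta>"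
    by (simp add: distrib_right)
  finally show ?case .
qed simp

text \<open>The price for giving up the first cell is a factor 2: the truncated integrals increase
  to the full one, hence eventually exceed half of it. Cutting at \<epsilon> divided by an integer
  lets the cut serve as a cell length with \<epsilon> on the grid.\<close>

lemma half_integral_away_from_0:
  fixes K :: "real \<Rightarrow> ennreal"
  assumes [measurable]: "K \<in> borel_measurable borel" and \<epsilon>: "0 < \<epsilon>"
    and fin: "(\<integral>\<^sup>+ x\<in>{0<..<\<epsilon>}. K x \<partial>lborel) < \<infinity>"
  shows "\<exists>M. (\<integral>\<^sup>+ x\<in>{0<..<\<epsilon>}. K x \<partial>lborel) \<le> 2 * (\<integral>\<^sup>+ x\<in>{\<epsilon> / real (Suc M)..<\<epsilon>}. K x \<partial>lborel)"
proof (cases "(\<integral>\<^sup>+ x\<in>{0<..<\<epsilon>}. K x \<partial>lborel) = 0")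
  case False
  obtain I where I: "(\<integral>\<^sup>+ x\<in>{0<..<\<epsilon>}. K x \<partial>lborel) = ennreal I" "0 < I"
    using fin False by (cases "\<integral>\<^sup>+ x\<in>{0<..<\<epsilon>}. K x \<partial>lborel") (auto simp: order_less_le)
  have "(\<integral>\<^sup>+ x\<in>{0<..<\<epsilon>}. K x \<partial>lborel) \<le> (\<integral>\<^sup>+ x. (SUP M. K x * indicator {\<epsilon> / real (Suc M)..<\<epsilon>} x) \<partial>lborel)"
  proof (rule nn_integral_mono)
    fix x :: real
    show "K x * indicator {0<..<\<epsilon>} x \<le> (SUP M. K x * indicator {\<epsilon> / real (Suc M)..<\<epsilon>} x)"
    proof (cases "0 < x \<and> x < \<epsilon>")
      case True
      obtain M where "\<epsilon> / x < real M" using reals_Archimedean2 by blast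
      then have "\<epsilon> / x \<le> real (Suc M)" by simp
      then have "\<epsilon> / real (Suc M) \<le> x" using True by (simp add: field_simps)
      then show ?thesis using True by (intro SUP_upper2[of M]) (auto simp: indicator_def)
    qed (auto simp: indicator_def)
  qed
  also have "\<dots> = (SUP M. \<integral>\<^sup>+ x\<in>{\<epsilon> / real (Suc M)..<\<epsilon>}. K x \<partial>lborel)"
  proof (rule nn_integral_monotone_convergence_SUP)
    have "\<epsilon> / real (Suc (Suc M)) \<le> \<epsilon> / real (Suc M)" for M using \<epsilon> by (intro divide_left_mono) auto
    then show "incseq (\<lambda>M x. K x * indicator {\<epsilon> / real (Suc M)..<\<epsilon>} x)"
      by (intro incseq_SucI le_funI) (auto simp: indicator_def simp del: of_nat_Suc intro: order_trans)
  qed measurable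
  finally have "ennreal (I / 2) < (SUP M. \<integral>\<^sup>+ x\<in>{\<epsilon> / real (Suc M)..<\<epsilon>}. K x \<partial>lborel)"
    unfolding I using I(2) by (simp add: ennreal_less_iff order_less_le_trans[rotated])
  then obtain M where "ennreal (I / 2) < (\<integral>\<^sup>+ x\<in>{\<epsilon> / real (Suc M)..<\<epsilon>}. K x \<partial>lborel)"
    by (auto simp: less_SUP_iff)
  then have "2 * ennreal (I / 2) \<le> 2 * (\<integral>\<^sup>+ x\<in>{\<epsilon> / real (Suc M)..<\<epsilon>}. K x \<partial>lborel)"
    by (intro mult_left_mono) auto
  moreover have "2 * ennreal (I / 2) = ennreal I"
    using I(2) ennreal_mult[of 2 "I / 2"] by simp
  ultimately show ?thesis unfolding I by auto
qed simp

text \<open>Averages of a decreasing sequence over initial blocks decrease as the block grows, so a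
  lower bound for the average over M terms holds for shorter blocks too.\<close>

lemma initial_block_partial_sums:
  fixes b :: "nat \<Rightarrow> real"
  assumes anti: "\<And>i j. i \<le> j \<Longrightarrow> b j \<le> b i" and total: "real M * \<alpha> \<le> (\<Sum>j<M. b j)" and l: "l \<le> M"
  shows "real l * \<alpha> \<le> (\<Sum>j<l. b j)"
proof (cases "\<alpha> \<le> b l")
  case True
  then have "\<alpha> \<le> b j" if "j < l" for j using anti[of j l] that by simp
  then have "(\<Sum>j<l. \<alpha>) \<le> (\<Sum>j<l. b j)" by (intro sum_mono) simp
  then show ?thesis by simp
next
  case False
  then have "b j \<le> \<alpha>" if "l \<le> j" for j using anti[OF that] by simp
  then have "(\<Sum>j\<in>{l..<M}. b j) \<le> (\<Sum>j\<in>{l..<M}. \<alpha>)" by (intro sum_mono) simp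
  then have "(\<Sum>j\<in>{l..<M}. b j) \<le> (real M - real l) * \<alpha>" using l by (simp add: of_nat_diff)
  moreover have "(\<Sum>j<M. b j) = (\<Sum>j<l. b j) + (\<Sum>j\<in>{l..<M}. b j)"
    using sum.atLeastLessThan_concat[of 0 l M b] l by (simp add: lessThan_atLeast0)
  ultimately show ?thesis using total by (simp add: algebra_simps)
qed

context
  fixes \<rho> :: "(real \<Rightarrow> ennreal) \<Rightarrow> ennreal"
  assumes ri: "ri_norm \<rho>"
begin

lemma ri_finite_imp_integral_finite:
  assumes [measurable]: "K \<in> borel_measurable borel" and fin: "\<rho> K < \<infinity>"
  shows "(\<integral>\<^sup>+ x\<in>{0<..<t}. K x \<partial>lborel) < \<infinity>"
proof -
  have "{0<..<t} \<in> sets M0" by (auto simp: sets_restrict_space_iff)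
  moreover have "emeasure M0 {0<..<t} < \<infinity>"
    using emeasure_bounded_finite[of "{0<..<t}"] by (subst emeasure_M0) auto
  ultimately obtain C where C: "(\<integral>\<^sup>+ x\<in>{0<..<t}. K x \<partial>M0) \<le> ennreal C * \<rho> K"
    using ri_integral_bound[OF ri] borel_measurable_M0[of K] by force
  have "(\<integral>\<^sup>+ x\<in>{0<..<t}. K x \<partial>lborel) = (\<integral>\<^sup>+ x\<in>{0<..<t}. K x \<partial>M0)"
    unfolding nn_integral_M0 by (intro nn_integral_cong) (auto simp: indicator_def)
  also note C
  also have "ennreal C * \<rho> K < \<infinity>" using fin by (simp add: ennreal_mult_less_top)
  finally show ?thesis .
qed

text \<open>The factor \<open>2\<close> leaves room to cut off the mass of
  \<open>K\<close> near \<open>0\<close>, so that lower step functions of \<open>K\<close> can be used.\<close>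

lemma ri_majorization_shifted:
  fixes F K :: "real \<Rightarrow> ennreal"
  assumes F[measurable]: "F \<in> borel_measurable borel" "\<And>s t. 0 < s \<Longrightarrow> s \<le> t \<Longrightarrow> F t \<le> F s"
    and K[measurable]: "K \<in> borel_measurable borel" "\<And>s t. 0 < s \<Longrightarrow> s \<le> t \<Longrightarrow> K t \<le> K s"
    and le: "\<And>t. 0 < t \<Longrightarrow> (\<integral>\<^sup>+ x\<in>{0<..<t}. F x \<partial>lborel) \<le> (\<integral>\<^sup>+ x\<in>{0<..<t}. K x \<partial>lborel)"
    and \<epsilon>: "0 < \<epsilon>" and L: "0 < L"
  shows "\<rho> (\<lambda>x. F (x + \<epsilon>) * indicator {0<..L} x) \<le> 2 * \<rho> K"
proof (cases "\<rho> K = \<infinity>")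
  case True
  then show ?thesis by (simp add: ennreal_mult_top)
next
  case False
  then have fin: "(\<integral>\<^sup>+ x\<in>{0<..<t}. K x \<partial>lborel) < \<infinity>" for t
    by (intro ri_finite_imp_integral_finite) (auto simp: less_top)
  \<comment> \<open>A decreasing function with finite integral near 0 is finite at every positive
    point, so the cell values below can be real numbers.\<close>
  have finF: "F t < \<infinity>" and finK: "K t < \<infinity>" if t: "0 < t" for t
  proof -
    have *: "G t < \<infinity>" if [measurable]: "G \<in> borel_measurable borel" and "\<And>s t. 0 < s \<Longrightarrow> s \<le> t \<Longrightarrow> G t \<le> G s"
      and "(\<integral>\<^sup>+ x\<in>{0<..<t}. G x \<partial>lborel) < \<infinity>" for G :: "real \<Rightarrow> ennreal"
    proof -
      have "G t * ennreal t < \<infinity>"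
        using riemann_sum_antimono_le[of G t 1] that t by (simp add: order_le_less_trans)
      then show ?thesis using t by (auto simp: ennreal_mult_less_top)
    qed
    show "F t < \<infinity>" by (rule *[OF F order_le_less_trans[OF le[OF t] fin]])
    show "K t < \<infinity>" by (rule *[OF K fin])
  qed
  define f where "f x = enn2real (F x)" for x
  define k where "k x = enn2real (K x)" for x
  have f: "F x = ennreal (f x)" "0 \<le> f x" and k: "K x = ennreal (k x)" "0 \<le> k x" if "0 < x" for x
    using finF[OF that] finK[OF that] by (auto simp: f_def k_def)
  obtain m0 where m0: "(\<integral>\<^sup>+ x\<in>{0<..<\<epsilon>}. K x \<partial>lborel) \<le> 2 * (\<integral>\<^sup>+ x\<in>{\<epsilon> / real (Suc m0)..<\<epsilon>}. K x \<partial>lborel)"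
    using half_integral_away_from_0[OF K(1) \<epsilon> fin] by blast
  \<comment> \<open>M cells make up (0, \<epsilon>], and the first of them is exactly the part
    discarded by the choice of \<open>m0\<close>.\<close>
  define M where "M = Suc m0"
  define \<delta> where "\<delta> = \<epsilon> / real M"
  have \<delta>: "0 < \<delta>" "\<delta> \<le> \<epsilon>" "real M * \<delta> = \<epsilon>" using \<epsilon> by (auto simp: \<delta>_def M_def field_simps)
  obtain N0 where "L / \<delta> < real N0" using reals_Archimedean2 by blast
  then have N0: "L \<le> real N0 * \<delta>" using \<delta> by (simp add: field_simps)
  define N where "N = M + N0"
  have N: "M \<le> N" "L \<le> real N * \<delta>" using N0 \<delta> by (auto simp: N_def algebra_simps intro: order_trans)
  have pos: "0 < real (Suc j) * \<delta>" for j using \<delta> by simp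
  have mono: "real (Suc i) * \<delta> \<le> real (Suc j) * \<delta>" if "i \<le> j" for i j
    using that \<delta> by (intro mult_right_mono) auto
  \<comment> \<open>F is flattened below \<epsilon>, so its samples are constant on the first M
    cells and \<open>initial_block_partial_sums\<close> can treat partial sums that end
    there.\<close>
  define G where "G x = F (max \<epsilon> x)" for x
  have [measurable]: "G \<in> borel_measurable borel" unfolding G_def by measurable
  have Ganti: "G t \<le> G s" if "s \<le> t" for s t
    unfolding G_def using that \<epsilon> by (intro F) auto
  have GF: "G x \<le> F x" if "0 < x" for x unfolding G_def using that by (intro F) auto
  \<comment> \<open>Halving pays for the factor 2 in the choice of \<open>m0\<close>; it returns as
    the 2 of the conclusion.\<close>
  define a where "a j = f (max \<epsilon> (real (Suc j) * \<delta>)) / 2" for j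
  define b where "b j = k (real (Suc j) * \<delta>)" for j
  have a: "0 \<le> a j" "G (real (Suc j) * \<delta>) = ennreal (2 * a j)" for j
    using f[of "max \<epsilon> (real (Suc j) * \<delta>)"] \<epsilon> by (auto simp: a_def G_def)
  have b: "0 \<le> b j" "K (real (Suc j) * \<delta>) = ennreal (b j)" for j
    using k[OF pos[of j]] by (auto simp: b_def)
  have a_anti: "a j \<le> a i" if "i \<le> j" for i j
    using Ganti[OF mono[OF that]] a by (simp add: ennreal_le_iff)
  have b_anti: "b j \<le> b i" if "i \<le> j" for i j
    using K(2)[OF pos mono[OF that]] b by (simp add: ennreal_le_iff)
  \<comment> \<open>From M cells on, the sums are compared through the integrals of F and K. The
    samples of K miss its mass on (0, \<delta>), which the choice of \<open>m0\<close>
    recovers.\<close>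
  have large: "(\<Sum>j<l. a j) \<le> (\<Sum>j<l. b j)" if l: "M \<le> l" for l
  proof -
    obtain l' where l': "l = Suc l'" using l by (cases l) (auto simp: M_def)
    have \<epsilon>l: "\<epsilon> \<le> real l * \<delta>" using \<delta> l by (subst \<delta>(3)[symmetric]) (intro mult_right_mono, auto)
    have "(\<integral>\<^sup>+ x. K x * indicator {\<delta>..<\<epsilon>} x + K x * indicator {\<epsilon>..<real l * \<delta>} x \<partial>lborel)
        = (\<integral>\<^sup>+ x\<in>{\<delta>..<real l * \<delta>}. K x \<partial>lborel)"
      using \<delta> \<epsilon>l by (intro nn_integral_cong) (auto simp: indicator_def)
    also have "\<dots> \<le> (\<Sum>j<l'. K (real (Suc j) * \<delta>)) * ennreal \<delta>"
      unfolding l' using \<delta> K by (intro riemann_sum_antimono_ge) auto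
    also have "\<dots> \<le> (\<Sum>j<l. K (real (Suc j) * \<delta>)) * ennreal \<delta>"
      unfolding l' by (intro mult_right_mono) auto
    also have "(\<Sum>j<l. K (real (Suc j) * \<delta>)) = ennreal (\<Sum>j<l. b j)"
      unfolding b(2) using b(1) by (intro sum_ennreal) simp
    finally have upper: "(\<integral>\<^sup>+ x. K x * indicator {\<delta>..<\<epsilon>} x + K x * indicator {\<epsilon>..<real l * \<delta>} x \<partial>lborel)
        \<le> ennreal (\<Sum>j<l. b j) * ennreal \<delta>" .
    have "2 * \<delta> * (\<Sum>j<l. a j) = (\<Sum>j<l. 2 * a j) * \<delta>"
      by (simp add: sum_distrib_left[symmetric])
    then have "ennreal (2 * \<delta> * (\<Sum>j<l. a j)) = ennreal (\<Sum>j<l. 2 * a j) * ennreal \<delta>"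
      using \<delta> by (simp only: ennreal_mult'')
    also have "ennreal (\<Sum>j<l. 2 * a j) = (\<Sum>j<l. G (real (Suc j) * \<delta>))"
      unfolding a(2) using a(1) by (intro sum_ennreal[symmetric]) simp
    also have "(\<Sum>j<l. G (real (Suc j) * \<delta>)) * ennreal \<delta> \<le> (\<integral>\<^sup>+ x\<in>{0<..<real l * \<delta>}. G x \<partial>lborel)"
      using \<delta> Ganti by (intro riemann_sum_antimono_le) auto
    also have "\<dots> \<le> (\<integral>\<^sup>+ x\<in>{0<..<real l * \<delta>}. F x \<partial>lborel)"
      using GF by (intro nn_integral_mono) (auto simp: indicator_def)
    also have "\<dots> \<le> (\<integral>\<^sup>+ x\<in>{0<..<real l * \<delta>}. K x \<partial>lborel)" using \<epsilon> \<epsilon>l by (intro le) simp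
    also have "\<dots> = (\<integral>\<^sup>+ x. K x * indicator {0<..<\<epsilon>} x + K x * indicator {\<epsilon>..<real l * \<delta>} x \<partial>lborel)"
      using \<epsilon> \<epsilon>l by (intro nn_integral_cong) (auto simp: indicator_def)
    also have "\<dots> = (\<integral>\<^sup>+ x\<in>{0<..<\<epsilon>}. K x \<partial>lborel) + (\<integral>\<^sup>+ x\<in>{\<epsilon>..<real l * \<delta>}. K x \<partial>lborel)"
      by (intro nn_integral_add) measurable
    also have "\<dots> \<le> 2 * (\<integral>\<^sup>+ x\<in>{\<delta>..<\<epsilon>}. K x \<partial>lborel) + 2 * (\<integral>\<^sup>+ x\<in>{\<epsilon>..<real l * \<delta>}. K x \<partial>lborel)"
      using m0 mult_right_mono[of 1 "2 :: ennreal" "\<integral>\<^sup>+ x\<in>{\<epsilon>..<real l * \<delta>}. K x \<partial>lborel"]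
      by (intro add_mono) (simp_all add: \<delta>_def M_def)
    also have "\<dots> = 2 * (\<integral>\<^sup>+ x. K x * indicator {\<delta>..<\<epsilon>} x + K x * indicator {\<epsilon>..<real l * \<delta>} x \<partial>lborel)"
      by (subst nn_integral_add) (auto simp: distrib_left)
    also have "\<dots> \<le> 2 * (ennreal (\<Sum>j<l. b j) * ennreal \<delta>)"
      using upper by (rule mult_left_mono) simp
    also have "\<dots> = ennreal (2 * \<delta> * (\<Sum>j<l. b j))"
      using b(1) \<delta> by (simp add: ennreal_mult sum_nonneg mult.commute mult.left_commute)
    finally have "2 * \<delta> * (\<Sum>j<l. a j) \<le> 2 * \<delta> * (\<Sum>j<l. b j)"
      using b \<delta> by (subst (asm) ennreal_le_iff) (auto intro!: mult_nonneg_nonneg sum_nonneg)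
    then show ?thesis using \<delta> by simp
  qed
  have sums: "(\<Sum>j<l. a j) \<le> (\<Sum>j<l. b j)" for l
  proof (cases "M \<le> l")
    case False
    define \<alpha> where "\<alpha> = f \<epsilon> / 2"
    have \<alpha>: "a j = \<alpha>" if "j < M" for j
    proof -
      have "real (Suc j) * \<delta> \<le> real M * \<delta>" using that \<delta> by (intro mult_right_mono) auto
      then show ?thesis unfolding a_def \<alpha>_def \<delta>(3) by (simp add: max_absorb1)
    qed
    have "real l * \<alpha> \<le> (\<Sum>j<l. b j)"
    proof (rule initial_block_partial_sums[OF b_anti])
      show "real M * \<alpha> \<le> (\<Sum>j<M. b j)" using large[of M] \<alpha> by simp
      show "l \<le> M" using False by simp
    qed
    then show ?thesis using \<alpha> False by simp
  qed (rule large)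
  have "\<rho> (\<lambda>x. F (x + \<epsilon>) * indicator {0<..L} x) \<le> \<rho> (\<lambda>x. ennreal 2 * step \<delta> N a x)"
  proof (rule ri_mono[OF ri])
    show "(\<lambda>x. F (x + \<epsilon>) * indicator {0<..L} x) \<in> borel_measurable M0"
      by (intro borel_measurable_M0) measurable
    show "(\<lambda>x. ennreal 2 * step \<delta> N a x) \<in> borel_measurable M0" by measurable
    fix x :: real assume x: "0 < x"
    show "F (x + \<epsilon>) * indicator {0<..L} x \<le> ennreal 2 * step \<delta> N a x"
    proof (cases "x \<le> L")
      case True
      then obtain j where j: "j < N" "real j * \<delta> < x" "x \<le> real (Suc j) * \<delta>"
        using cell_exists[OF \<delta>(1) x, of N] N by auto
      \<comment> \<open>This is what the shift by \<epsilon> is for: both the right end of the cell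
        of x and \<epsilon> itself are at most x + \<epsilon>.\<close>
      have "real (Suc j) * \<delta> \<le> x + \<epsilon>" using j(2) \<delta> by (simp add: algebra_simps)
      then have "F (x + \<epsilon>) \<le> G (real (Suc j) * \<delta>)" unfolding G_def using \<epsilon> x by (intro F) auto
      also have "\<dots> = ennreal 2 * step \<delta> N a x" using a step_eq[OF \<delta>(1) j] by (simp add: ennreal_mult)
      finally show ?thesis using True x by simp
    qed simp
  qed
  also have "\<dots> = ennreal 2 * \<rho> (step \<delta> N a)" by (rule ri_scale[OF ri]) auto
  also have "\<dots> \<le> ennreal 2 * \<rho> (step \<delta> N b)"
    using a b a_anti sums \<delta> by (intro mult_left_mono ri_step_majorization[OF ri]) auto
  also have "\<dots> \<le> ennreal 2 * \<rho> K"
  proof (intro mult_left_mono ri_mono[OF ri])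
    show "K \<in> borel_measurable M0" by (rule borel_measurable_M0) measurable
    fix x :: real assume x: "0 < x"
    show "step \<delta> N b x \<le> K x"
    proof (cases "x \<le> real N * \<delta>")
      case True
      then obtain j where j: "j < N" "real j * \<delta> < x" "x \<le> real (Suc j) * \<delta>"
        using cell_exists[OF \<delta>(1) x, of N] by auto
      show ?thesis unfolding step_eq[OF \<delta>(1) j] b(2)[symmetric] by (rule K(2)[OF x j(3)])
    next
      case False
      then show ?thesis using step_outside[OF \<delta>(1), of x N b] by simp
    qed
  qed auto
  finally show ?thesis by simp
qed

text \<open>Shifts by 1/(m+1) and cut-offs at m+1 produce functions increasing to the right-hand
  limit of F, and the Fatou property carries the bound to the limit. This is why g is compared with
  F at some point to the right of x.\<close>

lemma ri_majorization:
  fixes F K g :: "real \<Rightarrow> ennreal"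
  assumes F[measurable]: "F \<in> borel_measurable borel" "\<And>s t. 0 < s \<Longrightarrow> s \<le> t \<Longrightarrow> F t \<le> F s"
    and K: "K \<in> borel_measurable borel" "\<And>s t. 0 < s \<Longrightarrow> s \<le> t \<Longrightarrow> K t \<le> K s"
    and le: "\<And>t. 0 < t \<Longrightarrow> (\<integral>\<^sup>+ x\<in>{0<..<t}. F x \<partial>lborel) \<le> (\<integral>\<^sup>+ x\<in>{0<..<t}. K x \<partial>lborel)"
    and g: "g \<in> borel_measurable M0" "\<And>x. 0 < x \<Longrightarrow> \<exists>y>x. g x \<le> F y"
  shows "\<rho> g \<le> 2 * \<rho> K"
proof -
  define H where "H m x = F (x + 1 / real (Suc m)) * indicator {0<..real (Suc m)} x" for m x
  have H: "H m \<in> borel_measurable M0" for m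
    unfolding H_def by (intro borel_measurable_M0) measurable
  have "\<rho> g \<le> \<rho> (\<lambda>x. SUP m. H m x)"
  proof (rule ri_mono[OF ri _ g(1)])
    show "(\<lambda>x. SUP m. H m x) \<in> borel_measurable M0" using H by measurable
    fix x :: real assume x: "0 < x"
    then obtain y where y: "x < y" "g x \<le> F y" using g(2) by blast
    obtain m1 where m1: "1 / (y - x) < real m1" using reals_Archimedean2 by blast
    obtain m2 where m2: "x < real m2" using reals_Archimedean2 by blast
    define m where "m = max m1 m2"
    have "1 / (y - x) < real (Suc m)" "x \<le> real (Suc m)" using m1 m2 by (auto simp: m_def)
    then have "x + 1 / real (Suc m) \<le> y" "x \<le> real (Suc m)" using y(1) by (auto simp: field_simps)
    moreover have "F y \<le> F (x + 1 / real (Suc m))" using x calculation by (intro F) (auto simp: add_pos_pos)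
    ultimately have "g x \<le> H m x" using y(2) x by (simp add: H_def)
    then show "g x \<le> (SUP m. H m x)" by (intro SUP_upper2[of m]) auto
  qed
  also have "\<dots> = (SUP m. \<rho> (H m))"
  proof (rule ri_SUP[OF ri H])
    fix x :: real assume x: "0 < x"
    show "incseq (\<lambda>m. H m x)"
    proof (rule incseq_SucI)
      fix m
      have "F (x + 1 / real (Suc m)) \<le> F (x + 1 / real (Suc (Suc m)))"
        using x by (intro F) (auto simp: add_pos_pos frac_le)
      then show "H m x \<le> H (Suc m) x" by (auto simp: H_def indicator_def)
    qed
  qed
  also have "\<dots> \<le> 2 * \<rho> K"
    unfolding H_def using F K le by (intro SUP_least ri_majorization_shifted) auto
  finally show ?thesis .
qed

end

section \<open>The lower Boyd index\<close>

text \<open>Superlevel sets of a decreasing K are initial intervals, and right continuity settles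
  the case of their endpoint. Since \<open>dilation_norm\<close> is defined through rearrangements,
  this lets it act on K directly.\<close>

lemma rearr_M0_antimono:
  fixes K :: "real \<Rightarrow> ennreal"
  assumes anti: "\<And>s t. 0 < s \<Longrightarrow> s \<le> t \<Longrightarrow> K t \<le> K s"
    and right: "\<And>s. 0 < s \<Longrightarrow> K s \<le> (SUP t\<in>{s<..}. K t)" and s: "0 < s"
  shows "rearr M0 K s = K s"
proof -
  have meas: "K \<in> borel_measurable M0" using anti by (rule antimono_borel_measurable_M0)
  have "l < rearr M0 K s \<longleftrightarrow> l < K s" for l
  proof
    have sets: "{x \<in> space M0. l < K x} \<in> sets M0" using meas by measurable
    {
      assume "l < rearr M0 K s"
      then have less: "ennreal s < emeasure M0 {x \<in> space M0. l < K x}"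
        using less_rearr_iff[OF meas] by blast
      show "l < K s"
      proof (rule ccontr)
        assume n: "\<not> l < K s"
        have "{x \<in> space M0. l < K x} \<subseteq> {0<..<s}"
        proof
          fix x assume x: "x \<in> {x \<in> space M0. l < K x}"
          have "\<not> s \<le> x" using anti[OF s, of x] x n by (auto dest: order_less_le_trans)
          then show "x \<in> {0<..<s}" using x by simp
        qed
        then have "emeasure M0 {x \<in> space M0. l < K x} \<le> emeasure M0 {0<..<s}"
          by (intro emeasure_mono) (auto simp: sets_restrict_space_iff)
        also have "\<dots> = ennreal s" using s by (subst emeasure_M0) auto
        finally show False using less by simp
      qed
    next
      assume "l < K s"
      then have "l < (SUP t\<in>{s<..}. K t)" using right[OF s] by (rule order_less_le_trans)
      then obtain t where t: "s < t" "l < K t" by (auto simp: less_SUP_iff)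
      have "ennreal s < ennreal t" using t s by (simp add: ennreal_less_iff)
      also have "\<dots> = emeasure M0 {0<..t}" using t s by (subst emeasure_M0) auto
      also have "\<dots> \<le> emeasure M0 {x \<in> space M0. l < K x}"
        using anti t sets by (intro emeasure_mono) (auto intro: order_less_le_trans)
      finally show "l < rearr M0 K s" using less_rearr_iff[OF meas] by blast
    }
  qed
  then show ?thesis by (metis linorder_neqE less_irrefl)
qed

context
  fixes \<rho> :: "(real \<Rightarrow> ennreal) \<Rightarrow> ennreal"
  assumes ri: "ri_norm \<rho>"
begin

text \<open>The supremum in \<open>dilation_norm\<close> ranges over functions of positive finite
  norm. Norm 0 is therefore treated separately, using that \<open>h (t / \<sigma>)\<close> is at
  most \<open>h t\<close>.\<close>

lemma ri_dilation_le:
  fixes h :: "real \<Rightarrow> ennreal"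
  assumes anti: "\<And>s t. 0 < s \<Longrightarrow> s \<le> t \<Longrightarrow> h t \<le> h s"
    and right: "\<And>s. 0 < s \<Longrightarrow> h s \<le> (SUP t\<in>{s<..}. h t)"
    and \<sigma>: "0 < \<sigma>" "\<sigma> < 1" and fin: "\<rho> h < \<infinity>"
  shows "\<rho> (\<lambda>t. h (t / \<sigma>)) \<le> dilation_norm \<rho> \<sigma> * \<rho> h"
proof -
  have h: "h \<in> borel_measurable M0" using anti by (rule antimono_borel_measurable_M0)
  have h\<sigma>: "(\<lambda>t. h (t / \<sigma>)) \<in> borel_measurable M0"
    using \<sigma> by (intro antimono_borel_measurable_M0 anti) (auto simp: divide_right_mono)
  show ?thesis
  proof (cases "\<rho> h = 0")
    case True
    have "\<rho> (\<lambda>t. h (t / \<sigma>)) \<le> \<rho> h"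
    proof (rule ri_mono[OF ri h h\<sigma>])
      fix x :: real assume "0 < x"
      then show "h (x / \<sigma>) \<le> h x" using \<sigma> by (intro anti) (auto simp: field_simps)
    qed
    then show ?thesis using True by simp
  next
    case False
    let ?r = "rearr M0 h"
    have r: "?r t = h t" if "0 < t" for t using anti right that by (rule rearr_M0_antimono)
    have rm: "?r \<in> borel_measurable M0" by (intro antimono_borel_measurable_M0 rearr_antimono)
    have r\<sigma>m: "(\<lambda>t. ?r (t / \<sigma>)) \<in> borel_measurable M0"
      using \<sigma> by (intro antimono_borel_measurable_M0 rearr_antimono) (auto simp: divide_right_mono)
    have r1: "\<rho> ?r = \<rho> h" using r by (intro ri_cong[OF ri h rm])
    have r2: "\<rho> (\<lambda>t. ?r (t / \<sigma>)) = \<rho> (\<lambda>t. h (t / \<sigma>))"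
      using r \<sigma> by (intro ri_cong[OF ri h\<sigma> r\<sigma>m]) simp
    have "\<rho> (\<lambda>t. ?r (t / \<sigma>)) / \<rho> ?r \<le> dilation_norm \<rho> \<sigma>"
      unfolding dilation_norm_def using h False fin by (intro SUP_upper) (auto simp: zero_less_iff_neq_zero)
    then have "\<rho> (\<lambda>t. h (t / \<sigma>)) / \<rho> h * \<rho> h \<le> dilation_norm \<rho> \<sigma> * \<rho> h"
      unfolding r1 r2 by (rule mult_right_mono) simp
    then show ?thesis using False fin by (simp add: ennreal_divide_times mult_divide_eq_ennreal)
  qed
qed

text \<open>A positive Boyd index supplies one \<sigma> < 1 whose dilation norm d is below 1.
  Iterating this single dilation bounds the k-th dilate by d^k times the norm of h, so C = 1/(1 - d)
  works for finite sums, and the Fatou property gives the series.\<close>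

lemma ri_dyadic_tail_sum_bound:
  assumes boyd: "0 < lower_boyd \<rho>"
  shows "\<exists>\<sigma> C. 0 < \<sigma> \<and> \<sigma> < 1 \<and> 0 < C \<and> (\<forall>h. (\<forall>s t. 0 < s \<longrightarrow> s \<le> t \<longrightarrow> h t \<le> h s) \<longrightarrow>
    (\<forall>s>0. h s \<le> (SUP t\<in>{s<..}. h t)) \<longrightarrow> \<rho> (\<lambda>t. \<Sum>k. h (t / \<sigma> ^ k)) \<le> ennreal C * \<rho> h)"
proof -
  obtain \<sigma> where \<sigma>: "0 < \<sigma>" "\<sigma> < 1" and ln: "0 < ln (enn2real (dilation_norm \<rho> \<sigma>)) / ln \<sigma>"
    using boyd by (auto simp: lower_boyd_def less_SUP_iff)
  define d where "d = enn2real (dilation_norm \<rho> \<sigma>)"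
  have "ln d < 0" using ln \<sigma> ln_less_zero[of \<sigma>] by (auto simp: d_def zero_less_divide_iff)
  moreover have "0 \<le> d" by (simp add: d_def)
  \<comment> \<open>\<open>ln 0\<close> is 0 and \<open>enn2real\<close> sends infinity to 0, so a
    negative logarithm excludes both a vanishing and an infinite dilation norm.\<close>
  ultimately have d: "0 < d" "d < 1" by (cases "d = 0"; auto simp: ln_less_zero_iff)+
  have D: "dilation_norm \<rho> \<sigma> = ennreal d"
    using d(1) by (cases "dilation_norm \<rho> \<sigma>") (auto simp: d_def)
  have "\<rho> (\<lambda>t. \<Sum>k. h (t / \<sigma> ^ k)) \<le> ennreal (1 / (1 - d)) * \<rho> h"
    if anti: "\<forall>s t. 0 < s \<longrightarrow> s \<le> t \<longrightarrow> h t \<le> h s" and right: "\<forall>s>0. h s \<le> (SUP t\<in>{s<..}. h t)"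
    for h :: "real \<Rightarrow> ennreal"
  proof (cases "\<rho> h = \<infinity>")
    case True
    then show ?thesis using d by (simp add: ennreal_mult_top)
  next
    case False
    have anti_k: "h (t / \<sigma> ^ k) \<le> h (s / \<sigma> ^ k)" if "0 < s" "s \<le> t" for s t k
      using anti that \<sigma> by (simp add: divide_right_mono)
    have meas: "(\<lambda>t. h (t / \<sigma> ^ k)) \<in> borel_measurable M0" for k
      using anti_k by (rule antimono_borel_measurable_M0)
    have right_k: "h (s / \<sigma> ^ k) \<le> (SUP t\<in>{s<..}. h (t / \<sigma> ^ k))" if "0 < s" for s k
    proof -
      have "h (s / \<sigma> ^ k) \<le> (SUP t\<in>{s / \<sigma> ^ k<..}. h t)" using right that \<sigma> by simp
      also have "\<dots> \<le> (SUP t\<in>{s<..}. h (t / \<sigma> ^ k))"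
      proof (rule SUP_least)
        fix t assume "t \<in> {s / \<sigma> ^ k<..}"
        then have "s < t * \<sigma> ^ k" using \<sigma> by (simp add: field_simps)
        then show "h t \<le> (SUP t\<in>{s<..}. h (t / \<sigma> ^ k))"
          using \<sigma> by (intro SUP_upper2[of "t * \<sigma> ^ k"]) auto
      qed
      finally show ?thesis .
    qed
    have iter: "\<rho> (\<lambda>t. h (t / \<sigma> ^ k)) \<le> ennreal (d ^ k) * \<rho> h" for k
    proof (induction k)
      case (Suc k)
      have "\<rho> (\<lambda>t. h (t / \<sigma> ^ k)) < \<infinity>"
        using Suc False by (auto simp: less_top ennreal_mult_less_top intro: order_le_less_trans)
      then have "\<rho> (\<lambda>t. h (t / \<sigma> / \<sigma> ^ k)) \<le> ennreal d * \<rho> (\<lambda>t. h (t / \<sigma> ^ k))"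
        using ri_dilation_le[of "\<lambda>t. h (t / \<sigma> ^ k)", OF anti_k right_k \<sigma>] D by simp
      also have "\<dots> \<le> ennreal d * (ennreal (d ^ k) * \<rho> h)" by (intro mult_left_mono Suc) simp
      also have "\<dots> = ennreal (d ^ Suc k) * \<rho> h" using d by (simp add: ennreal_mult mult.assoc)
      finally show ?case by (simp add: mult.commute)
    qed simp
    have partial: "\<rho> (\<lambda>t. \<Sum>k<N. h (t / \<sigma> ^ k)) \<le> (\<Sum>k<N. ennreal (d ^ k)) * \<rho> h" for N
    proof (induction N)
      case 0
      have "\<rho> (\<lambda>_. 0) = 0" by (subst ri_eq_0_iff[OF ri]) auto
      then show ?case by simp
    next
      case (Suc N)
      have "\<rho> (\<lambda>t. \<Sum>k<Suc N. h (t / \<sigma> ^ k)) \<le> \<rho> (\<lambda>t. \<Sum>k<N. h (t / \<sigma> ^ k)) + \<rho> (\<lambda>t. h (t / \<sigma> ^ N))"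
        unfolding sum.lessThan_Suc by (intro ri_add[OF ri] borel_measurable_sum meas)
      also have "\<dots> \<le> (\<Sum>k<N. ennreal (d ^ k)) * \<rho> h + ennreal (d ^ N) * \<rho> h"
        by (intro add_mono Suc iter)
      finally show ?case by (simp add: distrib_right)
    qed
    have geo: "(\<Sum>k<N. ennreal (d ^ k)) \<le> ennreal (1 / (1 - d))" for N
    proof -
      have "(\<Sum>k<N. d ^ k) = (1 - d ^ N) / (1 - d)" using d by (simp add: sum_gp_strict)
      also have "\<dots> \<le> 1 / (1 - d)" using d by (intro divide_right_mono) auto
      finally show ?thesis using d by (simp add: sum_ennreal ennreal_leI)
    qed
    have "\<rho> (\<lambda>t. \<Sum>k. h (t / \<sigma> ^ k)) = \<rho> (\<lambda>t. SUP N. \<Sum>k<N. h (t / \<sigma> ^ k))"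
      by (simp add: suminf_eq_SUP)
    also have "\<dots> = (SUP N. \<rho> (\<lambda>t. \<Sum>k<N. h (t / \<sigma> ^ k)))"
      by (intro ri_SUP[OF ri] borel_measurable_sum meas incseq_SucI) simp
    also have "\<dots> \<le> ennreal (1 / (1 - d)) * \<rho> h"
      by (intro SUP_least order_trans[OF partial] mult_right_mono geo) simp
    finally show ?thesis .
  qed
  then show ?thesis using \<sigma> d by (intro exI[of _ \<sigma>] exI[of _ "1 / (1 - d)"]) auto
qed

end

section \<open>The estimate in rearrangement-invariant norms\<close>

lemma nn_integral_dilate:
  fixes u :: "real \<Rightarrow> ennreal"
  assumes [measurable]: "u \<in> borel_measurable borel" and c: "0 < c"
  shows "(\<integral>\<^sup>+ x\<in>{0<..<t}. u (x / c) \<partial>lborel) = ennreal c * (\<integral>\<^sup>+ x\<in>{0<..<t / c}. u x \<partial>lborel)"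
proof -
  have "(\<integral>\<^sup>+ x\<in>{0<..<t}. u (x / c) \<partial>lborel)
      = ennreal \<bar>c\<bar> * (\<integral>\<^sup>+ x. u ((0 + c * x) / c) * indicator {0<..<t} (0 + c * x) \<partial>lborel)"
  proof (rule nn_integral_real_affine)
    show "(\<lambda>x. u (x / c) * indicator {0<..<t} x) \<in> borel_measurable borel" by measurable
    show "c \<noteq> 0" using c by simp
  qed
  also have "(\<integral>\<^sup>+ x. u ((0 + c * x) / c) * indicator {0<..<t} (0 + c * x) \<partial>lborel) = (\<integral>\<^sup>+ x\<in>{0<..<t / c}. u x \<partial>lborel)"
    using c by (intro nn_integral_cong) (auto simp: indicator_def field_simps zero_less_mult_iff)
  finally show ?thesis using c by simp
qed

lemma geometric_cell_exists:
  fixes \<sigma> :: real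
  assumes \<sigma>: "0 < \<sigma>" "\<sigma> < 1" and t: "0 < t" "t < s"
  shows "\<exists>k. t / \<sigma> ^ k \<le> s \<and> s \<le> t / \<sigma> ^ Suc k"
proof -
  let ?P = "\<lambda>k. s \<le> t / \<sigma> ^ Suc k"
  obtain m where "\<sigma> ^ m < t / s" using real_arch_pow_inv[of "t / s" \<sigma>] \<sigma> t by auto
  then have "s \<le> t / \<sigma> ^ m" using \<sigma> t by (simp add: field_simps)
  also have "\<dots> \<le> t / \<sigma> ^ Suc m" using \<sigma> t by (intro divide_left_mono) (auto simp: mult_le_cancel_right1)
  finally have "?P m" .
  then have k: "?P (LEAST k. ?P k)" by (rule LeastI)
  have "t / \<sigma> ^ (LEAST k. ?P k) \<le> s"
  proof (cases "LEAST k. ?P k")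
    case (Suc j)
    then have "\<not> ?P j" using not_less_Least[of j ?P] by simp
    then show ?thesis unfolding Suc by simp
  qed (use t in simp)
  then show ?thesis using k by blast
qed

text \<open>Since \<open>s (f\<^sup>*\<^sup>*(s) - f\<^sup>*(s))\<close> increases, the left-hand side varies by bounded factors on geometric cells; its
  decreasing majorant is therefore controlled by a sum of dilates, to which majorization applies.\<close>

lemma test_fun_ri_bound:
  fixes \<rho> :: "(real \<Rightarrow> ennreal) \<Rightarrow> ennreal"
  assumes dim: "2 \<le> CARD('n)" and ri: "ri_norm \<rho>" and boyd: "0 < lower_boyd \<rho>"
    and A: "0 < A" "\<And>f :: real^'n \<Rightarrow> real. \<And>t. test_fun f \<Longrightarrow> 0 < t \<Longrightarrow>
      (\<integral>\<^sup>+ s\<in>{0<..<t}. ennreal (s powr (- 1 / real CARD('n))) * (fstarstar f s - fstar f s) \<partial>lborel)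
        \<le> ennreal A * (\<integral>\<^sup>+ s\<in>{0<..<t}. fstar (\<lambda>x. norm (grad f x)) s \<partial>lborel)"
  shows "\<exists>C>0. \<forall>f :: real^'n \<Rightarrow> real. test_fun f \<longrightarrow>
    \<rho> (\<lambda>s. ennreal (s powr (- 1 / real CARD('n))) * (fstarstar f s - fstar f s))
      \<le> ennreal C * \<rho> (fstar (\<lambda>x. norm (grad f x)))"
proof -
  obtain \<sigma> C where \<sigma>: "0 < \<sigma>" "\<sigma> < 1" and C: "0 < C" and tail: "\<And>h. (\<forall>s t. 0 < s \<longrightarrow> s \<le> t \<longrightarrow> h t \<le> h s) \<Longrightarrow>
    (\<forall>s>0. h s \<le> (SUP t\<in>{s<..}. h t)) \<Longrightarrow> \<rho> (\<lambda>t. \<Sum>k. h (t / \<sigma> ^ k)) \<le> ennreal C * \<rho> h"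
    using ri_dyadic_tail_sum_bound[OF ri boyd] by blast
  define n where "n = real CARD('n)"
  have n: "2 \<le> n" using dim by (simp add: n_def)
  \<comment> \<open>The exponent for which g s = s^(-r) \<open>oscillation f s\<close>; B below is
    the factor by which s^(-r) can drop when s grows by at most 1/\<sigma>.\<close>
  define r where "r = 1 + 1 / n"
  have r: "0 \<le> r" using n by (simp add: r_def)
  define B where "B = (1 / \<sigma>) powr r"
  have B: "0 < B" using \<sigma> by (simp add: B_def)
  have pow: "0 < \<sigma> ^ k" for k using \<sigma> by simp
  have "\<rho> (\<lambda>s. ennreal (s powr (- 1 / n)) * (fstarstar f s - fstar f s))
      \<le> ennreal (2 * (B * B * A) * C) * \<rho> (fstar (\<lambda>x. norm (grad f x)))"
    if f: "test_fun f" for f :: "real^'n \<Rightarrow> real"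
  proof -
    note [measurable] = test_fun_borel_measurable_grad[OF f]
    define g where "g s = ennreal (s powr (- 1 / n)) * (fstarstar f s - fstar f s)" for s
    define h where "h = fstar (\<lambda>x. norm (grad f x))"
    have g_meas [measurable]: "g \<in> borel_measurable borel" unfolding g_def by measurable
    have h_meas [measurable]: "h \<in> borel_measurable borel" unfolding h_def by measurable
    have h_anti: "h t \<le> h s" if "s \<le> t" for s t unfolding h_def using that by (rule fstar_antimono)
    have "(\<lambda>x. ennreal \<bar>norm (grad f x)\<bar>) \<in> borel_measurable lebesgue"
      by (intro measurable_completion) measurable
    then have h_right: "h s \<le> (SUP t\<in>{s<..}. h t)" if "0 < s" for s
      unfolding h_def fstar_def using that by (intro rearr_right_cont) auto
    have gh: "(\<integral>\<^sup>+ s\<in>{0<..<t}. g s \<partial>lborel) \<le> ennreal A * (\<integral>\<^sup>+ s\<in>{0<..<t}. h s \<partial>lborel)" if "0 < t" for t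
      unfolding g_def h_def n_def using A(2)[OF f that] .
    have g_osc: "g s = ennreal (s powr (- r)) * oscillation f s" if "0 < s" for s
    proof -
      have "- r = - 1 / n + - 1" by (simp add: r_def)
      then have "s powr (- r) = s powr (- 1 / n + - 1)" by (rule arg_cong)
      also have "\<dots> = s powr (- 1 / n) * s powr (- 1)" by (rule powr_add)
      finally have "s powr (- r) = s powr (- 1 / n) * (1 / s)" using that by (simp add: powr_minus_divide)
      then have "ennreal (s powr (- r)) = ennreal (s powr (- 1 / n)) * inverse (ennreal s)"
        using that by (simp add: ennreal_mult[symmetric] inverse_ennreal inverse_eq_divide)
      moreover have "fstarstar f s - fstar f s = oscillation f s / ennreal s"
        using that test_fun_fstar_finite[OF f, of s] by (intro fstarstar_minus_fstar) auto
      ultimately show ?thesis by (simp add: g_def divide_ennreal_def mult_ac)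
    qed
    have doubling: "g x \<le> ennreal B * g s" if x: "0 < x" "x \<le> s" "s \<le> x / \<sigma>" for x s
    proof -
      have "x powr (- r) = B * (x / \<sigma>) powr (- r)"
        using x \<sigma> by (simp add: B_def powr_divide powr_minus_divide)
      also have "\<dots> \<le> B * s powr (- r)"
        using x B r by (intro mult_left_mono powr_mono2') auto
      finally have "ennreal (x powr (- r)) * oscillation f x \<le> ennreal (B * s powr (- r)) * oscillation f s"
        using x by (intro mult_mono ennreal_leI oscillation_mono) auto
      then show ?thesis using x B by (simp add: g_osc ennreal_mult mult.assoc)
    qed
    \<comment> \<open>The supremum over s > t makes F decreasing. It leaves out s = t, so the factor
      B is included: by \<open>doubling\<close>, g x is at most B times g at a later point.\<close>
    define F where "F t = ennreal B * (SUP s\<in>{t<..}. g s)" for t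
    define K where "K t = (\<Sum>k. h (t / \<sigma> ^ k))" for t
    have F_anti: "F t \<le> F s" if "s \<le> t" for s t
      unfolding F_def using that by (intro mult_left_mono SUP_subset_mono) auto
    have K_anti: "K t \<le> K s" if "s \<le> t" for s t
      unfolding K_def using that \<sigma> by (intro suminf_le summableI h_anti divide_right_mono) auto
    have F_meas [measurable]: "F \<in> borel_measurable borel" by (intro borel_measurable_antimono_ennreal F_anti)
    have K_meas [measurable]: "K \<in> borel_measurable borel" by (intro borel_measurable_antimono_ennreal K_anti)
    \<comment> \<open>A point s in the k-th geometric cell is compared with the right end of the
      cell, because \<open>doubling\<close> only moves to the right; hence the index
      \<open>Suc k\<close>.\<close>
    have F_le: "F t \<le> ennreal (B * B) * (\<Sum>k. g (t / \<sigma> ^ Suc k))" if t: "0 < t" for t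
    proof -
      have "g s \<le> ennreal B * (\<Sum>k. g (t / \<sigma> ^ Suc k))" if s: "t < s" for s
      proof -
        obtain k where k: "t / \<sigma> ^ k \<le> s" "s \<le> t / \<sigma> ^ Suc k"
          using geometric_cell_exists[OF \<sigma> t s] by blast
        have "t / \<sigma> ^ Suc k \<le> s / \<sigma>"
          using divide_right_mono[OF k(1), of \<sigma>] \<sigma> by (simp add: mult.commute)
        then have "g s \<le> ennreal B * g (t / \<sigma> ^ Suc k)"
          using s t k by (intro doubling) auto
        also have "\<dots> \<le> ennreal B * (\<Sum>k. g (t / \<sigma> ^ Suc k))"
          using sum_le_suminf[of "\<lambda>k. g (t / \<sigma> ^ Suc k)" "{k}"] by (intro mult_left_mono) (simp_all add: summableI)
        finally show ?thesis .
      qed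
      then have "(SUP s\<in>{t<..}. g s) \<le> ennreal B * (\<Sum>k. g (t / \<sigma> ^ Suc k))" by (intro SUP_least) simp
      then have "F t \<le> ennreal B * (ennreal B * (\<Sum>k. g (t / \<sigma> ^ Suc k)))"
        unfolding F_def by (rule mult_left_mono) simp
      then show ?thesis using B by (simp add: ennreal_mult mult.assoc)
    qed
    have FK: "(\<integral>\<^sup>+ x\<in>{0<..<t}. F x \<partial>lborel) \<le> (\<integral>\<^sup>+ x\<in>{0<..<t}. ennreal (B * B * A) * K x \<partial>lborel)" if t: "0 < t" for t
    proof -
      have cell: "(\<integral>\<^sup>+ x\<in>{0<..<t}. g (x / \<sigma> ^ Suc k) \<partial>lborel) \<le> ennreal A * (\<integral>\<^sup>+ x\<in>{0<..<t}. h (x / \<sigma> ^ k) \<partial>lborel)" for k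
      proof -
        have "(\<integral>\<^sup>+ x\<in>{0<..<t}. g (x / \<sigma> ^ Suc k) \<partial>lborel) = ennreal (\<sigma> ^ Suc k) * (\<integral>\<^sup>+ x\<in>{0<..<t / \<sigma> ^ Suc k}. g x \<partial>lborel)"
          by (rule nn_integral_dilate[OF g_meas pow])
        also have "\<dots> \<le> ennreal (\<sigma> ^ Suc k) * (ennreal A * (\<integral>\<^sup>+ x\<in>{0<..<t / \<sigma> ^ Suc k}. h x \<partial>lborel))"
          using t pow[of "Suc k"] by (intro mult_left_mono gh) auto
        also have "\<dots> = ennreal A * (\<integral>\<^sup>+ x\<in>{0<..<t}. h (x / \<sigma> ^ Suc k) \<partial>lborel)"
          unfolding nn_integral_dilate[OF h_meas pow] by (simp only: mult.left_commute)
        \<comment> \<open>Since h decreases, lowering the index only enlarges the integral; the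
          dilates then match the terms of K, which start at k = 0.\<close>
        also have "\<dots> \<le> ennreal A * (\<integral>\<^sup>+ x\<in>{0<..<t}. h (x / \<sigma> ^ k) \<partial>lborel)"
        proof (intro mult_left_mono nn_integral_mono)
          fix x :: real
          have "h (x / \<sigma> ^ Suc k) \<le> h (x / \<sigma> ^ k)" if "0 < x"
            using that \<sigma> pow[of k] by (intro h_anti divide_left_mono) (auto simp: mult_le_cancel_right1)
          then show "h (x / \<sigma> ^ Suc k) * indicator {0<..<t} x \<le> h (x / \<sigma> ^ k) * indicator {0<..<t} x"
            by (auto simp: indicator_def)
        qed simp
        finally show ?thesis .
      qed
      have "(\<integral>\<^sup>+ x\<in>{0<..<t}. F x \<partial>lborel)
          \<le> (\<integral>\<^sup>+ x. ennreal (B * B) * (\<Sum>k. g (x / \<sigma> ^ Suc k) * indicator {0<..<t} x) \<partial>lborel)"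
        using F_le by (intro nn_integral_mono) (auto simp: indicator_def)
      also have "\<dots> = ennreal (B * B) * (\<Sum>k. \<integral>\<^sup>+ x\<in>{0<..<t}. g (x / \<sigma> ^ Suc k) \<partial>lborel)"
        by (subst nn_integral_cmult, measurable, subst nn_integral_suminf, measurable)
      also have "\<dots> \<le> ennreal (B * B) * (\<Sum>k. ennreal A * (\<integral>\<^sup>+ x\<in>{0<..<t}. h (x / \<sigma> ^ k) \<partial>lborel))"
        by (intro mult_left_mono suminf_le summableI cell) simp
      also have "\<dots> = ennreal (B * B) * (ennreal A * (\<Sum>k. \<integral>\<^sup>+ x\<in>{0<..<t}. h (x / \<sigma> ^ k) \<partial>lborel))"
        by (simp add: ennreal_suminf_cmult)
      also have "(\<Sum>k. \<integral>\<^sup>+ x\<in>{0<..<t}. h (x / \<sigma> ^ k) \<partial>lborel) = (\<integral>\<^sup>+ x\<in>{0<..<t}. K x \<partial>lborel)"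
        unfolding K_def by (subst nn_integral_suminf[symmetric], measurable)
      also have "ennreal (B * B) * (ennreal A * (\<integral>\<^sup>+ x\<in>{0<..<t}. K x \<partial>lborel)) = (\<integral>\<^sup>+ x\<in>{0<..<t}. ennreal (B * B * A) * K x \<partial>lborel)"
        using A(1) B by (simp add: nn_integral_cmult ennreal_mult mult.assoc)
      finally show ?thesis .
    qed
    have "\<rho> g \<le> 2 * \<rho> (\<lambda>x. ennreal (B * B * A) * K x)"
    proof (rule ri_majorization[OF ri F_meas _ _ _ FK])
      show "g \<in> borel_measurable M0" by (rule borel_measurable_M0) measurable
      fix x :: real assume x: "0 < x"
      \<comment> \<open>The midpoint of x and z will be the required point to the right of x: it
        lies before z, so the supremum in F at the midpoint still sees z.\<close>
      define z where "z = x / \<sigma>"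
      have z: "x < z" using x \<sigma> by (simp add: z_def field_simps)
      have "g x \<le> ennreal B * g z" using x z by (intro doubling) (auto simp: z_def)
      also have "\<dots> \<le> F ((x + z) / 2)"
        unfolding F_def using z by (intro mult_left_mono SUP_upper) auto
      finally show "\<exists>y>x. g x \<le> F y" using z by (intro exI[of _ "(x + z) / 2"]) simp
    qed (auto intro!: F_anti mult_left_mono K_anti)
    also have "\<dots> = 2 * (ennreal (B * B * A) * \<rho> K)"
      using A B by (subst ri_scale[OF ri borel_measurable_M0[OF K_meas]]) auto
    also have "\<dots> \<le> 2 * (ennreal (B * B * A) * (ennreal C * \<rho> h))"
      unfolding K_def using h_anti h_right by (intro mult_left_mono tail) auto
    \<comment> \<open>One B is built into F, the other comes from comparing points within a cell; A
      is the constant of the integral inequality, 2 that of majorization, C that of the series of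
      dilates.\<close>
    also have "\<dots> = ennreal (2 * (B * B * A) * C) * \<rho> h"
      using A B C by (simp add: ennreal_mult mult.assoc)
    finally show ?thesis unfolding g_def h_def .
  qed
  moreover have "0 < 2 * (B * B * A) * C" using A B C by simp
  ultimately show ?thesis unfolding n_def by blast
qed

theorem theorem1p1:
  fixes n :: real
  assumes dim: "CARD('n::finite) \<ge> 2"
    and n_def: "n = real CARD('n)"
  shows
   "let
      S1 = (\<exists>c>0. \<forall>(f::real^'n \<Rightarrow> real) G. W01 f G \<longrightarrow>
              (\<forall>t>0. ennreal t * enn_powr (emeasure lebesgue {x. t < \<bar>f x\<bar>}) ((n - 1) / n)
                 \<le> ennreal c * (\<integral>\<^sup>+ x. ennreal (norm (G x)) \<partial>lebesgue)));
      S2 = (\<exists>c>0. \<forall>f::real^'n \<Rightarrow> real. test_fun f \<longrightarrow> (\<forall>t>0.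
              (\<integral>\<^sup>+ s \<in> {0<..<t}. ennreal (s powr (- 1 / n)) * (fstarstar f s - fstar f s) \<partial>lborel)
                 \<le> ennreal (c * n) * (\<integral>\<^sup>+ s \<in> {0<..<t}. fstar (\<lambda>x. norm (grad f x)) s \<partial>lborel)));
      S3 = (\<forall>\<rho>. ri_norm \<rho> \<longrightarrow> lower_boyd \<rho> > 0 \<longrightarrow>
              (\<exists>C>0. \<forall>f::real^'n \<Rightarrow> real. test_fun f \<longrightarrow>
                 \<rho> (\<lambda>s. ennreal (s powr (- 1 / n)) * (fstarstar f s - fstar f s))
                   \<le> ennreal C * \<rho> (fstar (\<lambda>x. norm (grad f x)))));
      S4 = (\<exists>c>0. \<forall>(f::real^'n \<Rightarrow> real) G. W01 f G \<longrightarrow>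
              lorentz_norm f \<le> ennreal c * (\<integral>\<^sup>+ x. ennreal (norm (G x)) \<partial>lebesgue))
    in (S1 \<longleftrightarrow> S2) \<and> (S2 \<longleftrightarrow> S3) \<and> (S3 \<longleftrightarrow> S4)"
proof -
  have n: "2 \<le> n" using dim n_def by simp
  obtain A where A: "0 < A" "\<And>f :: real^'n \<Rightarrow> real. \<And>t. test_fun f \<Longrightarrow> 0 < t \<Longrightarrow>
      (\<integral>\<^sup>+ s\<in>{0<..<t}. ennreal (s powr (- 1 / n)) * (fstarstar f s - fstar f s) \<partial>lborel)
        \<le> ennreal A * (\<integral>\<^sup>+ s\<in>{0<..<t}. fstar (\<lambda>x. norm (grad f x)) s \<partial>lborel)"
  proof -
    obtain c where c: "0 < c" "\<And>f :: real^'n \<Rightarrow> real. \<And>t. test_fun f \<Longrightarrow> 0 < t \<Longrightarrow>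
      (\<integral>\<^sup>+ s\<in>{0<..<t}. ennreal (s powr (- 1 / n)) * (fstarstar f s - fstar f s) \<partial>lborel)
        \<le> ennreal c * (\<integral>\<^sup>+ x. ennreal (norm (grad f x)) * indicator {x. fstar f t < ennreal \<bar>f x\<bar>} x \<partial>lborel)"
      using test_fun_oscillation_integral_bound[OF dim] unfolding n_def by blast
    show thesis
    proof (rule that[OF c(1)])
      fix f :: "real^'n \<Rightarrow> real" and t :: real assume f: "test_fun f" and t: "0 < t"
      show "(\<integral>\<^sup>+ s\<in>{0<..<t}. ennreal (s powr (- 1 / n)) * (fstarstar f s - fstar f s) \<partial>lborel)
        \<le> ennreal c * (\<integral>\<^sup>+ s\<in>{0<..<t}. fstar (\<lambda>x. norm (grad f x)) s \<partial>lborel)"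
        by (intro order_trans[OF c(2)[OF f t]] mult_left_mono test_fun_gradient_above_level f t) simp
    qed
  qed
  obtain c where c: "0 < c" "\<And>(f :: real^'n \<Rightarrow> real) G. W01 f G \<Longrightarrow>
    lorentz_norm f \<le> ennreal c * (\<integral>\<^sup>+ x. ennreal (norm (G x)) \<partial>lebesgue)"
    using W01_lorentz_norm_bound[OF dim] by blast
  have S1: "\<exists>c>0. \<forall>(f::real^'n \<Rightarrow> real) G. W01 f G \<longrightarrow>
              (\<forall>t>0. ennreal t * enn_powr (emeasure lebesgue {x. t < \<bar>f x\<bar>}) ((n - 1) / n)
                 \<le> ennreal c * (\<integral>\<^sup>+ x. ennreal (norm (G x)) \<partial>lebesgue))"
  proof (intro exI[of _ c] conjI allI impI c(1))
    fix f :: "real^'n \<Rightarrow> real" and G :: "real^'n \<Rightarrow> real^'n" and t :: real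
    assume W: "W01 f G" and t: "0 < t"
    have "f \<in> borel_measurable lebesgue" using W by (auto simp: W01_def)
    from lorentz_norm_weak[OF this t dim]
    have "ennreal t * enn_powr (emeasure lebesgue {x. t < \<bar>f x\<bar>}) ((n - 1) / n) \<le> lorentz_norm f"
      using n by (simp add: n_def[symmetric] diff_divide_distrib)
    also note c(2)[OF W]
    finally show "ennreal t * enn_powr (emeasure lebesgue {x. t < \<bar>f x\<bar>}) ((n - 1) / n)
                 \<le> ennreal c * (\<integral>\<^sup>+ x. ennreal (norm (G x)) \<partial>lebesgue)" .
  qed
  have S2: "\<exists>c>0. \<forall>f::real^'n \<Rightarrow> real. test_fun f \<longrightarrow> (\<forall>t>0.
              (\<integral>\<^sup>+ s \<in> {0<..<t}. ennreal (s powr (- 1 / n)) * (fstarstar f s - fstar f s) \<partial>lborel)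
                 \<le> ennreal (c * n) * (\<integral>\<^sup>+ s \<in> {0<..<t}. fstar (\<lambda>x. norm (grad f x)) s \<partial>lborel))"
    \<comment> \<open>The explicit factor n in (ii) is compensated by the witness
      \<open>A / n\<close>.\<close>
    using A n by (intro exI[of _ "A / n"]) auto
  have S3: "\<forall>\<rho>. ri_norm \<rho> \<longrightarrow> lower_boyd \<rho> > 0 \<longrightarrow>
              (\<exists>C>0. \<forall>f::real^'n \<Rightarrow> real. test_fun f \<longrightarrow>
                 \<rho> (\<lambda>s. ennreal (s powr (- 1 / n)) * (fstarstar f s - fstar f s))
                   \<le> ennreal C * \<rho> (fstar (\<lambda>x. norm (grad f x))))"
    using test_fun_ri_bound[OF dim _ _ A(1) A(2)[unfolded n_def]] unfolding n_def by blast
  have S4: "\<exists>c>0. \<forall>(f::real^'n \<Rightarrow> real) G. W01 f G \<longrightarrow>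
              lorentz_norm f \<le> ennreal c * (\<integral>\<^sup>+ x. ennreal (norm (G x)) \<partial>lebesgue)"
    using c by blast
  show ?thesis unfolding Let_def using S1 S2 S3 S4 by blast
qed

end
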